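(* For every finite sets interpretation $\mathcal{I}=(\delta(X),\phi_\preceq(X,Y))$ (producing structures with a single binary relation $\preceq$), there exists a WMSO-formula $\mathit{Code}(X,x)$ (with a free set variable $X$ and a free first-order variable $x$) such that, whenever for some tree $t$ the structure $\mathcal{I}(t)$ is a finite powerset lattice, the relation $\{(X,x): t\models\mathit{Code}(X,x)\}$, restricted to atoms $X$ of $\mathcal{I}(t)$, is an injective function from the atoms of $\mathcal{I}(t)$ to nodes of $t$: every atom $X$ is related to exactly one node, and distinct atoms are related to distinct nodes.
   Context: A tree labeled by a finite alphabet $\Sigma$ is a partial mapping $t:\{0,1\}^*\to\Sigma$ with prefix-closed domain $\mathit{dom}(t)$ (its nodes) such that $u1\in\mathit{dom}(t)$ implies $u0\in\mathit{dom}(t)$; as a structure it has universe $\mathit{dom}(t)$, binary relations $S_0,S_1$ with $S_i(u,v)$ iff $v=ui$, and a unary predicate for each letter. WMSO is MSO with set variables ranging over finite sets. A finite sets interpretation $(\delta(X),\phi_\preceq(X,Y))$ consists of WMSO formulas with free set variables; $\mathcal{I}(t)$ has universe the finite sets $U\subseteq\mathit{dom}(t)$ with $t\models\delta(U)$ and $\preceq=\{(U,V): t\models\phi_\preceq(U,V)\}$. A structure $(\mathcal{U},\preceq)$ is a finite powerset lattice if it is isomorphic to $(\mathcal{P}^F(E),\subseteq)$ for some set $E$, where $\mathcal{P}^F(E)$ is the set of finite subsets of $E$. Its atoms are the elements having exactly one element strictly smaller with respect to $\preceq$ (corresponding to singletons). *)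

theory Defs
  imports "HOL-Library.Sublist"
begin

text \<open>The binary alphabet {0, 1} is rendered by bool: False is 0, True is 1.\<close>

type_synonym node = "bool list"
type_synonym 'a tree = "node \<rightharpoonup> 'a"

definition is_tree :: "'a tree \<Rightarrow> bool" where
  "is_tree t \<longleftrightarrow>
     (\<forall>u v. v \<in> dom t \<longrightarrow> prefix u v \<longrightarrow> u \<in> dom t) \<and>
     (\<forall>u. u @ [True] \<in> dom t \<longrightarrow> u @ [False] \<in> dom t)"

text \<open>First-order and set variables are both named by natural numbers but live in
  separate name spaces. Disjunction, universal quantification etc. are derived.\<close>

datatype 'a wmso =
    Succ bool nat nat
  | Lab 'a nat
  | Eq nat nat
  | Mem nat nat
  | Neg "'a wmso"
  | Conj "'a wmso" "'a wmso"
  | ExElem nat "'a wmso"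
  | ExSet nat "'a wmso"

fun free_elem :: "'a wmso \<Rightarrow> nat set" where
  "free_elem (Succ i x y) = {x, y}"
| "free_elem (Lab a x) = {x}"
| "free_elem (Eq x y) = {x, y}"
| "free_elem (Mem x X) = {x}"
| "free_elem (Neg \<phi>) = free_elem \<phi>"
| "free_elem (Conj \<phi> \<psi>) = free_elem \<phi> \<union> free_elem \<psi>"
| "free_elem (ExElem x \<phi>) = free_elem \<phi> - {x}"
| "free_elem (ExSet X \<phi>) = free_elem \<phi>"

fun free_set :: "'a wmso \<Rightarrow> nat set" where
  "free_set (Succ i x y) = {}"
| "free_set (Lab a x) = {}"
| "free_set (Eq x y) = {}"
| "free_set (Mem x X) = {X}"
| "free_set (Neg \<phi>) = free_set \<phi>"
| "free_set (Conj \<phi> \<psi>) = free_set \<phi> \<union> free_set \<psi>"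
| "free_set (ExElem x \<phi>) = free_set \<phi>"
| "free_set (ExSet X \<phi>) = free_set \<phi> - {X}"

fun sat :: "'a tree \<Rightarrow> (nat \<Rightarrow> node) \<Rightarrow> (nat \<Rightarrow> node set) \<Rightarrow> 'a wmso \<Rightarrow> bool" where
  "sat t e s (Succ i x y) \<longleftrightarrow> e y = e x @ [i]"
| "sat t e s (Lab a x) \<longleftrightarrow> t (e x) = Some a"
| "sat t e s (Eq x y) \<longleftrightarrow> e x = e y"
| "sat t e s (Mem x X) \<longleftrightarrow> e x \<in> s X"
| "sat t e s (Neg \<phi>) \<longleftrightarrow> \<not> sat t e s \<phi>"
| "sat t e s (Conj \<phi> \<psi>) \<longleftrightarrow> sat t e s \<phi> \<and> sat t e s \<psi>"
| "sat t e s (ExElem x \<phi>) \<longleftrightarrow> (\<exists>u\<in>dom t. sat t (e(x := u)) s \<phi>)"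
| "sat t e s (ExSet X \<phi>) \<longleftrightarrow> (\<exists>U\<in>Fpow (dom t). sat t e (s(X := U)) \<phi>)"

lemma sat_cong:
  assumes "\<And>x. x \<in> free_elem \<phi> \<Longrightarrow> e x = e' x"
    and "\<And>X. X \<in> free_set \<phi> \<Longrightarrow> s X = s' X"
  shows "sat t e s \<phi> \<longleftrightarrow> sat t e' s' \<phi>"
  using assms
proof (induction \<phi> arbitrary: e e' s s')
  case (Conj \<phi> \<psi>)
  have "sat t e s \<phi> \<longleftrightarrow> sat t e' s' \<phi>" "sat t e s \<psi> \<longleftrightarrow> sat t e' s' \<psi>"
    by (rule Conj.IH; simp add: Conj.prems)+
  then show ?case by simp
next
  case (ExElem x \<phi>)
  have "sat t (e(x := u)) s \<phi> \<longleftrightarrow> sat t (e'(x := u)) s' \<phi>" for u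
    by (rule ExElem.IH) (use ExElem.prems in auto)
  then show ?case by simp
next
  case (ExSet X \<phi>)
  have "sat t e (s(X := U)) \<phi> \<longleftrightarrow> sat t e' (s'(X := U)) \<phi>" for U
    by (rule ExSet.IH) (use ExSet.prems in auto)
  then show ?case by simp
next
  case (Neg \<phi>)
  have "sat t e s \<phi> \<longleftrightarrow> sat t e' s' \<phi>"
    by (rule Neg.IH) (use Neg.prems in auto)
  then show ?case by simp
qed auto

text \<open>Instances of \<open>sat\<close> at the declared free variables. By \<open>sat_cong\<close> the default values
  \<open>[]\<close> and \<open>{}\<close> of the remaining variables are irrelevant for the formulas these are used with.\<close>

definition sat_X :: "'a tree \<Rightarrow> 'a wmso \<Rightarrow> node set \<Rightarrow> bool" where
  "sat_X t \<phi> U \<longleftrightarrow> sat t (\<lambda>_. []) ((\<lambda>_. {})(0 := U)) \<phi>"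

definition sat_XY :: "'a tree \<Rightarrow> 'a wmso \<Rightarrow> node set \<Rightarrow> node set \<Rightarrow> bool" where
  "sat_XY t \<phi> U V \<longleftrightarrow> sat t (\<lambda>_. []) ((\<lambda>_. {})(0 := U, 1 := V)) \<phi>"

definition sat_Xx :: "'a tree \<Rightarrow> 'a wmso \<Rightarrow> node set \<Rightarrow> node \<Rightarrow> bool" where
  "sat_Xx t \<phi> U u \<longleftrightarrow> sat t ((\<lambda>_. [])(0 := u)) ((\<lambda>_. {})(0 := U)) \<phi>"

definition finite_sets_interpretation :: "'a wmso \<Rightarrow> 'a wmso \<Rightarrow> bool" where
  "finite_sets_interpretation \<delta> \<phi> \<longleftrightarrow>
     free_elem \<delta> = {} \<and> free_set \<delta> \<subseteq> {0} \<and>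
     free_elem \<phi> = {} \<and> free_set \<phi> \<subseteq> {0, 1}"

text \<open>A structure with one binary relation is a pair of its universe and the relation.\<close>

type_synonym 'b rel_structure = "'b set \<times> 'b rel"

definition interp :: "'a wmso \<Rightarrow> 'a wmso \<Rightarrow> 'a tree \<Rightarrow> node set rel_structure" where
  "interp \<delta> \<phi> t =
     (let A = {U \<in> Fpow (dom t). sat_X t \<delta> U}
      in (A, {(U, V). U \<in> A \<and> V \<in> A \<and> sat_XY t \<phi> U V}))"

definition iso_to_Fpow :: "'b rel_structure \<Rightarrow> 'c set \<Rightarrow> bool" where
  "iso_to_Fpow S E \<longleftrightarrow> (\<exists>h. bij_betw h (fst S) (Fpow E) \<and>
     (\<forall>x\<in>fst S. \<forall>y\<in>fst S. (x, y) \<in> snd S \<longleftrightarrow> h x \<subseteq> h y))"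

text \<open>The set \<open>E\<close> is quantified over the element type of the structure only, as HOL has no
  quantification over types; the lemma \<open>finite_powerset_latticeI\<close> shows that this is no
  restriction.\<close>

definition finite_powerset_lattice :: "'b rel_structure \<Rightarrow> bool" where
  "finite_powerset_lattice S \<longleftrightarrow> (\<exists>E :: 'b set. iso_to_Fpow S E)"

lemma finite_powerset_latticeI:
  fixes S :: "'b rel_structure" and E :: "'c set"
  assumes "iso_to_Fpow S E"
  shows "finite_powerset_lattice S"
proof -
  obtain h where h: "bij_betw h (fst S) (Fpow E)"
    and r: "\<forall>x\<in>fst S. \<forall>y\<in>fst S. (x, y) \<in> snd S \<longleftrightarrow> h x \<subseteq> h y"
    using assms unfolding iso_to_Fpow_def by blast
  define g where "g = (\<lambda>e. inv_into (fst S) h {e})"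
  have hg: "h (g e) = {e}" if "e \<in> E" for e
    unfolding g_def using that
    by (intro bij_betw_inv_into_right[OF h]) (auto simp: Fpow_def)
  have inj: "inj_on g E"
    by (rule inj_onI) (metis hg singleton_inject)
  have "bij_betw (image g) (Fpow E) (Fpow (g ` E))"
    unfolding bij_betw_def
  proof
    show "inj_on (image g) (Fpow E)"
      by (rule inj_on_subset[OF inj_on_image_Pow[OF inj]]) (auto simp: Fpow_def)
    show "image g ` Fpow E = Fpow (g ` E)"
    proof
      show "Fpow (g ` E) \<subseteq> image g ` Fpow E"
      proof
        fix B assume "B \<in> Fpow (g ` E)"
        then obtain C where "C \<subseteq> E" "finite C" "B = g ` C"
          unfolding Fpow_def using finite_subset_image by (metis (no_types, lifting) mem_Collect_eq)
        then show "B \<in> image g ` Fpow E" by (auto simp: Fpow_def)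
      qed
    qed (auto simp: Fpow_def)
  qed
  from bij_betw_trans[OF h this]
  have "bij_betw (\<lambda>x. g ` h x) (fst S) (Fpow (g ` E))" by (simp add: comp_def)
  moreover have "(x, y) \<in> snd S \<longleftrightarrow> g ` h x \<subseteq> g ` h y" if "x \<in> fst S" "y \<in> fst S" for x y
  proof -
    have "h x \<subseteq> E" "h y \<subseteq> E"
      using bij_betwE[OF h] that by (auto simp: Fpow_def)
    then have "g ` h x \<subseteq> g ` h y \<longleftrightarrow> h x \<subseteq> h y"
      using inj unfolding inj_on_def by blast
    then show ?thesis using r that by simp
  qed
  ultimately have "iso_to_Fpow S (g ` E)" unfolding iso_to_Fpow_def by blast
  then show ?thesis unfolding finite_powerset_lattice_def by blast
qed

definition atoms :: "'b rel_structure \<Rightarrow> 'b set" where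
  "atoms S = {x \<in> fst S. \<exists>!y. y \<in> fst S \<and> (y, x) \<in> snd S \<and> y \<noteq> x}"

end

theory Submission
  imports Defs "HOL-Library.Nat_Bijection" "HOL-Library.List_Lexorder" "HOL-Library.FuncSet"
    "HOL-Library.Disjoint_Sets"
begin

text \<open>By the composition method, what a set does inside the subtree at a node matters to the
  outside only up to finitely many classes, uniformly in the tree. If many contents inside and many
  contents outside combined freely to atoms, the joins of subsets of this grid would need too many
  classes; hence for every atom and every node, one of the two sides is determined by its class up
  to a bounded number of choices. Walking from the root towards the side with many choices ends
  after finitely many steps, at the location of the atom.

  A connected region \<open>R\<close> of nodes with \<open>k\<close> boundary edges contains the locations of at most
  \<open>|R| + C k\<close> atoms, because the joins of sets of such atoms are determined by their traces on \<open>R\<close>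
  and a bounded amount of information per boundary edge. So, as in Hall's theorem, the atoms can be
  spread injectively over the nodes, by a flow that moves at most \<open>C\<close> atoms across each edge. The least
  possible upward flow has finite witnesses, so it is definable in WMSO, and so are the routes of the
  individual atoms, once the atoms at a node are enumerated by a definable linear order.\<close>

subsection \<open>Definable predicates\<close>

text \<open>Neither the location of an atom nor Hall's theorem yields a code directly: a location
  may be shared by up to \<open>1 + 3 * bnd N\<close> atoms, and a matching that merely exists in
  each tree is not given by one formula. The injection has to be canonical, and it must be read off
  from finite sets although the tree and the set of atoms may be infinite. This is why finiteness is
  proved at every stage: of the nodes where an atom has many contents, of the support of a
  labelling, of the route of an atom. It is also why every count is bounded by a number that depends
  on the formulas alone: a bounded number can be guessed by a finite disjunction, and a bounded
  tuple of sets by finitely many quantifiers.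

  Upper bounds on numbers of atoms always come from joins: the subsets of \<open>n\<close> atoms
  have \<open>2 ^ n\<close> joins, which the order formula must tell apart. One side of a region
  contributes to this only a colour for each trace that an atom leaves on it; the location is chosen
  such that there are few traces.\<close>

lemma finite_free_elem [simp]: "finite (free_elem \<phi>)"
  by (induction \<phi>) auto

lemma finite_free_set [simp]: "finite (free_set \<phi>)"
  by (induction \<phi>) auto

lemma fresh_nat: "finite A \<Longrightarrow> \<exists>y::nat. y \<notin> A"
  using ex_new_if_finite infinite_UNIV_nat by blast

text \<open>Bound variables are replaced by fresh ones, which avoids capture. The maps
  \<open>f\<close> and \<open>g\<close> are arbitrary, so free variables may also be identified with
  each other; the final formula is obtained in this way.\<close>

lemma wmso_subst:
  "\<exists>\<phi>'. free_elem \<phi>' \<subseteq> f ` free_elem \<phi> \<and> free_set \<phi>' \<subseteq> g ` free_set \<phi> \<and>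
     (\<forall>t e s. sat t e s \<phi>' \<longleftrightarrow> sat t (e \<circ> f) (s \<circ> g) \<phi>)"
proof (induction \<phi> arbitrary: f g)
  case (Succ i x y)
  show ?case by (rule exI[of _ "Succ i (f x) (f y)"]) auto
next
  case (Lab a x)
  show ?case by (rule exI[of _ "Lab a (f x)"]) auto
next
  case (Eq x y)
  show ?case by (rule exI[of _ "Eq (f x) (f y)"]) auto
next
  case (Mem x X)
  show ?case by (rule exI[of _ "Mem (f x) (g X)"]) auto
next
  case (Neg \<phi>)
  obtain \<phi>' where "free_elem \<phi>' \<subseteq> f ` free_elem \<phi>" "free_set \<phi>' \<subseteq> g ` free_set \<phi>"
    "\<forall>t e s. sat t e s \<phi>' \<longleftrightarrow> sat t (e \<circ> f) (s \<circ> g) \<phi>"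
    using Neg.IH by meson
  then show ?case by (intro exI[of _ "Neg \<phi>'"]) (auto simp: o_def)
next
  case (Conj \<phi> \<psi>)
  obtain \<phi>' where "free_elem \<phi>' \<subseteq> f ` free_elem \<phi>" "free_set \<phi>' \<subseteq> g ` free_set \<phi>"
    "\<forall>t e s. sat t e s \<phi>' \<longleftrightarrow> sat t (e \<circ> f) (s \<circ> g) \<phi>"
    using Conj.IH(1) by meson
  moreover obtain \<psi>' where "free_elem \<psi>' \<subseteq> f ` free_elem \<psi>" "free_set \<psi>' \<subseteq> g ` free_set \<psi>"
    "\<forall>t e s. sat t e s \<psi>' \<longleftrightarrow> sat t (e \<circ> f) (s \<circ> g) \<psi>"
    using Conj.IH(2) by meson
  ultimately show ?case by (intro exI[of _ "Conj \<phi>' \<psi>'"]) (auto simp: o_def)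
next
  case (ExElem x \<phi>)
  obtain y where y: "y \<notin> f ` free_elem \<phi>" using fresh_nat by (meson finite_free_elem finite_imageI)
  obtain \<phi>' where *: "free_elem \<phi>' \<subseteq> f(x := y) ` free_elem \<phi>" "free_set \<phi>' \<subseteq> g ` free_set \<phi>"
    "\<forall>t e s. sat t e s \<phi>' \<longleftrightarrow> sat t (e \<circ> f(x := y)) (s \<circ> g) \<phi>"
    using ExElem.IH by meson
  have "sat t (e(y := u) \<circ> f(x := y)) (s \<circ> g) \<phi> \<longleftrightarrow> sat t ((e \<circ> f)(x := u)) (s \<circ> g) \<phi>" for t e s u
    by (rule sat_cong) (use y in auto)
  then have "\<forall>t e s. sat t e s (ExElem y \<phi>') \<longleftrightarrow> sat t (e \<circ> f) (s \<circ> g) (ExElem x \<phi>)"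
    using *(3) by simp
  moreover have "free_elem (ExElem y \<phi>') \<subseteq> f ` free_elem (ExElem x \<phi>)"
    using *(1) by (auto split: if_splits)
  ultimately show ?case using *(2) by (intro exI[of _ "ExElem y \<phi>'"] conjI) (assumption | simp only: free_elem.simps free_set.simps)+
next
  case (ExSet X \<phi>)
  obtain Y where Y: "Y \<notin> g ` free_set \<phi>" using fresh_nat by (meson finite_free_set finite_imageI)
  obtain \<phi>' where *: "free_elem \<phi>' \<subseteq> f ` free_elem \<phi>" "free_set \<phi>' \<subseteq> g(X := Y) ` free_set \<phi>"
    "\<forall>t e s. sat t e s \<phi>' \<longleftrightarrow> sat t (e \<circ> f) (s \<circ> g(X := Y)) \<phi>"
    using ExSet.IH by meson
  have "sat t (e \<circ> f) (s(Y := U) \<circ> g(X := Y)) \<phi> \<longleftrightarrow> sat t (e \<circ> f) ((s \<circ> g)(X := U)) \<phi>" for t e s U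
    by (rule sat_cong) (use Y in auto)
  then have "\<forall>t e s. sat t e s (ExSet Y \<phi>') \<longleftrightarrow> sat t (e \<circ> f) (s \<circ> g) (ExSet X \<phi>)"
    using *(3) by simp
  moreover have "free_set (ExSet Y \<phi>') \<subseteq> g ` free_set (ExSet X \<phi>)"
    using *(2) by (auto split: if_splits)
  ultimately show ?case using *(1) by (intro exI[of _ "ExSet Y \<phi>'"] conjI) (assumption | simp only: free_elem.simps free_set.simps)+
qed

definition env :: "'a tree \<Rightarrow> (nat \<Rightarrow> node) \<Rightarrow> (nat \<Rightarrow> node set) \<Rightarrow> bool" where
  "env t e s \<longleftrightarrow> (\<forall>x. e x \<in> dom t) \<and> (\<forall>X. s X \<in> Fpow (dom t))"

text \<open>One formula has to serve all trees in \<open>TT\<close>. Its free variables are not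
  recorded: a defining formula may contain stray ones, as long as their values in the tree do not
  matter. The empty tree has no \<open>env\<close>, hence imposes no condition.\<close>

definition dfn ::
  "'a tree set \<Rightarrow> ('a tree \<Rightarrow> (nat \<Rightarrow> node) \<Rightarrow> (nat \<Rightarrow> node set) \<Rightarrow> bool) \<Rightarrow> bool" where
  "dfn TT P \<longleftrightarrow> (\<exists>\<phi>. \<forall>t\<in>TT. \<forall>e s. env t e s \<longrightarrow> (sat t e s \<phi> \<longleftrightarrow> P t e s))"

lemma dfnI: "(\<And>t e s. t \<in> TT \<Longrightarrow> env t e s \<Longrightarrow> sat t e s \<phi> \<longleftrightarrow> P t e s) \<Longrightarrow> dfn TT P"
  unfolding dfn_def by blast

lemma dfn_cong:
  assumes "dfn TT P" "\<And>t e s. t \<in> TT \<Longrightarrow> env t e s \<Longrightarrow> P t e s \<longleftrightarrow> Q t e s"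
  shows "dfn TT Q"
  using assms unfolding dfn_def by blast

lemma dfn_succ: "dfn TT (\<lambda>t e s. e y = e x @ [i])"
  by (rule dfnI[of _ "Succ i x y"]) simp

lemma dfn_eq: "dfn TT (\<lambda>t e s. e x = e y)"
  by (rule dfnI[of _ "Eq x y"]) simp

lemma dfn_mem: "dfn TT (\<lambda>t e s. e x \<in> s X)"
  by (rule dfnI[of _ "Mem x X"]) simp

lemma dfn_not: "dfn TT P \<Longrightarrow> dfn TT (\<lambda>t e s. \<not> P t e s)"
  unfolding dfn_def by (metis sat.simps(5))

lemma dfn_conj:
  assumes "dfn TT P" "dfn TT Q"
  shows "dfn TT (\<lambda>t e s. P t e s \<and> Q t e s)"
proof -
  obtain \<phi> \<psi> where "\<forall>t\<in>TT. \<forall>e s. env t e s \<longrightarrow> (sat t e s \<phi> \<longleftrightarrow> P t e s)"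
    "\<forall>t\<in>TT. \<forall>e s. env t e s \<longrightarrow> (sat t e s \<psi> \<longleftrightarrow> Q t e s)"
    using assms unfolding dfn_def by blast
  then show ?thesis by (intro dfnI[of _ "Conj \<phi> \<psi>"]) simp
qed

lemma dfn_const: "dfn TT (\<lambda>t e s. b)"
proof (cases b)
  case True
  then show ?thesis by (intro dfnI[of _ "Eq 0 0"]) simp
next
  case False
  then show ?thesis by (intro dfnI[of _ "Neg (Eq 0 0)"]) simp
qed

lemma dfn_disj:
  assumes "dfn TT P" "dfn TT Q"
  shows "dfn TT (\<lambda>t e s. P t e s \<or> Q t e s)"
proof -
  have "dfn TT (\<lambda>t e s. \<not> (\<not> P t e s \<and> \<not> Q t e s))"
    by (intro dfn_not dfn_conj assms)
  then show ?thesis by simp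
qed

lemma dfn_imp:
  assumes "dfn TT P" "dfn TT Q"
  shows "dfn TT (\<lambda>t e s. P t e s \<longrightarrow> Q t e s)"
proof -
  have "dfn TT (\<lambda>t e s. \<not> P t e s \<or> Q t e s)"
    by (intro dfn_not dfn_disj assms)
  then show ?thesis by simp
qed

lemma dfn_iff:
  assumes "dfn TT P" "dfn TT Q"
  shows "dfn TT (\<lambda>t e s. P t e s \<longleftrightarrow> Q t e s)"
  unfolding iff_conv_conj_imp by (intro dfn_conj dfn_imp assms)

text \<open>The quantifier rules work with de Bruijn indices: the bound variable gets index 0 in the
  premise, and the indices of all other variables are shifted.\<close>

lemma dfn_ex:
  assumes "dfn TT (\<lambda>t e s. Q t (\<lambda>n. e (Suc n)) s (e 0))"
  shows "dfn TT (\<lambda>t e s. \<exists>v\<in>dom t. Q t e s v)"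
proof -
  obtain \<phi> where \<phi>: "\<And>t e s. t \<in> TT \<Longrightarrow> env t e s \<Longrightarrow> sat t e s \<phi> \<longleftrightarrow> Q t (\<lambda>n. e (Suc n)) s (e 0)"
    using assms unfolding dfn_def by blast
  \<comment> \<open>Undoing the shift sends variable \<open>n\<close> of \<phi> to
    \<open>n - 1\<close>; the bound variable must differ from all of these.\<close>
  obtain y where y: "y \<notin> (\<lambda>n. n - 1) ` free_elem \<phi>"
    using fresh_nat by (meson finite_free_elem finite_imageI)
  obtain \<phi>' where \<phi>': "\<And>t e s. sat t e s \<phi>' \<longleftrightarrow> sat t (e \<circ> case_nat y id) (s \<circ> id) \<phi>"
    using wmso_subst by meson
  have "sat t (e(y := v) \<circ> case_nat y id) (s \<circ> id) \<phi> \<longleftrightarrow> Q t e s v"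
    if "t \<in> TT" "env t e s" "v \<in> dom t" for t e s v
  proof -
    have "sat t (e(y := v) \<circ> case_nat y id) (s \<circ> id) \<phi> \<longleftrightarrow> sat t (case_nat v e) s \<phi>"
      by (rule sat_cong) (use y in \<open>auto split: nat.split simp: image_iff\<close>)
    moreover have "env t (case_nat v e) s"
      using that by (auto simp: env_def split: nat.split)
    ultimately show ?thesis using \<phi> that(1) by simp
  qed
  then show ?thesis using \<phi>' by (intro dfnI[of _ "ExElem y \<phi>'"]) auto
qed

lemma dfn_exS:
  assumes "dfn TT (\<lambda>t e s. Q t e (\<lambda>n. s (Suc n)) (s 0))"
  shows "dfn TT (\<lambda>t e s. \<exists>V\<in>Fpow (dom t). Q t e s V)"
proof -
  obtain \<phi> where \<phi>: "\<And>t e s. t \<in> TT \<Longrightarrow> env t e s \<Longrightarrow> sat t e s \<phi> \<longleftrightarrow> Q t e (\<lambda>n. s (Suc n)) (s 0)"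
    using assms unfolding dfn_def by blast
  obtain y where y: "y \<notin> (\<lambda>n. n - 1) ` free_set \<phi>"
    using fresh_nat by (meson finite_free_set finite_imageI)
  obtain \<phi>' where \<phi>': "\<And>t e s. sat t e s \<phi>' \<longleftrightarrow> sat t (e \<circ> id) (s \<circ> case_nat y id) \<phi>"
    using wmso_subst by meson
  have "sat t (e \<circ> id) (s(y := V) \<circ> case_nat y id) \<phi> \<longleftrightarrow> Q t e s V"
    if "t \<in> TT" "env t e s" "V \<in> Fpow (dom t)" for t e s V
  proof -
    have "sat t (e \<circ> id) (s(y := V) \<circ> case_nat y id) \<phi> \<longleftrightarrow> sat t e (case_nat V s) \<phi>"
      by (rule sat_cong) (use y in \<open>auto split: nat.split simp: image_iff\<close>)
    moreover have "env t e (case_nat V s)"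
      using that by (auto simp: env_def split: nat.split)
    ultimately show ?thesis using \<phi> that(1) by simp
  qed
  then show ?thesis using \<phi>' by (intro dfnI[of _ "ExSet y \<phi>'"]) auto
qed

lemma dfn_all:
  assumes "dfn TT (\<lambda>t e s. Q t (\<lambda>n. e (Suc n)) s (e 0))"
  shows "dfn TT (\<lambda>t e s. \<forall>v\<in>dom t. Q t e s v)"
  using dfn_not[OF dfn_ex[of TT "\<lambda>t e s v. \<not> Q t e s v", OF dfn_not[OF assms]]] by simp

lemma dfn_allS:
  assumes "dfn TT (\<lambda>t e s. Q t e (\<lambda>n. s (Suc n)) (s 0))"
  shows "dfn TT (\<lambda>t e s. \<forall>V\<in>Fpow (dom t). Q t e s V)"
  using dfn_not[OF dfn_exS[of TT "\<lambda>t e s v. \<not> Q t e s v", OF dfn_not[OF assms]]] by simp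

lemma dfn_rename:
  assumes "dfn TT P"
  shows "dfn TT (\<lambda>t e s. P t (\<lambda>n. e (f n)) (\<lambda>n. s (g n)))"
proof -
  obtain \<phi> where \<phi>: "\<And>t e s. t \<in> TT \<Longrightarrow> env t e s \<Longrightarrow> sat t e s \<phi> \<longleftrightarrow> P t e s"
    using assms unfolding dfn_def by blast
  obtain \<phi>' where \<phi>': "\<And>t e s. sat t e s \<phi>' \<longleftrightarrow> sat t (e \<circ> f) (s \<circ> g) \<phi>"
    using wmso_subst by meson
  have "env t (e \<circ> f) (s \<circ> g)" if "env t e s" for t e s
    using that by (simp add: env_def)
  then have "sat t (e \<circ> f) (s \<circ> g) \<phi> \<longleftrightarrow> P t (\<lambda>n. e (f n)) (\<lambda>n. s (g n))"
    if "t \<in> TT" "env t e s" for t e s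
    using \<phi>[OF that(1), of "e \<circ> f" "s \<circ> g"] that(2) unfolding o_def by blast
  then show ?thesis by (intro dfnI[of _ \<phi>']) (simp only: \<phi>')
qed

section \<open>Quantification over tuples of finite sets\<close>

definition fam :: "'b set \<Rightarrow> nat \<Rightarrow> (nat \<Rightarrow> 'b set) set" where
  "fam T m = {Z. (\<forall>k<m. Z k \<in> Fpow T) \<and> (\<forall>k\<ge>m. Z k = {})}"

lemma fam_0: "fam T 0 = {\<lambda>_. {}}"
  by (auto simp: fam_def)

lemma fam_in_Fpow: "Z \<in> fam T m \<Longrightarrow> Z k \<in> Fpow T"
  by (cases "k < m") (auto simp: fam_def Fpow_def)

lemma ex_fam_Suc: "(\<exists>Z\<in>fam T (Suc m). P Z) \<longleftrightarrow> (\<exists>Z\<in>fam T m. \<exists>V\<in>Fpow T. P (Z(m := V)))"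
proof
  assume "\<exists>Z\<in>fam T (Suc m). P Z"
  then obtain Z where Z: "Z \<in> fam T (Suc m)" "P Z" by blast
  then have "Z(m := {}) \<in> fam T m" "Z m \<in> Fpow T" by (auto simp: fam_def)
  moreover have "P ((Z(m := {}))(m := Z m))" using Z by simp
  ultimately show "\<exists>Z\<in>fam T m. \<exists>V\<in>Fpow T. P (Z(m := V))" by blast
next
  assume "\<exists>Z\<in>fam T m. \<exists>V\<in>Fpow T. P (Z(m := V))"
  then obtain Z V where "Z \<in> fam T m" "V \<in> Fpow T" "P (Z(m := V))" by blast
  moreover from this have "Z(m := V) \<in> fam T (Suc m)" by (auto simp: fam_def less_Suc_eq)
  ultimately show "\<exists>Z\<in>fam T (Suc m). P Z" by blast
qed

lemma dfn_exF:
  assumes "dfn TT (\<lambda>t e s. Q t e (\<lambda>n. s (n + m)) (\<lambda>k. if k < m then s k else {}))"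
  shows "dfn TT (\<lambda>t e s. \<exists>Z\<in>fam (dom t) m. Q t e s Z)"
  using assms
proof (induction m arbitrary: Q)
  case 0
  then show ?case by (simp add: fam_0)
next
  case (Suc m)
  have "dfn TT (\<lambda>t e s. \<exists>V\<in>Fpow (dom t). Q t e (\<lambda>n. s (n + m)) ((\<lambda>k. if k < m then s k else {})(m := V)))"
  proof (rule dfn_exS)
    \<comment> \<open>The set bound last has index 0, but in the family it is component
      \<open>m\<close>; \<open>?g\<close> is the cycle that moves it there and leaves the outer
      variables fixed.\<close>
    let ?g = "\<lambda>n. if n < m then Suc n else if n = m then 0 else n"
    have "(\<lambda>k. if k < Suc m then s (?g k) else {}) = (\<lambda>k. if k < m then s (Suc k) else {})(m := s 0)"
      for s :: "nat \<Rightarrow> node set" by (auto simp: fun_eq_iff)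
    then show "dfn TT (\<lambda>t e s. Q t e (\<lambda>n. s (Suc (n + m))) ((\<lambda>k. if k < m then s (Suc k) else {})(m := s 0)))"
      using dfn_rename[OF Suc.prems, of id ?g] by simp
  qed
  then have "dfn TT (\<lambda>t e s. \<exists>Z\<in>fam (dom t) m. \<exists>V\<in>Fpow (dom t). Q t e s (Z(m := V)))"
    using Suc.IH[of "\<lambda>t e s Z. \<exists>V\<in>Fpow (dom t). Q t e s (Z(m := V))"] by simp
  then show ?case by (simp add: ex_fam_Suc)
qed

lemma dfn_allF:
  assumes "dfn TT (\<lambda>t e s. Q t e (\<lambda>n. s (n + m)) (\<lambda>k. if k < m then s k else {}))"
  shows "dfn TT (\<lambda>t e s. \<forall>Z\<in>fam (dom t) m. Q t e s Z)"
  using dfn_not[OF dfn_exF[of TT "\<lambda>t e s v. \<not> Q t e s v", OF dfn_not[OF assms]]] by simp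

lemma dfn_all_less:
  fixes m :: nat
  assumes "\<And>k. k < m \<Longrightarrow> dfn TT (P k)"
  shows "dfn TT (\<lambda>t e s. \<forall>k<m. P k t e s)"
  using assms
proof (induction m)
  case 0
  then show ?case by (simp add: dfn_const)
next
  case (Suc m)
  have "(\<forall>k<Suc m. P k t e s) \<longleftrightarrow> (\<forall>k<m. P k t e s) \<and> P m t e s" for t e s
    using less_Suc_eq by auto
  then show ?case using dfn_conj[OF Suc.IH Suc.prems[of m]] Suc.prems by simp
qed

lemma dfn_ex_less:
  fixes m :: nat
  assumes "\<And>k. k < m \<Longrightarrow> dfn TT (P k)"
  shows "dfn TT (\<lambda>t e s. \<exists>k<m. P k t e s)"
  using dfn_not[OF dfn_all_less[of m TT "\<lambda>k t e s. \<not> P k t e s", OF dfn_not[OF assms]]] by simp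

section \<open>Bounded numbers as definable terms\<close>

definition dfnf ::
  "'a tree set \<Rightarrow> ('a tree \<Rightarrow> (nat \<Rightarrow> node) \<Rightarrow> (nat \<Rightarrow> node set) \<Rightarrow> nat) \<Rightarrow> bool" where
  "dfnf TT F \<longleftrightarrow> (\<exists>b. \<forall>t\<in>TT. \<forall>e s. env t e s \<longrightarrow> F t e s < b) \<and> (\<forall>k. dfn TT (\<lambda>t e s. F t e s = k))"

text \<open>A bounded value is guessed by a finite disjunction. So a predicate that is definable for
  each constant can be applied to a definable number, which later allows all flow values to be
  treated as constants.\<close>

lemma dfn_num:
  assumes "dfnf TT F" "\<And>k. dfn TT (\<lambda>t e s. Q k t e s)"
  shows "dfn TT (\<lambda>t e s. Q (F t e s) t e s)"
proof -
  obtain b where "\<forall>t\<in>TT. \<forall>e s. env t e s \<longrightarrow> F t e s < b" using assms unfolding dfnf_def by blast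
  moreover have "dfn TT (\<lambda>t e s. \<exists>k<b. F t e s = k \<and> Q k t e s)"
    using assms by (intro dfn_ex_less dfn_conj) (auto simp: dfnf_def)
  ultimately show ?thesis by (elim dfn_cong) auto
qed

lemma dfnf_const: "dfnf TT (\<lambda>t e s. k)"
  unfolding dfnf_def by (auto simp: dfn_const)

lemma dfn_num2:
  assumes "dfnf TT F" "dfnf TT G"
  shows "dfn TT (\<lambda>t e s. R (F t e s) (G t e s))"
  by (rule dfn_num[OF assms(1)], rule dfn_num[OF assms(2)], rule dfn_const)

text \<open>No arithmetic is expressed in the logic: bounded arguments leave finitely many pairs of
  values, so every operation is a finite table.\<close>

lemma dfnf_op:
  assumes "dfnf TT F" "dfnf TT G"
  shows "dfnf TT (\<lambda>t e s. opr (F t e s) (G t e s))"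
  unfolding dfnf_def
proof (intro conjI allI)
  show "dfn TT (\<lambda>t e s. opr (F t e s) (G t e s) = k)" for k
    by (rule dfn_num2[OF assms])
  obtain b b' where "\<forall>t\<in>TT. \<forall>e s. env t e s \<longrightarrow> F t e s < b" "\<forall>t\<in>TT. \<forall>e s. env t e s \<longrightarrow> G t e s < b'"
    using assms unfolding dfnf_def by blast
  moreover obtain m where "\<forall>x\<in>(\<lambda>(i, j). opr i j) ` ({..<b} \<times> {..<b'}). x < m"
    using finite_nat_set_iff_bounded[of "(\<lambda>(i, j). opr i j) ` ({..<b} \<times> {..<b'})"] by auto
  ultimately have "\<forall>t\<in>TT. \<forall>e s. env t e s \<longrightarrow> opr (F t e s) (G t e s) < m"
    by (auto simp: image_iff)
  then show "\<exists>m. \<forall>t\<in>TT. \<forall>e s. env t e s \<longrightarrow> opr (F t e s) (G t e s) < m" by blast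
qed

lemma dfnf_cong:
  assumes "dfnf TT F" "\<And>t e s. t \<in> TT \<Longrightarrow> env t e s \<Longrightarrow> F t e s = G t e s"
  shows "dfnf TT G"
proof -
  have "dfn TT (\<lambda>t e s. G t e s = k)" for k
  proof -
    have "dfn TT (\<lambda>t e s. F t e s = k)" using assms by (simp add: dfnf_def)
    then show ?thesis by (rule dfn_cong) (use assms in auto)
  qed
  then show ?thesis using assms unfolding dfnf_def by metis
qed

lemma dfnf_count:
  fixes m :: nat
  assumes "\<And>k. k < m \<Longrightarrow> dfn TT (P k)"
  shows "dfnf TT (\<lambda>t e s. card {k. k < m \<and> P k t e s})"
  using assms
proof (induction m)
  case 0
  then show ?case by (simp add: dfnf_const)
next
  case (Suc m)
  have *: "{k. k < Suc m \<and> P k t e s} = {k. k < m \<and> P k t e s} \<union> (if P m t e s then {m} else {})" for t e s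
    by (auto simp: less_Suc_eq)
  have "card {k. k < Suc m \<and> P k t e s} = card {k. k < m \<and> P k t e s} + of_bool (P m t e s)" for t e s
    unfolding * by (subst card_Un_disjoint) auto
  moreover have "dfnf TT (\<lambda>t e s. of_bool (P m t e s))"
  proof -
    have "dfn TT (\<lambda>t e s. of_bool (P m t e s) = k)" for k :: nat
    proof -
      have "dfn TT (\<lambda>t e s. (P m t e s \<and> k = 1) \<or> (\<not> P m t e s \<and> k = 0))"
        by (intro dfn_disj dfn_conj dfn_not dfn_const Suc.prems) simp_all
      then show ?thesis by (rule dfn_cong) auto
    qed
    moreover have "of_bool (P m t e s) < (2::nat)" for t e s by simp
    ultimately show ?thesis unfolding dfnf_def by blast
  qed
  ultimately show ?case using Suc dfnf_op[where opr = "(+)"] by simp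
qed

subsection \<open>Finite index at a cut of the tree\<close>

abbreviation below :: "node \<Rightarrow> node set" where
  "below u \<equiv> {v. prefix u v}"

definition mix :: "'b set \<Rightarrow> 'b set \<Rightarrow> 'b set \<Rightarrow> 'b set" where
  "mix S X Y = X \<inter> S \<union> (Y - S)"

lemma mem_mix [simp]: "v \<in> mix S X Y \<longleftrightarrow> (if v \<in> S then v \<in> X else v \<in> Y)"
  by (auto simp: mix_def)

lemma mix_same [simp]: "mix S X X = X"
  by auto

lemma mix_compl: "mix (- S) X Y = mix S Y X"
  by auto

lemma mix_Fpow: "X \<in> Fpow T \<Longrightarrow> Y \<in> Fpow T \<Longrightarrow> mix S X Y \<in> Fpow T"
  by (auto simp: mix_def Fpow_def)

definition emix :: "nat set \<Rightarrow> (nat \<Rightarrow> node) \<Rightarrow> (nat \<Rightarrow> node) \<Rightarrow> nat \<Rightarrow> node" where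
  "emix I e e' = (\<lambda>x. if x \<in> I then e x else e' x)"

text \<open>Colours are the types of the Feferman-Vaught composition method; \<open>I\<close> is the
  set of first-order variables placed below \<open>u\<close>. An implication is enough, since
  equality of colours is symmetric.\<close>

definition inner_colour ::
  "'a tree \<Rightarrow> node \<Rightarrow> 'a wmso \<Rightarrow> (nat set \<Rightarrow> (nat \<Rightarrow> node) \<Rightarrow> (nat \<Rightarrow> node set) \<Rightarrow> nat) \<Rightarrow> bool" where
  "inner_colour t u \<phi> c \<longleftrightarrow> (\<forall>I e1 s1 e2 s2 e s.
     (\<forall>x\<in>I. prefix u (e1 x) \<and> prefix u (e2 x)) \<longrightarrow> (\<forall>x. x \<notin> I \<longrightarrow> \<not> prefix u (e x)) \<longrightarrow>
     c I e1 s1 = c I e2 s2 \<longrightarrow> sat t (emix I e1 e) (\<lambda>X. mix (below u) (s1 X) (s X)) \<phi> \<longrightarrow>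
     sat t (emix I e2 e) (\<lambda>X. mix (below u) (s2 X) (s X)) \<phi>)"

lemma inner_colourI:
  assumes "\<And>I e1 s1 e2 s2 e s. \<forall>x\<in>I. prefix u (e1 x) \<and> prefix u (e2 x) \<Longrightarrow>
     \<forall>x. x \<notin> I \<longrightarrow> \<not> prefix u (e x) \<Longrightarrow> c I e1 s1 = c I e2 s2 \<Longrightarrow>
     sat t (emix I e1 e) (\<lambda>X. mix (below u) (s1 X) (s X)) \<phi> \<Longrightarrow>
     sat t (emix I e2 e) (\<lambda>X. mix (below u) (s2 X) (s X)) \<phi>"
  shows "inner_colour t u \<phi> c"
  using assms unfolding inner_colour_def by blast

lemma inner_colourD:
  assumes "inner_colour t u \<phi> c" "\<forall>x\<in>I. prefix u (e1 x) \<and> prefix u (e2 x)"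
    "\<forall>x. x \<notin> I \<longrightarrow> \<not> prefix u (e x)" "c I e1 s1 = c I e2 s2"
    "sat t (emix I e1 e) (\<lambda>X. mix (below u) (s1 X) (s X)) \<phi>"
  shows "sat t (emix I e2 e) (\<lambda>X. mix (below u) (s2 X) (s X)) \<phi>"
  using assms unfolding inner_colour_def by blast

text \<open>Induction on the formula. At a quantifier the colour records the set of colours that
  witnesses below \<open>u\<close> can produce, and for a first-order variable also the colour that
  results when its witness lies elsewhere. Encoding pairs and finite sets as numbers keeps one type
  of colours throughout, and \<open>K\<close> depends on the formula only.\<close>

lemma ex_inner_colour:
  "\<exists>K. finite K \<and> (\<forall>t u. \<exists>c. (\<forall>I e s. c I e s \<in> K) \<and> inner_colour t u \<phi> c)"
proof (induction \<phi>)
  case (Succ i x y)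
  \<comment> \<open>The only edge across the cut is the one that enters \<open>u\<close>. So if only
    the target is inside, whether it equals \<open>u\<close> is all the outside has to know.\<close>
  have cut: "w = u" if "prefix u w" "w = v @ [i]" "\<not> prefix u v" for u w v :: node
    using that by (auto simp: prefix_snoc)
  show ?case
  proof (intro exI[of _ "{0, 1}"] conjI allI)
    fix t :: "'a tree" and u
    show "\<exists>c. (\<forall>I e s. c I e s \<in> {0, 1}) \<and> inner_colour t u (Succ i x y) c"
    proof (intro exI conjI allI inner_colourI)
      fix I e1 s1 e2 s2 e s
      assume *: "\<forall>x\<in>I. prefix u (e1 x) \<and> prefix u (e2 x)" "\<forall>x. x \<notin> I \<longrightarrow> \<not> prefix u (e x)"
        "of_bool (if x \<in> I then e1 y = e1 x @ [i] else e1 y = u) =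
          (of_bool (if x \<in> I then e2 y = e2 x @ [i] else e2 y = u) :: nat)"
        "sat t (emix I e1 e) (\<lambda>X. mix (below u) (s1 X) (s X)) (Succ i x y)"
      have eq: "(if x \<in> I then e1 y = e1 x @ [i] else e1 y = u) =
          (if x \<in> I then e2 y = e2 x @ [i] else e2 y = u)"
        using *(3) by (simp only: of_bool_eq_iff)
      show "sat t (emix I e2 e) (\<lambda>X. mix (below u) (s2 X) (s X)) (Succ i x y)"
      proof (cases "x \<in> I")
        case True
        then have "y \<in> I" using *(1,2,4) by (auto simp: emix_def split: if_splits)
        with True *(4) eq show ?thesis by (simp add: emix_def)
      next
        case False
        show ?thesis
        proof (cases "y \<in> I")
          case True
          then have "e1 y = e x @ [i]" using * False by (simp add: emix_def)
          then have "e1 y = u" using cut True False * by blast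
          with False True eq have "e2 y = u" by simp
          with \<open>e1 y = u\<close> \<open>e1 y = e x @ [i]\<close> False True show ?thesis by (simp add: emix_def)
        next
          case False
          with \<open>x \<notin> I\<close> *(4) show ?thesis by (simp add: emix_def)
        qed
      qed
    qed auto
  qed auto
next
  case (Lab a x)
  show ?case
  proof (intro exI[of _ "{0, 1}"] conjI allI)
    fix t :: "'a tree" and u
    show "\<exists>c. (\<forall>I e s. c I e s \<in> {0, 1}) \<and> inner_colour t u (Lab a x) c"
      by (rule exI[of _ "\<lambda>I e s. of_bool (t (e x) = Some a)"]) (auto simp: inner_colour_def emix_def)
  qed auto
next
  case (Eq x y)
  show ?case
  proof (intro exI[of _ "{0, 1}"] conjI allI)
    fix t :: "'a tree" and u
    show "\<exists>c. (\<forall>I e s. c I e s \<in> {0, 1}) \<and> inner_colour t u (Eq x y) c"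
      by (rule exI[of _ "\<lambda>I e s. of_bool (e x = e y)"]) (auto simp: inner_colour_def emix_def split: if_splits)
  qed auto
next
  case (Mem x X)
  show ?case
  proof (intro exI[of _ "{0, 1}"] conjI allI)
    fix t :: "'a tree" and u
    show "\<exists>c. (\<forall>I e s. c I e s \<in> {0, 1}) \<and> inner_colour t u (Mem x X) c"
      by (rule exI[of _ "\<lambda>I e s. of_bool (e x \<in> s X)"]) (auto simp: inner_colour_def emix_def split: if_splits)
  qed auto
next
  case (Neg \<phi>)
  then obtain K where K: "finite K" "\<forall>t u. \<exists>c. (\<forall>I e s. c I e s \<in> K) \<and> inner_colour t u \<phi> c" by blast
  have *: "inner_colour t u (Neg \<phi>) c" if "inner_colour t u \<phi> c" for t u c
  proof (rule inner_colourI)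
    fix I e1 s1 e2 s2 e s
    assume *: "\<forall>x\<in>I. prefix u (e1 x) \<and> prefix u (e2 x)" "\<forall>x. x \<notin> I \<longrightarrow> \<not> prefix u (e x)"
      "c I e1 s1 = c I e2 s2" "sat t (emix I e1 e) (\<lambda>X. mix (below u) (s1 X) (s X)) (Neg \<phi>)"
    then have "\<forall>x\<in>I. prefix u (e2 x) \<and> prefix u (e1 x)" by blast
    from inner_colourD[OF that this *(2) *(3)[symmetric], of s] *(4)
    show "sat t (emix I e2 e) (\<lambda>X. mix (below u) (s2 X) (s X)) (Neg \<phi>)"
      unfolding sat.simps by blast
  qed
  show ?case
  proof (intro exI[of _ K] conjI allI)
    fix t :: "'a tree" and u
    obtain c where c: "\<forall>I e s. c I e s \<in> K" "inner_colour t u \<phi> c"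
      using K by meson
    show "\<exists>c. (\<forall>I e s. c I e s \<in> K) \<and> inner_colour t u (Neg \<phi>) c"
      by (rule exI[of _ c]) (use c * in simp)
  qed (use K in simp)
next
  case (Conj \<phi> \<psi>)
  obtain K1 where K1: "finite K1" "\<forall>t u. \<exists>c. (\<forall>I e s. c I e s \<in> K1) \<and> inner_colour t u \<phi> c"
    using Conj.IH(1) by blast
  obtain K2 where K2: "finite K2" "\<forall>t u. \<exists>c. (\<forall>I e s. c I e s \<in> K2) \<and> inner_colour t u \<psi> c"
    using Conj.IH(2) by blast
  show ?case
  proof (intro exI[of _ "prod_encode ` (K1 \<times> K2)"] conjI allI)
    fix t :: "'a tree" and u
    obtain c1 c2 where c: "\<forall>I e s. c1 I e s \<in> K1" "inner_colour t u \<phi> c1"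
        "\<forall>I e s. c2 I e s \<in> K2" "inner_colour t u \<psi> c2"
      using K1 K2 by meson
    have "inner_colour t u (Conj \<phi> \<psi>) (\<lambda>I e s. prod_encode (c1 I e s, c2 I e s))"
    proof (rule inner_colourI)
      fix I e1 s1 e2 s2 e s
      assume *: "\<forall>x\<in>I. prefix u (e1 x) \<and> prefix u (e2 x)" "\<forall>x. x \<notin> I \<longrightarrow> \<not> prefix u (e x)"
        and eq: "prod_encode (c1 I e1 s1, c2 I e1 s1) = prod_encode (c1 I e2 s2, c2 I e2 s2)"
        and sat: "sat t (emix I e1 e) (\<lambda>X. mix (below u) (s1 X) (s X)) (Conj \<phi> \<psi>)"
      from eq have "c1 I e1 s1 = c1 I e2 s2" "c2 I e1 s1 = c2 I e2 s2" by simp_all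
      from inner_colourD[OF c(2) * this(1)] inner_colourD[OF c(4) * this(2)] sat
      show "sat t (emix I e2 e) (\<lambda>X. mix (below u) (s2 X) (s X)) (Conj \<phi> \<psi>)"
        unfolding sat.simps by blast
    qed
    moreover have "\<forall>I e s. prod_encode (c1 I e s, c2 I e s) \<in> prod_encode ` (K1 \<times> K2)"
      using c by simp
    ultimately show "\<exists>c. (\<forall>I e s. c I e s \<in> prod_encode ` (K1 \<times> K2)) \<and> inner_colour t u (Conj \<phi> \<psi>) c"
      by (intro exI[of _ "\<lambda>I e s. prod_encode (c1 I e s, c2 I e s)"] conjI)
  qed (use K1 K2 in auto)
next
  case (ExElem x \<phi>)
  then obtain K where K: "finite K" "\<forall>t u. \<exists>c. (\<forall>I e s. c I e s \<in> K) \<and> inner_colour t u \<phi> c" by blast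
  let ?K = "prod_encode ` (set_encode ` Pow K \<times> K)"
  show ?case
  proof (intro exI[of _ ?K] conjI allI)
    fix t :: "'a tree" and u
    obtain c where c: "\<forall>I e s. c I e s \<in> K" "inner_colour t u \<phi> c"
      using K by meson
    let ?C = "\<lambda>I e s. {c (insert x I) (e(x := v)) s |v. v \<in> dom t \<and> prefix u v}"
    \<comment> \<open>The variable \<open>x\<close> may already belong to \<open>I\<close>; a
      witness outside overrides this older value, hence \<open>I - {x}\<close>.\<close>
    let ?c = "\<lambda>I e s. prod_encode (set_encode (?C I e s), c (I - {x}) e s)"
    have C: "?C I e s \<subseteq> K" for I e s using c by blast
    have "inner_colour t u (ExElem x \<phi>) ?c"
    proof (rule inner_colourI)
      fix I e1 s1 e2 s2 e s
      assume *: "\<forall>x\<in>I. prefix u (e1 x) \<and> prefix u (e2 x)" "\<forall>x. x \<notin> I \<longrightarrow> \<not> prefix u (e x)"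
        and eq: "?c I e1 s1 = ?c I e2 s2"
        and sat: "sat t (emix I e1 e) (\<lambda>X. mix (below u) (s1 X) (s X)) (ExElem x \<phi>)"
      from eq have "set_encode (?C I e1 s1) = set_encode (?C I e2 s2)" and eq2: "c (I - {x}) e1 s1 = c (I - {x}) e2 s2"
        by simp_all
      then have eq1: "?C I e1 s1 = ?C I e2 s2"
        by (subst (asm) set_encode_eq) (rule finite_subset[OF C K(1)])+
      from sat obtain v where v: "v \<in> dom t"
        "sat t ((emix I e1 e)(x := v)) (\<lambda>X. mix (below u) (s1 X) (s X)) \<phi>" by auto
      show "sat t (emix I e2 e) (\<lambda>X. mix (below u) (s2 X) (s X)) (ExElem x \<phi>)"
      proof (cases "prefix u v")
        case True
        then have "c (insert x I) (e1(x := v)) s1 \<in> ?C I e2 s2" using v eq1 by blast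
        then obtain v2 where v2: "v2 \<in> dom t" "prefix u v2"
          "c (insert x I) (e1(x := v)) s1 = c (insert x I) (e2(x := v2)) s2" by blast
        have m: "emix (insert x I) (e'(x := w)) e = (emix I e' e)(x := w)" for e' w
          by (auto simp: emix_def fun_eq_iff)
        have A: "\<forall>z\<in>insert x I. prefix u ((e1(x := v)) z) \<and> prefix u ((e2(x := v2)) z)"
          using * True v2 by simp
        have B: "\<forall>z. z \<notin> insert x I \<longrightarrow> \<not> prefix u (e z)" using * by simp
        have "sat t (emix (insert x I) (e2(x := v2)) e) (\<lambda>X. mix (below u) (s2 X) (s X)) \<phi>"
          by (rule inner_colourD[OF c(2) A B v2(3)]) (simp only: m v)
        then have "sat t ((emix I e2 e)(x := v2)) (\<lambda>X. mix (below u) (s2 X) (s X)) \<phi>"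
          by (simp only: m)
        then show ?thesis using v2(1) unfolding sat.simps by blast
      next
        case False
        have m: "emix (I - {x}) e' (e(x := v)) = (emix I e' e)(x := v)" for e'
          by (auto simp: emix_def fun_eq_iff)
        have A: "\<forall>z\<in>I - {x}. prefix u (e1 z) \<and> prefix u (e2 z)" using * by simp
        have B: "\<forall>z. z \<notin> I - {x} \<longrightarrow> \<not> prefix u ((e(x := v)) z)" using * False by simp
        have "sat t (emix (I - {x}) e2 (e(x := v))) (\<lambda>X. mix (below u) (s2 X) (s X)) \<phi>"
          by (rule inner_colourD[OF c(2) A B eq2]) (simp only: m v)
        then have "sat t ((emix I e2 e)(x := v)) (\<lambda>X. mix (below u) (s2 X) (s X)) \<phi>"
          by (simp only: m)
        then show ?thesis using v(1) unfolding sat.simps by blast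
      qed
    qed
    moreover have "\<forall>I e s. ?c I e s \<in> ?K"
      using c(1) C by (intro allI imageI) auto
    ultimately show "\<exists>c. (\<forall>I e s. c I e s \<in> ?K) \<and> inner_colour t u (ExElem x \<phi>) c"
      by (intro exI[of _ ?c] conjI)
  qed (use K in auto)
next
  case (ExSet X \<phi>)
  then obtain K where K: "finite K" "\<forall>t u. \<exists>c. (\<forall>I e s. c I e s \<in> K) \<and> inner_colour t u \<phi> c" by blast
  let ?K = "set_encode ` Pow K"
  show ?case
  proof (intro exI[of _ ?K] conjI allI)
    fix t :: "'a tree" and u
    obtain c where c: "\<forall>I e s. c I e s \<in> K" "inner_colour t u \<phi> c"
      using K by meson
    let ?C = "\<lambda>I e s. {c I e (s(X := U)) |U. U \<in> Fpow (dom t)}"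
    let ?c = "\<lambda>I e s. set_encode (?C I e s)"
    have C: "?C I e s \<subseteq> K" for I e s using c by blast
    have "inner_colour t u (ExSet X \<phi>) ?c"
    proof (rule inner_colourI)
      fix I e1 s1 e2 s2 e s
      assume *: "\<forall>x\<in>I. prefix u (e1 x) \<and> prefix u (e2 x)" "\<forall>x. x \<notin> I \<longrightarrow> \<not> prefix u (e x)"
        and eq: "?c I e1 s1 = ?c I e2 s2"
        and sat: "sat t (emix I e1 e) (\<lambda>X. mix (below u) (s1 X) (s X)) (ExSet X \<phi>)"
      from eq have eq1: "?C I e1 s1 = ?C I e2 s2"
        by (subst (asm) set_encode_eq) (rule finite_subset[OF C K(1)])+
      from sat obtain U where U: "U \<in> Fpow (dom t)"
        "sat t (emix I e1 e) ((\<lambda>X. mix (below u) (s1 X) (s X))(X := U)) \<phi>" by auto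
      then have "c I e1 (s1(X := U)) \<in> ?C I e2 s2" using eq1 by blast
      then obtain U2 where U2: "U2 \<in> Fpow (dom t)" "c I e1 (s1(X := U)) = c I e2 (s2(X := U2))" by blast
      have m: "(\<lambda>Y. mix (below u) ((s'(X := V)) Y) ((s(X := U)) Y)) =
          (\<lambda>X. mix (below u) (s' X) (s X))(X := mix (below u) V U)" for s' V
        by (auto simp: fun_eq_iff)
      have "sat t (emix I e2 e) (\<lambda>Y. mix (below u) ((s2(X := U2)) Y) ((s(X := U)) Y)) \<phi>"
        by (rule inner_colourD[OF c(2) *(1) *(2) U2(2)]) (simp only: m mix_same U)
      then have "sat t (emix I e2 e) ((\<lambda>X. mix (below u) (s2 X) (s X))(X := mix (below u) U2 U)) \<phi>"
        unfolding m .
      then show "sat t (emix I e2 e) (\<lambda>X. mix (below u) (s2 X) (s X)) (ExSet X \<phi>)"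
        using mix_Fpow[OF U2(1) U(1)] unfolding sat.simps by blast
    qed
    moreover have "\<forall>I e s. ?c I e s \<in> ?K"
      using C by blast
    ultimately show "\<exists>c. (\<forall>I e s. c I e s \<in> ?K) \<and> inner_colour t u (ExSet X \<phi>) c"
      by (intro exI[of _ ?c] conjI)
  qed (use K in auto)
qed

text \<open>All first-order variables are fixed at \<open>u\<close> and thus count as inner, so that
  only sets have to be coloured. For \<open>u\<close> in the tree this assignment meets the
  requirement of \<open>env\<close>, which matters for formulas with stray variables.\<close>

lemma finite_index:
  "\<exists>N. \<forall>t u. \<exists>c::(nat \<Rightarrow> node set) \<Rightarrow> nat. (\<forall>s. c s < N) \<and>
     (\<forall>s1 s2 s. c s1 = c s2 \<longrightarrow>
        (sat t (\<lambda>_. u) (\<lambda>X. mix (below u) (s1 X) (s X)) \<phi> \<longleftrightarrow>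
         sat t (\<lambda>_. u) (\<lambda>X. mix (below u) (s2 X) (s X)) \<phi>))"
proof -
  obtain K :: "nat set" where K: "finite K" "\<forall>t u. \<exists>c. (\<forall>I e s. c I e s \<in> K) \<and> inner_colour t u \<phi> c"
    using ex_inner_colour[of \<phi>] by (elim exE conjE)
  then obtain N where N: "\<forall>k\<in>K. k < N" using finite_nat_set_iff_bounded[of K] by blast
  show ?thesis
  proof (intro exI[of _ N] allI)
    fix t :: "'a tree" and u
    obtain c where c: "\<forall>I e s. c I e s \<in> K" "inner_colour t u \<phi> c"
      using K by meson
    have m: "emix UNIV (\<lambda>_. u) (\<lambda>_. u) = (\<lambda>_. u)" by (simp add: emix_def)
    have sat: "sat t (\<lambda>_. u) (\<lambda>X. mix (below u) (s2 X) (s X)) \<phi>"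
      if "c UNIV (\<lambda>_. u) s1 = c UNIV (\<lambda>_. u) s2" "sat t (\<lambda>_. u) (\<lambda>X. mix (below u) (s1 X) (s X)) \<phi>" for s1 s2 s
      using inner_colourD[OF c(2) _ _ that(1), of "\<lambda>_. u" s] that(2) by (simp add: m)
    show "\<exists>c::(nat \<Rightarrow> node set) \<Rightarrow> nat. (\<forall>s. c s < N) \<and>
     (\<forall>s1 s2 s. c s1 = c s2 \<longrightarrow>
        (sat t (\<lambda>_. u) (\<lambda>X. mix (below u) (s1 X) (s X)) \<phi> \<longleftrightarrow>
         sat t (\<lambda>_. u) (\<lambda>X. mix (below u) (s2 X) (s X)) \<phi>))"
    proof (intro exI[of _ "c UNIV (\<lambda>_. u)"] conjI allI impI iffI)
      show "c UNIV (\<lambda>_. u) s < N" for s using N c(1) by simp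
    qed (erule sat[rotated], simp)+
  qed
qed

subsection \<open>Locating the atoms\<close>

definition atleast :: "nat \<Rightarrow> 'b set \<Rightarrow> bool" where
  "atleast n S \<longleftrightarrow> (\<exists>F\<subseteq>S. finite F \<and> card F = n)"

lemma atleast_finite: "finite S \<Longrightarrow> atleast n S \<longleftrightarrow> n \<le> card S"
  unfolding atleast_def using card_mono obtain_subset_with_card_n by metis

lemma atleast_infinite: "infinite S \<Longrightarrow> atleast n S"
  unfolding atleast_def using infinite_arbitrarily_large by metis

lemma not_atleast_Suc: "\<not> atleast (Suc n) S \<longleftrightarrow> finite S \<and> card S \<le> n"
  by (cases "finite S") (auto simp: atleast_finite atleast_infinite)

definition eqv :: "node set \<Rightarrow> node set set \<Rightarrow> node \<Rightarrow> node set \<Rightarrow> node set \<Rightarrow> bool" where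
  "eqv T At u X Y \<longleftrightarrow> (\<forall>W\<in>Fpow T. mix (below u) X W \<in> At \<longleftrightarrow> mix (below u) Y W \<in> At)"

text \<open>Since the part outside the subtree is fixed, each member stands for one inner content;
  the class collects the contents that can replace that of \<open>X\<close> in every
  surrounding.\<close>

definition cls :: "node set \<Rightarrow> node set set \<Rightarrow> node \<Rightarrow> node set \<Rightarrow> node set set" where
  "cls T At u X = {Y \<in> Fpow T. Y - below u = X - below u \<and> eqv T At u X Y}"

text \<open>The threshold is the number of colours, from which on \<open>no_grid\<close>
  applies.\<close>

definition many :: "node set \<Rightarrow> node set set \<Rightarrow> nat \<Rightarrow> node \<Rightarrow> node set \<Rightarrow> bool" where
  "many T At N u X \<longleftrightarrow> atleast (Suc N) (cls T At u X)"

text \<open>The deepest node with many contents. The root is the default for atoms without such a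
  node, so location at \<open>[]\<close> does not imply many contents there; the count in a region
  with top \<open>[]\<close> must not rely on it.\<close>

definition located :: "node set \<Rightarrow> node set set \<Rightarrow> nat \<Rightarrow> node set \<Rightarrow> node \<Rightarrow> bool" where
  "located T At N X x \<longleftrightarrow> x \<in> T \<and> (x = [] \<or> many T At N x X) \<and>
     (\<forall>y\<in>T. strict_prefix x y \<longrightarrow> \<not> many T At N y X)"

lemma finite_prefixes: "finite S \<Longrightarrow> finite {u. \<exists>v\<in>S. prefix u v}"
proof -
  assume "finite S"
  moreover have "{u. \<exists>v\<in>S. prefix u v} = (\<Union>v\<in>S. set (prefixes v))" by auto
  ultimately show ?thesis by simp
qed

text \<open>The powerset lattice enters through \<open>join\<close> alone. The relation
  \<open>le\<close> is the order formula on arbitrary sets, not only on the interpreted universe,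
  because joins will be mixed with each other and the mixtures need not satisfy the domain
  formula.\<close>

locale atom_system =
  fixes T :: "node set" and At :: "node set set" and le :: "node set \<Rightarrow> node set \<Rightarrow> bool" and N :: nat
  assumes root: "[] \<in> T"
    and prefix_closed: "v \<in> T \<Longrightarrow> prefix u v \<Longrightarrow> u \<in> T"
    and At_Fpow: "At \<subseteq> Fpow T"
    and join: "finite F \<Longrightarrow> F \<subseteq> At \<Longrightarrow> \<exists>J\<in>Fpow T. \<forall>X\<in>At. le X J \<longleftrightarrow> X \<in> F"
    and colour_At: "u \<in> T \<Longrightarrow> \<exists>c. (\<forall>X. c X < N) \<and>
      (\<forall>X\<in>Fpow T. \<forall>Y\<in>Fpow T. c X = c Y \<longrightarrow> eqv T At u X Y)"
    and colour_le: "u \<in> T \<Longrightarrow> \<exists>c. (\<forall>X J. c X J < N) \<and>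
      (\<forall>X J X' J' W Z. c X J = c X' J' \<longrightarrow>
         le (mix (below u) X W) (mix (below u) J Z) \<longleftrightarrow> le (mix (below u) X' W) (mix (below u) J' Z))"
begin

lemma At_finite: "X \<in> At \<Longrightarrow> finite X"
  using At_Fpow by (auto simp: Fpow_def)

text \<open>All subsets of a grid of atoms would have a join, but the join of the diagonal sees only
  boundedly many different rows.\<close>

lemma no_grid:
  assumes "u \<in> T" "finite A" "card A > N" "finite B" "card B > N"
    and injA: "inj_on (\<lambda>X. X \<inter> below u) A" and injB: "inj_on (\<lambda>X. X - below u) B"
    and grid: "\<And>X Y. X \<in> A \<Longrightarrow> Y \<in> B \<Longrightarrow> mix (below u) X Y \<in> At"
  shows False
proof -
  obtain A' where A': "A' \<subseteq> A" "card A' = Suc N" "finite A'"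
    using assms(3) obtain_subset_with_card_n[of "Suc N" A] by auto
  then obtain b where b: "b ` A' \<subseteq> B" "inj_on b A'"
    using card_le_inj[of A' B] assms by auto
  define F where "F = (\<lambda>X. mix (below u) X (b X)) ` A'"
  have "finite F" "F \<subseteq> At" using A' b grid by (auto simp: F_def)
  from join[OF this] obtain J where "\<forall>X\<in>At. le X J \<longleftrightarrow> X \<in> F" by (elim bexE)
  then have J: "le X J \<longleftrightarrow> X \<in> F" if "X \<in> At" for X using that by simp
  obtain c where c: "\<forall>X J. c X J < N"
    and c': "\<forall>X J X' J' W Z. c X J = c X' J' \<longrightarrow>
       le (mix (below u) X W) (mix (below u) J Z) \<longleftrightarrow> le (mix (below u) X' W) (mix (below u) J' Z)"
    using colour_le[OF assms(1)] by (elim exE conjE)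
  have "\<not> inj_on (\<lambda>X. c X J) A'"
  proof
    assume "inj_on (\<lambda>X. c X J) A'"
    then have "card A' \<le> card {..<N}" using c by (intro card_inj_on_le) auto
    then show False using A' by simp
  qed
  then obtain X Y where XY: "X \<in> A'" "Y \<in> A'" "X \<noteq> Y" "c X J = c Y J" by (auto simp: inj_on_def)
  have "le (mix (below u) X (b X)) J"
    using J[of "mix (below u) X (b X)"] XY A' b grid by (auto simp: F_def)
  then have "le (mix (below u) Y (b X)) J"
    using c'[rule_format, OF XY(4), of "b X" J] by simp
  \<comment> \<open>This atom is off the diagonal, yet below its join. Membership in
    \<open>F\<close> forces its row and its column to belong to one diagonal entry
    \<open>Z\<close>.\<close>
  then have "mix (below u) Y (b X) \<in> F" using J grid XY A' b by blast
  then obtain Z where Z: "Z \<in> A'" "mix (below u) Y (b X) = mix (below u) Z (b Z)"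
    by (auto simp: F_def)
  have "Y \<inter> below u = Z \<inter> below u" using Z(2) by (auto simp: mix_def)
  then have "Y = Z" using injA XY Z A' by (auto dest: inj_onD)
  have "b X - below u = b Z - below u" using Z(2) by (auto simp: mix_def)
  then have "b X = b Z" using injB XY Z b by (meson image_subset_iff inj_onD)
  then have "X = Z" using b XY Z by (auto dest: inj_onD)
  then show False using \<open>Y = Z\<close> XY by simp
qed

abbreviation "D \<equiv> below"
abbreviation "MANY \<equiv> many T At N"
abbreviation "CLS \<equiv> cls T At"

lemma many_obtain:
  assumes "MANY u X"
  obtains A where "A \<subseteq> CLS u X" "finite A" "card A = Suc N"
  using assms unfolding many_def atleast_def by blast

lemma inj_on_inside: "A \<subseteq> CLS u X \<Longrightarrow> inj_on (\<lambda>X. X \<inter> D u) A"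
  by (rule inj_onI) (auto simp: cls_def set_eq_iff, blast+)

lemma cls_At: "Y \<in> CLS u X \<Longrightarrow> X \<in> At \<Longrightarrow> Y \<in> At"
proof -
  assume Y: "Y \<in> CLS u X" and X: "X \<in> At"
  then have "mix (D u) X X \<in> At \<longleftrightarrow> mix (D u) Y X \<in> At"
    using At_Fpow unfolding cls_def eqv_def by blast
  moreover have "mix (D u) Y X = Y" using Y by (auto simp: cls_def set_eq_iff)
  ultimately show "Y \<in> At" using X by simp
qed

lemma cls_mix: "Y \<in> CLS u X \<Longrightarrow> W \<in> Fpow T \<Longrightarrow> mix (D u) X W \<in> At \<Longrightarrow> mix (D u) Y W \<in> At"
  by (auto simp: cls_def eqv_def)

text \<open>A variation below \<open>v\<close> is one below each ancestor \<open>u\<close> as well: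
  a surrounding of \<open>u\<close>, filled up with \<open>X\<close> between \<open>u\<close> and
  \<open>v\<close>, is a surrounding of \<open>v\<close>.\<close>

lemma many_mono:
  assumes "MANY v X" "prefix u v" "X \<in> At"
  shows "MANY u X"
proof -
  have sub: "D v \<subseteq> D u" using assms(2) by (auto intro: prefix_order.trans)
  have "CLS v X \<subseteq> CLS u X"
  proof
    fix Y assume Y: "Y \<in> CLS v X"
    then have out: "Y - D v = X - D v" by (simp add: cls_def)
    have "mix (D u) X W \<in> At \<longleftrightarrow> mix (D u) Y W \<in> At" if "W \<in> Fpow T" for W
    proof -
      have "mix (D u) X W = mix (D v) X (mix (D u) X W)"
        using sub by (auto simp: set_eq_iff subset_iff)
      moreover have "mix (D u) Y W = mix (D v) Y (mix (D u) X W)" using out sub by (auto simp: set_eq_iff subset_iff)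
      moreover have "mix (D u) X W \<in> Fpow T" using that assms(3) At_Fpow mix_Fpow by blast
      ultimately show ?thesis using Y unfolding cls_def eqv_def by auto
    qed
    then show "Y \<in> CLS u X" using Y out sub by (auto simp: cls_def eqv_def)
  qed
  then show ?thesis using assms(1) unfolding many_def atleast_def by blast
qed

text \<open>In two disjoint subtrees the contents can be varied independently of each other, which
  yields a grid with the variants at \<open>u\<close> as rows and those at \<open>v\<close> as
  columns.\<close>

lemma many_chain:
  assumes "MANY u X" "MANY v X" "X \<in> At" "u \<in> T"
  shows "prefix u v \<or> prefix v u"
proof (rule ccontr)
  assume par: "\<not> ?thesis"
  then have disj: "D u \<inter> D v = {}" using prefix_same_cases by auto
  obtain A where A: "A \<subseteq> CLS u X" "finite A" "card A = Suc N" using many_obtain assms by blast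
  obtain B where B: "B \<subseteq> CLS v X" "finite B" "card B = Suc N" using many_obtain assms by blast
  show False
  proof (rule no_grid[OF \<open>u \<in> T\<close> A(2) _ B(2)])
    show "inj_on (\<lambda>X. X \<inter> D u) A" using A inj_on_inside by blast
    show "inj_on (\<lambda>X. X - D u) B"
    proof (rule inj_onI)
      fix Y Z assume YZ: "Y \<in> B" "Z \<in> B" "Y - D u = Z - D u"
      then have "Y \<inter> D v = Z \<inter> D v" using disj by (auto simp: set_eq_iff)
      then show "Y = Z" using inj_on_inside[OF B(1)] YZ by (auto dest: inj_onD)
    qed
    fix Y Z assume YZ: "Y \<in> A" "Z \<in> B"
    then have "Z - D v = X - D v" using B by (auto simp: cls_def)
    then have "mix (D u) X Z = Z" using disj by (auto simp: set_eq_iff)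
    moreover have "Z \<in> At" using YZ B cls_At assms by blast
    ultimately show "mix (D u) Y Z \<in> At" using cls_mix[of Y u X Z] YZ A At_Fpow by auto
  qed (use A B in auto)
qed

text \<open>Infinitely many such nodes escape every finite set. After variants \<open>A\<close> at
  one node \<open>u\<close> have been fixed, there is another such node \<open>v\<close> whose
  subtree meets neither \<open>X\<close> nor any member of \<open>A\<close>. All these sets are then
  empty below \<open>v\<close>, so the variants at \<open>v\<close> combine with every member of
  \<open>A\<close> to a grid. This argument needs atoms to be finite.\<close>

lemma finite_many:
  assumes "X \<in> At"
  shows "finite {u \<in> T. MANY u X}"
proof (rule ccontr)
  assume inf: "infinite {u \<in> T. MANY u X}"
  have ex: "\<exists>u\<in>T. MANY u X \<and> (\<forall>v\<in>S. \<not> prefix u v)" if "finite S" for S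
  proof (rule ccontr)
    assume "\<not> ?thesis"
    then have "{u \<in> T. MANY u X} \<subseteq> {u. \<exists>v\<in>S. prefix u v}" by auto
    then show False using inf finite_prefixes[OF that] finite_subset by blast
  qed
  have "finite X" using assms At_finite by blast
  then obtain u where u: "u \<in> T" "MANY u X" "\<forall>v\<in>X. \<not> prefix u v" using ex by blast
  obtain A where A: "A \<subseteq> CLS u X" "finite A" "card A = Suc N" using many_obtain u by blast
  have A_At: "A \<subseteq> At" using A cls_At assms by blast
  then have "finite (\<Union>A \<union> X \<union> {u})" using A \<open>finite X\<close> At_finite by blast
  then obtain v where v: "v \<in> T" "MANY v X" "\<forall>w\<in>\<Union>A \<union> X \<union> {u}. \<not> prefix v w" using ex by meson
  obtain B where B: "B \<subseteq> CLS v X" "finite B" "card B = Suc N" using many_obtain v by blast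
  show False
  proof (rule no_grid[OF \<open>v \<in> T\<close> B(2) _ A(2)])
    show "inj_on (\<lambda>X. X \<inter> D v) B" using B inj_on_inside by blast
    have "Y - D v = Y" if "Y \<in> A" for Y using v(3) that by auto
    then show "inj_on (\<lambda>X. X - D v) A" by (auto simp: inj_on_def)
    fix Y Z assume YZ: "Y \<in> B" "Z \<in> A"
    then have "mix (D v) X Z = Z" using v(3) by (auto simp: set_eq_iff)
    then show "mix (D v) Y Z \<in> At" using cls_mix[of Y v X Z] YZ B A_At At_Fpow by auto
  qed (use A B in auto)
qed

lemma located_many:
  assumes "located T At N X x" "MANY c X" "c \<in> T" "X \<in> At"
  shows "prefix c x"
proof -
  have "\<not> strict_prefix x c" using assms by (auto simp: located_def)
  moreover have "prefix x c \<or> prefix c x"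
    using assms many_chain[of x X c] by (auto simp: located_def)
  ultimately show ?thesis by (auto simp: strict_prefix_def)
qed

lemma ex1_located:
  assumes "X \<in> At"
  shows "\<exists>!x. located T At N X x"
proof (rule ex_ex1I)
  let ?Q = "{u \<in> T. MANY u X}"
  show "\<exists>x. located T At N X x"
  proof (cases "?Q = {}")
    case True
    then have "located T At N X []" using root by (auto simp: located_def)
    then show ?thesis ..
  next
    case False
    have fin: "finite (length ` ?Q)" using finite_many[OF assms] by simp
    then have "Max (length ` ?Q) \<in> length ` ?Q" using False by (intro Max_in) auto
    then obtain x where x: "x \<in> ?Q" "length x = Max (length ` ?Q)" by auto
    have "\<not> MANY y X" if "y \<in> T" "strict_prefix x y" for y
    proof
      assume "MANY y X"
      then have "length y \<le> length x" using that x(2) fin by (metis (mono_tags, lifting) Max_ge imageI mem_Collect_eq)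
      then show False using that(2) prefix_length_less by fastforce
    qed
    then have "located T At N X x" using x by (auto simp: located_def)
    then show ?thesis ..
  qed
  fix x y assume xy: "located T At N X x" "located T At N X y"
  then have "x = [] \<or> prefix x y" "y = [] \<or> prefix y x"
    using located_many assms unfolding located_def by blast+
  then show "x = y" by (auto dest: prefix_order.antisym)
qed

definition loc :: "node set \<Rightarrow> node" where
  "loc X = (THE x. located T At N X x)"

lemma located_loc: "X \<in> At \<Longrightarrow> located T At N X (loc X)"
  unfolding loc_def by (rule theI') (rule ex1_located)

lemma located_iff: "X \<in> At \<Longrightarrow> located T At N X x \<longleftrightarrow> x = loc X"
  using located_loc ex1_located by blast

lemma loc_in_T: "X \<in> At \<Longrightarrow> loc X \<in> T"
  using located_loc by (simp add: located_def)

end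

subsection \<open>Counting atoms in a region\<close>

lemma set_encode_less: "A \<subseteq> {..<n} \<Longrightarrow> set_encode A < 2 ^ n"
proof -
  assume "A \<subseteq> {..<n}"
  then have "set_encode A \<le> (\<Sum>k<n. 2 ^ k)"
    unfolding set_encode_def by (intro sum_mono2) auto
  also have "\<dots> < (2::nat) ^ n" by (induction n) auto
  finally show ?thesis .
qed

lemma set_encode_inj_below:
  assumes "A \<subseteq> {..<n}" "B \<subseteq> {..<n}" "set_encode A = set_encode B"
  shows "A = B"
proof -
  have "finite A" "finite B" using assms finite_subset by blast+
  then show ?thesis using assms(3) set_encode_eq by blast
qed

text \<open>The cost of one boundary edge: at most \<open>2 ^ N * N\<close> traces of atoms on the
  side behind it, and for each trace a colour out of \<open>2 ^ N\<close>, that is, \<open>N\<close>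
  bits.\<close>

definition bnd :: "nat \<Rightarrow> nat" where
  "bnd N = 2 ^ N * N * N"

definition cuts :: "node set \<Rightarrow> node set \<Rightarrow> node set" where
  "cuts T R = {c \<in> T. c \<notin> R \<and> (\<exists>v\<in>R. \<exists>i. c = v @ [i])}"

lemma finite_cuts: "finite R \<Longrightarrow> finite (cuts T R)"
proof -
  assume "finite R"
  then have "finite ((\<lambda>(v, i). v @ [i]) ` (R \<times> (UNIV :: bool set)))" by simp
  moreover have "cuts T R \<subseteq> (\<lambda>(v, i). v @ [i]) ` (R \<times> UNIV)" by (auto simp: cuts_def)
  ultimately show ?thesis using finite_subset by blast
qed

context atom_system
begin

section \<open>Colours of the sides of a region\<close>

definition side_colour :: "node set \<Rightarrow> nat \<Rightarrow> (node set \<Rightarrow> node set \<Rightarrow> nat) \<Rightarrow> bool" where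
  "side_colour S n c \<longleftrightarrow> (\<forall>X J. c X J < n) \<and>
     (\<forall>X J X' J' W Z. c X J = c X' J' \<longrightarrow> le (mix S X W) (mix S J Z) \<longrightarrow> le (mix S X' W) (mix S J' Z))"

lemma side_colour_imp:
  assumes "side_colour S n c" "c X J = c X' J'" "le (mix S X W) (mix S J Z)"
  shows "le (mix S X' W) (mix S J' Z)"
  by (rule assms(1)[unfolded side_colour_def, THEN conjunct2, rule_format, OF assms(2,3)])

lemma side_colourD:
  assumes "side_colour S n c" "c X J = c X' J'"
  shows "le (mix S X W) (mix S J Z) \<longleftrightarrow> le (mix S X' W) (mix S J' Z)"
  using side_colour_imp[OF assms] side_colour_imp[OF assms(1) assms(2)[symmetric]] by (rule iffI)

lemma side_colour_less: "side_colour S n c \<Longrightarrow> c X J < n"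
  by (simp only: side_colour_def)

lemma ex_side_colour_below:
  assumes "u \<in> T"
  shows "\<exists>c. side_colour (D u) N c"
proof -
  obtain c where c: "\<forall>X J. c X J < N"
    and c': "\<forall>X J X' J' W Z. c X J = c X' J' \<longrightarrow>
       le (mix (below u) X W) (mix (below u) J Z) \<longleftrightarrow> le (mix (below u) X' W) (mix (below u) J' Z)"
    using colour_le[OF assms(1)] by (elim exE conjE)
  have "side_colour (D u) N c"
    unfolding side_colour_def
  proof (intro conjI allI impI)
    show "c X J < N" for X J using c by simp
    fix X J X' J' W Z
    assume "c X J = c X' J'" "le (mix (D u) X W) (mix (D u) J Z)"
    then show "le (mix (D u) X' W) (mix (D u) J' Z)" using c'[rule_format, of X J X' J' W Z] by simp
  qed
  then show ?thesis by (intro exI[of _ c])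
qed

text \<open>The bound \<open>N\<close> is relaxed to \<open>2 ^ N\<close> so that both kinds of
  sides share one number of colours.\<close>

lemma side_below:
  assumes "u \<in> T"
  shows "\<exists>c. side_colour (D u) (2 ^ N) c"
proof -
  obtain c where c: "side_colour (D u) N c" using ex_side_colour_below[OF assms] by (elim exE)
  have "N < 2 ^ N" by simp
  with side_colour_less[OF c] have "\<forall>X J. c X J < 2 ^ N"
    by (meson less_trans)
  then have "side_colour (D u) (2 ^ N) c"
    using c[unfolded side_colour_def, THEN conjunct2] unfolding side_colour_def
    by (intro conjI)
  then show ?thesis by (intro exI[of _ c])
qed

text \<open>The dual colouring: a pair of outer contents is coloured by the set of inner colours
  that complete it to a related pair. This set determines its behaviour, and there are
  \<open>2 ^ N\<close> sets of inner colours.\<close>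

lemma side_outside:
  assumes "u \<in> T"
  shows "\<exists>c. side_colour (- D u) (2 ^ N) c"
proof -
  obtain c where c: "side_colour (D u) N c" using ex_side_colour_below[OF assms] by (elim exE)
  let ?C = "\<lambda>P J. {c X Y |X Y. le (mix (D u) X P) (mix (D u) Y J)}"
  have C: "?C P J \<subseteq> {..<N}" for P J using side_colour_less[OF c] by blast
  have "side_colour (- D u) (2 ^ N) (\<lambda>P J. set_encode (?C P J))"
    unfolding side_colour_def
  proof (intro conjI allI impI)
    show "set_encode (?C P J) < 2 ^ N" for P J by (rule set_encode_less[OF C])
    fix P J P' J' W Z
    assume "set_encode (?C P J) = set_encode (?C P' J')" and le: "le (mix (- D u) P W) (mix (- D u) J Z)"
    then have eq: "?C P J = ?C P' J'" using set_encode_inj_below[OF C C] by blast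
    from le have "c W Z \<in> ?C P J" unfolding mix_compl by blast
    then have "c W Z \<in> ?C P' J'" using eq by blast
    then obtain X Y where XY: "c W Z = c X Y" "le (mix (D u) X P') (mix (D u) Y J')" by blast
    then show "le (mix (- D u) P' W) (mix (- D u) J' Z)"
      unfolding mix_compl using side_colourD[OF c XY(1)] by blast
  qed
  then show ?thesis by (intro exI[of _ "\<lambda>P J. set_encode (?C P J)"])
qed

text \<open>The sides are exchanged one at a time. By disjointness the earlier exchanges leave the
  next side untouched, and equal colours at the trace of \<open>X\<close> make the exchange there
  invisible to \<open>X\<close>.\<close>

lemma le_swap:
  assumes "finite \<S>'" "\<S>' \<subseteq> \<S>" "disjoint \<S>" "\<forall>S\<in>\<S>. side_colour S n (c S)"
    "\<forall>S\<in>\<S>. c S (X \<inter> S) J = c S (X \<inter> S) J'"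
  shows "le X (mix (\<Union>\<S>') J' J) \<longleftrightarrow> le X J"
  using assms(1,2)
proof (induction \<S>' rule: finite_induct)
  case empty
  have "mix {} J' J = J" by auto
  then show ?case by simp
next
  case (insert S \<S>')
  let ?K = "mix (\<Union>\<S>') J' J"
  have "S \<inter> \<Union>\<S>' = {}" using assms(3) insert by (force simp: disjoint_def)
  then have 1: "mix S J ?K = ?K" by (auto simp: set_eq_iff)
  have 2: "mix (\<Union>(insert S \<S>')) J' J = mix S J' ?K" by (auto simp: set_eq_iff)
  have 3: "mix S (X \<inter> S) X = X" by (auto simp: set_eq_iff)
  have "side_colour S n (c S)" "c S (X \<inter> S) J = c S (X \<inter> S) J'" using assms insert by auto
  from side_colourD[OF this, of X ?K]
  have "le X ?K \<longleftrightarrow> le X (mix S J' ?K)" unfolding 1 3 .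
  then show ?case using insert 2 by simp
qed

text \<open>The \<open>2 ^ card F\<close> joins of subsets of \<open>F\<close> are told apart by their traces on \<open>R\<close> together with
  the colours that they induce at the sides.\<close>

lemma card_atoms_le:
  assumes "finite F" "F \<subseteq> At" "finite R" "finite \<S>" "disjoint \<S>"
    and side: "\<forall>S\<in>\<S>. \<exists>c. side_colour S (2 ^ L) c"
    and cover: "T \<subseteq> R \<union> \<Union>\<S>"
    and parts: "\<forall>S\<in>\<S>. card ((\<lambda>X. X \<inter> S) ` F) \<le> M"
  shows "card F \<le> card R + card \<S> * (M * L)"
proof -
  obtain c where c: "\<forall>S\<in>\<S>. side_colour S (2 ^ L) (c S)"
    using bchoice[OF side] by (elim exE)
  have "\<forall>G\<in>Pow F. \<exists>J. J \<in> Fpow T \<and> (\<forall>X\<in>At. le X J \<longleftrightarrow> X \<in> G)"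
  proof
    fix G assume "G \<in> Pow F"
    then have "finite G" "G \<subseteq> At" using assms finite_subset by auto
    from join[OF this] show "\<exists>J. J \<in> Fpow T \<and> (\<forall>X\<in>At. le X J \<longleftrightarrow> X \<in> G)" unfolding Bex_def .
  qed
  from bchoice[OF this] obtain j where "\<forall>G\<in>Pow F. j G \<in> Fpow T \<and> (\<forall>X\<in>At. le X (j G) \<longleftrightarrow> X \<in> G)"
    by (elim exE)
  then have jT: "j G \<subseteq> T" and j: "X \<in> At \<Longrightarrow> le X (j G) \<longleftrightarrow> X \<in> G" if "G \<subseteq> F" for G X
    using that by (auto simp: Fpow_def)
  define par where "par = (\<lambda>S. (\<lambda>X. X \<inter> S) ` F)"
  define \<Theta> where "\<Theta> = (\<lambda>G. (j G \<inter> R, \<lambda>S\<in>\<S>. \<lambda>P\<in>par S. c S P (j G)))"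
  let ?B = "Pow R \<times> PiE \<S> (\<lambda>S. PiE (par S) (\<lambda>_. {..<2 ^ L :: nat}))"
  have fin: "finite (par S)" for S using assms by (simp add: par_def)
  have finB: "finite ?B" using assms fin by (auto intro!: finite_PiE)
  have "\<Theta> ` Pow F \<subseteq> ?B"
    using c side_colour_less by (fastforce simp: \<Theta>_def)
  moreover have "inj_on \<Theta> (Pow F)"
  proof (rule inj_onI)
    fix G H assume GH: "G \<in> Pow F" "H \<in> Pow F" "\<Theta> G = \<Theta> H"
    have R: "j G \<inter> R = j H \<inter> R" using GH by (simp add: \<Theta>_def)
    have eq: "c S (X \<inter> S) (j G) = c S (X \<inter> S) (j H)" if "S \<in> \<S>" "X \<in> F" for S X
    proof -
      have "(\<lambda>S\<in>\<S>. \<lambda>P\<in>par S. c S P (j G)) S (X \<inter> S) = (\<lambda>S\<in>\<S>. \<lambda>P\<in>par S. c S P (j H)) S (X \<inter> S)"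
        using GH(3) by (simp add: \<Theta>_def)
      moreover have "X \<inter> S \<in> par S" using that by (simp add: par_def)
      ultimately show ?thesis using that by simp
    qed
    \<comment> \<open>The two joins agree on \<open>R\<close>, so exchanging all sides turns one
      into the other; by the colours no atom of \<open>F\<close> notices the exchange.\<close>
    have m: "mix (\<Union>\<S>) (j H) (j G) = j H"
      using R cover jT[of G] jT[of H] GH(1,2) by (auto simp: set_eq_iff split: if_splits)
    have "X \<in> G \<longleftrightarrow> X \<in> H" if "X \<in> F" for X
    proof -
      have "le X (mix (\<Union>\<S>) (j H) (j G)) \<longleftrightarrow> le X (j G)"
        by (rule le_swap[where n = "2 ^ L" and c = c and \<S> = \<S>]) (use assms c eq that in simp_all)
      then show ?thesis using m j[of G X] j[of H X] GH that assms(2) by auto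
    qed
    then show "G = H" using GH by auto
  qed
  ultimately have "card (Pow F) \<le> card ?B" using finB card_inj_on_le by blast
  also have "card ?B = 2 ^ card R * (\<Prod>S\<in>\<S>. (2 ^ L) ^ card (par S))"
    using assms fin by (simp add: card_cartesian_product card_Pow card_PiE)
  also have "\<dots> \<le> 2 ^ card R * (\<Prod>S\<in>\<S>. (2 ^ L) ^ M)"
    using parts by (intro mult_left_mono prod_mono) (auto simp: par_def intro!: power_increasing)
  also have "\<dots> = 2 ^ (card R + card \<S> * (M * L))"
    by (simp add: power_add power_mult[symmetric] mult.commute mult.left_commute)
  finally have "(2::nat) ^ card F \<le> 2 ^ (card R + card \<S> * (M * L))"
    using assms by (simp add: card_Pow)
  then show ?thesis by (simp only: power_increasing_iff one_less_numeral_iff semiring_norm)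
qed

section \<open>Traces of atoms on one side of a cut\<close>

lemma card_image_partition:
  fixes q :: "'b \<Rightarrow> nat"
  assumes "finite F" "\<And>X. X \<in> F \<Longrightarrow> q X < n" "\<And>k. k < n \<Longrightarrow> card (f ` {X \<in> F. q X = k}) \<le> m"
  shows "card (f ` F) \<le> n * m"
proof -
  have "f ` F = (\<Union>k<n. f ` {X \<in> F. q X = k})" using assms(2) by auto
  also have "card \<dots> \<le> (\<Sum>k<n. card (f ` {X \<in> F. q X = k}))" by (rule card_UN_le) simp
  also have "\<dots> \<le> (\<Sum>k<n. m)" using assms(3) by (intro sum_mono) simp
  finally show ?thesis by simp
qed

text \<open>Atoms with the same inner colour at \<open>c\<close> have interchangeable contents
  there. Transplanted into the surroundings of one of them, \<open>X0\<close>, these contents all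
  appear in its class, which has at most \<open>N\<close> members; and there are \<open>N\<close>
  colours.\<close>

lemma card_few_parts:
  assumes "c \<in> T" "finite F" "F \<subseteq> At" "\<forall>X\<in>F. \<not> MANY c X"
  shows "card ((\<lambda>X. X \<inter> D c) ` F) \<le> N * N"
proof -
  obtain q where q: "\<forall>X. q X < N" "\<forall>X\<in>Fpow T. \<forall>Y\<in>Fpow T. q X = q Y \<longrightarrow> eqv T At c X Y"
    using colour_At[OF assms(1)] by (elim exE conjE)
  show ?thesis
  proof (rule card_image_partition[OF assms(2), of q])
    fix k
    let ?F = "{X \<in> F. q X = k}"
    show "card ((\<lambda>X. X \<inter> D c) ` ?F) \<le> N"
    proof (cases "?F = {}")
      case False
      then obtain X0 where X0: "X0 \<in> F" "q X0 = k" by blast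
      then have fin: "finite (CLS c X0)" "card (CLS c X0) \<le> N"
        using assms(4) by (auto simp: many_def not_atleast_Suc)
      have "(\<lambda>X. X \<inter> D c) ` ?F \<subseteq> (\<lambda>X. X \<inter> D c) ` CLS c X0"
      proof (intro subsetI, elim imageE)
        fix P X assume X: "P = X \<inter> D c" "X \<in> ?F"
        let ?Y = "mix (D c) X X0"
        have Fp: "X \<in> Fpow T" "X0 \<in> Fpow T" using X X0 assms(3) At_Fpow by auto
        have "eqv T At c X0 X" using q(2)[rule_format, OF Fp(2,1)] X X0 by simp
        moreover have "mix (D c) ?Y W = mix (D c) X W" for W by auto
        ultimately have "eqv T At c X0 ?Y" by (simp add: eqv_def)
        moreover have "?Y - D c = X0 - D c" by auto
        ultimately have "?Y \<in> CLS c X0" using mix_Fpow[OF Fp] by (simp add: cls_def)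
        moreover have "P = ?Y \<inter> D c" using X by auto
        ultimately show "P \<in> (\<lambda>X. X \<inter> D c) ` CLS c X0" by blast
      qed
      then have "card ((\<lambda>X. X \<inter> D c) ` ?F) \<le> card ((\<lambda>X. X \<inter> D c) ` CLS c X0)"
        using fin by (intro card_mono) auto
      also have "\<dots> \<le> card (CLS c X0)" using fin by (intro card_image_le)
      finally show ?thesis using fin by simp
    next
      case True
      show ?thesis unfolding True by simp
    qed
  qed (use q in simp)
qed

text \<open>Outer parts are sorted by the set of inner colours with which they form atoms, which
  gives at most \<open>2 ^ N\<close> groups. Within a group every outer part accepts the same
  contents, in particular the \<open>N + 1\<close> variants of a single atom \<open>X0\<close>; more
  than \<open>N\<close> outer parts would complete a grid.\<close>

lemma card_many_parts:
  assumes "u \<in> T" "finite F" "F \<subseteq> At" "\<forall>X\<in>F. MANY u X"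
  shows "card ((\<lambda>X. X \<inter> - D u) ` F) \<le> 2 ^ N * N"
proof -
  obtain q where q: "\<forall>X. q X < N" "\<forall>X\<in>Fpow T. \<forall>Y\<in>Fpow T. q X = q Y \<longrightarrow> eqv T At u X Y"
    using colour_At[OF assms(1)] by (elim exE conjE)
  let ?Q = "\<lambda>X. {q Y |Y. Y \<in> Fpow T \<and> mix (D u) Y X \<in> At}"
  have Q: "?Q X \<subseteq> {..<N}" for X using q by auto
  show ?thesis
  proof (rule card_image_partition[OF assms(2), of "\<lambda>X. set_encode (?Q X)"])
    show "set_encode (?Q X) < 2 ^ N" for X by (rule set_encode_less[OF Q])
    fix k
    let ?F = "{X \<in> F. set_encode (?Q X) = k}"
    show "card ((\<lambda>X. X \<inter> - D u) ` ?F) \<le> N"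
    proof (cases "?F = {}")
      case False
      then obtain X0 where X0: "X0 \<in> F" "set_encode (?Q X0) = k" by blast
      obtain A where A: "A \<subseteq> CLS u X0" "finite A" "card A = Suc N"
        using many_obtain assms(4) X0 by blast
      have grid: "mix (D u) Y X \<in> At" if Y: "Y \<in> A" and X: "X \<in> ?F" for X Y
      proof -
        have Fp: "X0 \<in> Fpow T" "X \<in> Fpow T" "Y \<in> Fpow T"
          using X X0 assms(3) At_Fpow Y A by (auto simp: cls_def)
        have "mix (D u) Y X0 \<in> At" using cls_mix[of Y u X0 X0] Y A Fp X0 assms(3) by auto
        then have "q Y \<in> ?Q X0" using Fp by blast
        moreover have "?Q X0 = ?Q X" using set_encode_inj_below[OF Q Q] X X0 by blast
        ultimately obtain Y' where Y': "q Y = q Y'" "Y' \<in> Fpow T" "mix (D u) Y' X \<in> At" by blast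
        then show ?thesis using q(2) Fp unfolding eqv_def by metis
      qed
      obtain B where B: "B \<subseteq> ?F" "inj_on (\<lambda>X. X \<inter> - D u) B" "(\<lambda>X. X \<inter> - D u) ` ?F = (\<lambda>X. X \<inter> - D u) ` B"
        using subset_image_inj[of "(\<lambda>X. X \<inter> - D u) ` ?F" "\<lambda>X. X \<inter> - D u" ?F] by auto
      have finB: "finite B" using B(1) assms(2) finite_subset by fastforce
      have "card B \<le> N"
      proof (rule ccontr)
        assume "\<not> ?thesis"
        moreover have "inj_on (\<lambda>X. X - D u) B" using B(2) by (simp add: Diff_eq)
        ultimately show False
          using no_grid[OF assms(1) A(2) _ finB _ inj_on_inside[OF A(1)]] grid B(1) A(3) by auto
      qed
      then show ?thesis using B(3) card_image[OF B(2)] by simp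
    next
      case True
      show ?thesis unfolding True by simp
    qed
  qed
qed

text \<open>Every side carries few traces, for opposite reasons. An atom located in \<open>R\<close>
  cannot have many contents at a cut \<open>c\<close>, since its location would then lie below
  \<open>c\<close>. If \<open>u\<close> is not the root, its location is not the root either, so it
  has many contents there and by monotonicity at \<open>u\<close>. If \<open>u\<close> is the root,
  there is no outer side to be counted.\<close>

lemma card_region:
  assumes "finite R" "R \<subseteq> T" "u \<in> R" "\<forall>v\<in>R. prefix u v"
    and convex: "\<And>v w. v \<in> R \<Longrightarrow> prefix u w \<Longrightarrow> prefix w v \<Longrightarrow> w \<in> R"
    and F: "finite F" "F \<subseteq> At" "\<forall>X\<in>F. loc X \<in> R"
  shows "card F \<le> card R + (card (cuts T R) + (if u = [] then 0 else 1)) * bnd N"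
proof -
  have uT: "u \<in> T" using assms(2,3) by blast
  define \<S> where "\<S> = D ` cuts T R \<union> (if u = [] then {} else {- D u})"
  have above: "prefix u c" if "c \<in> cuts T R" for c
    using that assms(4) by (auto simp: cuts_def intro: prefix_order.trans)
  have noprefix: "\<not> prefix c v" if "c \<in> cuts T R" "v \<in> R" for c v
    using that convex[OF that(2) above[OF that(1)]] by (auto simp: cuts_def)
  have "disjoint \<S>"
  proof -
    have "c = c'" if "c \<in> cuts T R" "c' \<in> cuts T R" "prefix c v" "prefix c' v" for c c' v
    proof -
      have "c = c'" if "prefix c c'" "c \<in> cuts T R" "c' \<in> cuts T R" for c c'
        using that noprefix[OF that(2)] by (auto simp: cuts_def prefix_snoc)
      then show ?thesis using that prefix_same_cases by blast
    qed
    moreover have "D c \<inter> - D u = {}" if "c \<in> cuts T R" for c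
      using above[OF that] by (auto intro: prefix_order.trans)
    ultimately show ?thesis by (fastforce simp: \<S>_def disjoint_def)
  qed
  moreover have "finite \<S>" using finite_cuts[OF assms(1)] by (simp add: \<S>_def)
  moreover have "\<forall>S\<in>\<S>. \<exists>c. side_colour S (2 ^ N) c"
    using side_below side_outside[OF uT] by (auto simp: \<S>_def cuts_def)
  moreover have "T \<subseteq> R \<union> \<Union>\<S>"
  proof
    fix v assume "v \<in> T"
    show "v \<in> R \<union> \<Union>\<S>"
    proof (cases "prefix u v")
      case False
      then show ?thesis by (auto simp: \<S>_def)
    next
      case True
      with \<open>v \<in> T\<close> have "v \<in> R \<or> (\<exists>c\<in>cuts T R. prefix c v)"
      proof (induction v rule: rev_induct)
        case Nil
        then show ?case using assms(3) by simp
      next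
        case (snoc i w)
        show ?case
        proof (cases "u = w @ [i]")
          case True
          then show ?thesis using assms(3) by simp
        next
          case False
          then have "prefix u w" "w \<in> T" using snoc.prems prefix_closed[OF snoc.prems(1)] by (auto simp: prefix_snoc)
          then have "w \<in> R \<or> (\<exists>c\<in>cuts T R. prefix c w)" using snoc.IH by simp
          then show ?thesis using snoc.prems(1) by (auto simp: cuts_def)
        qed
      qed
      then show ?thesis by (auto simp: \<S>_def)
    qed
  qed
  moreover have "\<forall>S\<in>\<S>. card ((\<lambda>X. X \<inter> S) ` F) \<le> 2 ^ N * N"
  proof
    fix S assume "S \<in> \<S>"
    then consider c where "c \<in> cuts T R" "S = D c" | "u \<noteq> []" "S = - D u"
      by (auto simp: \<S>_def split: if_splits)
    then show "card ((\<lambda>X. X \<inter> S) ` F) \<le> 2 ^ N * N"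
    proof cases
      case 1
      then have "c \<in> T" by (simp add: cuts_def)
      have "\<not> MANY c X" if "X \<in> F" for X
        using located_many[OF located_loc, of X c] noprefix[OF 1(1), of "loc X"] F that \<open>c \<in> T\<close> by blast
      then have "card ((\<lambda>X. X \<inter> D c) ` F) \<le> N * N"
        using card_few_parts[OF \<open>c \<in> T\<close> F(1,2)] by blast
      also have "\<dots> \<le> 2 ^ N * N" by (intro mult_right_mono) (auto intro: less_imp_le)
      finally show ?thesis using 1 by simp
    next
      case 2
      have "MANY u X" if "X \<in> F" for X
      proof -
        have X: "X \<in> At" "prefix u (loc X)" using F that assms(4) by auto
        then have "MANY (loc X) X" using located_loc[OF X(1)] 2(1) by (auto simp: located_def)
        then show ?thesis using many_mono X by blast
      qed
      then show ?thesis using card_many_parts[OF uT F(1,2)] 2 by simp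
    qed
  qed
  ultimately have "card F \<le> card R + card \<S> * (2 ^ N * N * N)"
    using card_atoms_le[OF F(1,2) assms(1)] by blast
  also have "card \<S> \<le> card (cuts T R) + (if u = [] then 0 else 1)"
    unfolding \<S>_def using card_image_le[OF finite_cuts[OF assms(1)], of D]
    by (intro order.trans[OF card_Un_le] add_mono) auto
  finally show ?thesis by (simp add: bnd_def)
qed

end

subsection \<open>Distributing the atoms over the nodes\<close>

definition chv :: "node set \<Rightarrow> (node \<Rightarrow> nat) \<Rightarrow> node \<Rightarrow> bool \<Rightarrow> nat" where
  "chv T F v i = (if v @ [i] \<in> T then F (v @ [i]) else 0)"

lemma chv_mono: "(\<And>v. F v \<le> G v) \<Longrightarrow> chv T F v i \<le> chv T G v i"
  by (simp add: chv_def)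

text \<open>\<open>l v - C\<close> is a lower bound, with a finite witness, on the number of atoms that have to leave the
  subtree at \<open>v\<close> upwards if no node may keep more than one atom; negative values stand for free
  capacity, which is cut off at \<open>C\<close>.\<close>

definition labelling :: "node set \<Rightarrow> (node \<Rightarrow> nat) \<Rightarrow> nat \<Rightarrow> (node \<Rightarrow> nat) \<Rightarrow> bool" where
  "labelling T g C l \<longleftrightarrow> {v. l v > 0} \<in> Fpow T \<and>
     (\<forall>v\<in>T. l v > 0 \<longrightarrow> l v + 1 + chv T (\<lambda>_. C) v False + chv T (\<lambda>_. C) v True
        \<le> g v + C + chv T l v False + chv T l v True)"

definition eta :: "node set \<Rightarrow> (node \<Rightarrow> nat) \<Rightarrow> nat \<Rightarrow> node \<Rightarrow> nat" where
  "eta T g C u = Max {l u |l. labelling T g C l}"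

text \<open>Up to \<open>fall\<close> atoms can move from outside into the subtree at a node, and \<open>rise\<close> atoms have to
  leave it.\<close>

definition fall :: "node set \<Rightarrow> (node \<Rightarrow> nat) \<Rightarrow> nat \<Rightarrow> node \<Rightarrow> nat" where
  "fall T g C u = C - eta T g C u"

definition rise :: "node set \<Rightarrow> (node \<Rightarrow> nat) \<Rightarrow> nat \<Rightarrow> node \<Rightarrow> nat" where
  "rise T g C u = eta T g C u - C"

definition own :: "node set \<Rightarrow> (node \<Rightarrow> nat) \<Rightarrow> nat \<Rightarrow> node \<Rightarrow> nat" where
  "own T g C u = fall T g C u + chv T (rise T g C) u False + chv T (rise T g C) u True"

text \<open>The atoms passing through a node \<open>u\<close> occupy numbered places: first those falling into \<open>u\<close>, then
  those rising from child 0 and from child 1, and from \<open>own u\<close> on the atoms located at \<open>u\<close>. The atom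
  at place 0 stays, the next ones fall into child 0, then into child 1, and the remaining ones rise.\<close>

definition move :: "node set \<Rightarrow> (node \<Rightarrow> nat) \<Rightarrow> nat \<Rightarrow> node \<Rightarrow> nat \<Rightarrow> node \<Rightarrow> nat \<Rightarrow> bool" where
  "move T g C u k w m \<longleftrightarrow> 0 < k \<and>
     (let a = chv T (fall T g C) u False; b = chv T (fall T g C) u True in
      (k \<le> a \<and> w = u @ [False] \<and> m = k - 1) \<or>
      (a < k \<and> k \<le> a + b \<and> w = u @ [True] \<and> m = k - 1 - a) \<or>
      (a + b < k \<and> u = w @ [False] \<and> m = fall T g C w + (k - 1 - a - b)) \<or>
      (a + b < k \<and> u = w @ [True] \<and>
         m = fall T g C w + chv T (rise T g C) w False + (k - 1 - a - b)))"

definition closed_under_move :: "node set \<Rightarrow> (node \<Rightarrow> nat) \<Rightarrow> nat \<Rightarrow> (nat \<Rightarrow> node set) \<Rightarrow> bool" where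
  "closed_under_move T g C Z \<longleftrightarrow> (\<forall>u\<in>T. \<forall>k<3 * C + 2. u \<in> Z k \<longrightarrow>
     (\<forall>w\<in>T. \<forall>m<3 * C + 2. move T g C u k w m \<longrightarrow> w \<in> Z m))"

locale flow_system =
  fixes T :: "node set" and g :: "node \<Rightarrow> nat" and C :: nat
  assumes root_T: "[] \<in> T"
    and T_closed: "v \<in> T \<Longrightarrow> prefix u v \<Longrightarrow> u \<in> T"
    and region: "finite R \<Longrightarrow> R \<subseteq> T \<Longrightarrow> u \<in> R \<Longrightarrow> \<forall>v\<in>R. prefix u v \<Longrightarrow>
      \<forall>v\<in>R. \<forall>w. prefix u w \<longrightarrow> prefix w v \<longrightarrow> w \<in> R \<Longrightarrow>
      (\<Sum>v\<in>R. g v) \<le> card R + (card (cuts T R) + (if u = [] then 0 else 1)) * C"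
begin

abbreviation "LAB \<equiv> labelling T g C"
abbreviation "\<eta> \<equiv> eta T g C"
abbreviation "fl \<equiv> fall T g C"
abbreviation "ri \<equiv> rise T g C"
abbreviation "ow \<equiv> own T g C"

text \<open>In terms of \<open>f = l - C\<close> the condition at a positive node is that
  \<open>f v + 1\<close> is at most \<open>g v\<close> plus the values of \<open>f\<close> at the
  children. It is summed over the nodes \<open>R\<close> reached from \<open>u\<close> downwards
  through positive nodes: the inner values cancel, and each cut contributes \<open>- C\<close>,
  which pays for its edge in the assumption \<open>region\<close>. What remains is \<open>C\<close>
  for the edge above \<open>u\<close>, and 0 at the root.\<close>

lemma labelling_le:
  assumes "LAB l"
  shows "l u \<le> C + (if u = [] then 0 else C)"
proof (cases "l u = 0")
  case False
  have fin: "finite {v. l v > 0}" and sub: "{v. l v > 0} \<subseteq> T"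
    using assms by (auto simp: labelling_def Fpow_def)
  define R where "R = {v. prefix u v \<and> (\<forall>w. prefix u w \<longrightarrow> prefix w v \<longrightarrow> l w > 0)}"
  have R_pos: "l v > 0" if "v \<in> R" for v using that by (auto simp: R_def)
  have "finite R" by (rule finite_subset[OF _ fin]) (use R_pos in blast)
  have "R \<subseteq> T" using R_pos sub by blast
  have uR: "u \<in> R" using False by (auto simp: R_def dest: prefix_order.antisym)
  have uv: "\<forall>v\<in>R. prefix u v" by (simp add: R_def)
  have convex: "\<forall>v\<in>R. \<forall>w. prefix u w \<longrightarrow> prefix w v \<longrightarrow> w \<in> R"
    by (auto simp: R_def intro: prefix_order.trans)
  define ch where "ch = (\<lambda>v. {c \<in> T. \<exists>i. c = v @ [i]})"
  define f where "f = (\<lambda>c. int (l c) - int C)"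
  have step: "f v \<le> int (g v) - 1 + (\<Sum>c\<in>ch v. f c)" if "v \<in> R" for v
  proof -
    have "ch v = (if v @ [False] \<in> T then {v @ [False]} else {}) \<union> (if v @ [True] \<in> T then {v @ [True]} else {})"
      by (auto simp: ch_def ex_bool_eq)
    then have "(\<Sum>c\<in>ch v. f c) = (if v @ [False] \<in> T then f (v @ [False]) else 0) + (if v @ [True] \<in> T then f (v @ [True]) else 0)"
      by simp
    moreover have "l v + 1 + chv T (\<lambda>_. C) v False + chv T (\<lambda>_. C) v True \<le> g v + C + chv T l v False + chv T l v True"
      using assms R_pos[OF that] that \<open>R \<subseteq> T\<close> by (auto simp: labelling_def)
    ultimately show ?thesis by (auto simp: f_def chv_def split: if_splits)
  qed
  have Un: "(\<Union>v\<in>R. ch v) = (R - {u}) \<union> cuts T R"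
  proof (intro equalityI subsetI)
    fix c assume "c \<in> (\<Union>v\<in>R. ch v)"
    then obtain v i where "v \<in> R" "c \<in> T" "c = v @ [i]" by (auto simp: ch_def)
    moreover have "c \<noteq> u" using uv \<open>v \<in> R\<close> \<open>c = v @ [i]\<close> by (metis append_self_conv not_Cons_self2 prefix_order.antisym prefixI)
    ultimately show "c \<in> (R - {u}) \<union> cuts T R" by (auto simp: cuts_def)
  next
    fix c assume "c \<in> (R - {u}) \<union> cuts T R"
    then consider "c \<in> R" "c \<noteq> u" | "c \<in> cuts T R" by blast
    then show "c \<in> (\<Union>v\<in>R. ch v)"
    proof cases
      case 1
      then have "prefix u c" using uv by blast
      with 1 obtain w i where w: "c = w @ [i]" "prefix u w"
        by (cases c rule: rev_cases) (auto simp: prefix_snoc)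
      then have "w \<in> R" using convex 1 by (metis prefixI)
      then show ?thesis using w 1 \<open>R \<subseteq> T\<close> by (auto simp: ch_def)
    qed (auto simp: cuts_def ch_def)
  qed
  have zero: "l c = 0" if c: "c \<in> cuts T R" for c
  proof (rule ccontr)
    assume "l c \<noteq> 0"
    obtain v i where v: "v \<in> R" "c = v @ [i]" using c unfolding cuts_def by blast
    have "c \<in> R" using v \<open>l c \<noteq> 0\<close> by (auto simp: R_def prefix_snoc)
    then show False using c by (simp add: cuts_def)
  qed
  have "(\<Sum>v\<in>R. f v) \<le> (\<Sum>v\<in>R. int (g v) - 1 + (\<Sum>c\<in>ch v. f c))"
    using step by (rule sum_mono)
  also have "\<dots> = int (\<Sum>v\<in>R. g v) - int (card R) + (\<Sum>v\<in>R. \<Sum>c\<in>ch v. f c)"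
    by (simp add: sum.distrib sum_subtractf)
  also have "(\<Sum>v\<in>R. \<Sum>c\<in>ch v. f c) = (\<Sum>c\<in>(\<Union>v\<in>R. ch v). f c)"
  proof (rule sum.UNION_disjoint[symmetric])
    have "ch v \<subseteq> (\<lambda>i. v @ [i]) ` UNIV" for v by (auto simp: ch_def)
    then show "\<forall>v\<in>R. finite (ch v)" by (meson finite finite_imageI finite_subset)
  qed (use \<open>finite R\<close> in \<open>auto simp: ch_def\<close>)
  also have "\<dots> = (\<Sum>c\<in>R - {u}. f c) + (\<Sum>c\<in>cuts T R. f c)"
    unfolding Un using \<open>finite R\<close> finite_cuts by (intro sum.union_disjoint) (auto simp: cuts_def)
  also have "(\<Sum>c\<in>cuts T R. f c) = - (int (card (cuts T R)) * int C)"
    using zero by (simp add: f_def)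
  finally have "f u \<le> int (\<Sum>v\<in>R. g v) - int (card R) - int (card (cuts T R)) * int C"
    using \<open>finite R\<close> uR by (simp add: sum.remove)
  also have "int (\<Sum>v\<in>R. g v) \<le> int (card R + (card (cuts T R) + (if u = [] then 0 else 1)) * C)"
    using region[OF \<open>finite R\<close> \<open>R \<subseteq> T\<close> uR uv convex] by (simp only: of_nat_le_iff)
  finally show ?thesis by (auto simp: f_def algebra_simps split: if_splits)
qed simp

lemma labelling_zero: "LAB (\<lambda>_. 0)"
  by (simp add: labelling_def Fpow_def)

text \<open>Raising labels elsewhere only enlarges the right-hand sides. Owing to this, optimal
  labels at both children of a node are attained by one labelling.\<close>

lemma labelling_max:
  assumes "LAB l1" "LAB l2"
  shows "LAB (\<lambda>v. max (l1 v) (l2 v))"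
proof -
  have "chv T l1 v i \<le> chv T (\<lambda>v. max (l1 v) (l2 v)) v i" "chv T l2 v i \<le> chv T (\<lambda>v. max (l1 v) (l2 v)) v i" for v i
    by (rule chv_mono, simp)+
  note * = this
  have "{v. max (l1 v) (l2 v) > 0} = {v. l1 v > 0} \<union> {v. l2 v > 0}" by auto
  then have "{v. max (l1 v) (l2 v) > 0} \<in> Fpow T" using assms by (auto simp: labelling_def Fpow_def)
  moreover have "max (l1 v) (l2 v) + 1 + chv T (\<lambda>_. C) v False + chv T (\<lambda>_. C) v True
        \<le> g v + C + chv T (\<lambda>v. max (l1 v) (l2 v)) v False + chv T (\<lambda>v. max (l1 v) (l2 v)) v True"
    if "v \<in> T" "max (l1 v) (l2 v) > 0" for v
  proof (cases "l1 v \<ge> l2 v")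
    case True
    then have "l1 v > 0" using that by simp
    then have "l1 v + 1 + chv T (\<lambda>_. C) v False + chv T (\<lambda>_. C) v True \<le> g v + C + chv T l1 v False + chv T l1 v True"
      using assms that by (simp add: labelling_def)
    then show ?thesis using True *(1)[of v False] *(1)[of v True] by (simp add: max_def)
  next
    case False
    then have "l2 v > 0" using that by simp
    then have "l2 v + 1 + chv T (\<lambda>_. C) v False + chv T (\<lambda>_. C) v True \<le> g v + C + chv T l2 v False + chv T l2 v True"
      using assms that by (simp add: labelling_def)
    then show ?thesis using False *(2)[of v False] *(2)[of v True] by (simp add: max_def)
  qed
  ultimately show ?thesis unfolding labelling_def by blast
qed

lemma finite_labels: "finite {l u |l. LAB l}"
proof (rule finite_subset)
  show "{l u |l. LAB l} \<subseteq> {..C + C}"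
  proof (clarsimp)
    fix l assume "LAB l"
    from labelling_le[OF this, of u] show "l u \<le> C + C" by (simp split: if_splits)
  qed
qed simp

lemma eta_attained: "\<exists>l. LAB l \<and> l u = \<eta> u"
proof -
  have "\<eta> u \<in> {l u |l. LAB l}"
    unfolding eta_def by (rule Max_in[OF finite_labels]) (use labelling_zero in blast)
  then obtain l where "\<eta> u = l u" "LAB l" by blast
  then show ?thesis by (intro exI[of _ l]) simp
qed

lemma le_eta: "LAB l \<Longrightarrow> l u \<le> \<eta> u"
  unfolding eta_def by (rule Max_ge[OF finite_labels]) blast

lemma eta_le: "\<eta> u \<le> C + (if u = [] then 0 else C)"
proof -
  obtain l where "LAB l" "l u = \<eta> u" using eta_attained[of u] by blast
  with labelling_le[of l u] show ?thesis by simp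
qed

text \<open>A labelling optimal at both children is raised at \<open>u\<close> as far as the
  condition at \<open>u\<close> permits. The condition at the parent can only profit, so the result
  is again a labelling, and \<open>eta\<close> is at least its value at \<open>u\<close>.\<close>

lemma eta_flow:
  assumes "u \<in> T"
  shows "g u + C + chv T \<eta> u False + chv T \<eta> u True
    \<le> 1 + chv T (\<lambda>_. C) u False + chv T (\<lambda>_. C) u True + \<eta> u"
proof -
  obtain l0 where l0: "LAB l0" "l0 (u @ [False]) = \<eta> (u @ [False])" using eta_attained by blast
  obtain l1 where l1: "LAB l1" "l1 (u @ [True]) = \<eta> (u @ [True])" using eta_attained by blast
  define l where "l = (\<lambda>v. max (l0 v) (l1 v))"
  have l: "LAB l" using labelling_max[OF l0(1) l1(1)] by (simp add: l_def)
  have ch: "chv T \<eta> u i \<le> chv T l u i" for i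
    using l0(2) l1(2) by (cases i) (auto simp: chv_def l_def)
  \<comment> \<open>The largest label that the condition at \<open>u\<close> admits. If the
    difference is truncated to 0, it cannot exceed \<open>l u\<close>, and no new labelling is
    needed.\<close>
  define val where "val = g u + C + chv T l u False + chv T l u True
    - (1 + chv T (\<lambda>_. C) u False + chv T (\<lambda>_. C) u True)"
  have "val \<le> \<eta> u"
  proof (cases "val \<le> l u")
    case True
    then show ?thesis using le_eta[OF l, of u] by simp
  next
    case False
    define l' where "l' = l(u := val)"
    have up: "l v \<le> l' v" for v using False by (simp add: l'_def)
    have chup: "chv T l v i \<le> chv T l' v i" for v i by (rule chv_mono) (rule up)
    have chu: "chv T l' u i = chv T l u i" for i by (simp add: chv_def l'_def)
    have "{v. l' v > 0} \<subseteq> insert u {v. l v > 0}" by (auto simp: l'_def)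
    moreover have "finite (insert u {v. l v > 0})" "insert u {v. l v > 0} \<subseteq> T"
      using l assms by (auto simp: labelling_def Fpow_def)
    ultimately have "{v. l' v > 0} \<in> Fpow T" by (auto simp: Fpow_def intro: finite_subset)
    moreover have "l' v + 1 + chv T (\<lambda>_. C) v False + chv T (\<lambda>_. C) v True
        \<le> g v + C + chv T l' v False + chv T l' v True" if "v \<in> T" "l' v > 0" for v
    proof (cases "v = u")
      case True
      then show ?thesis using False chu by (simp add: l'_def val_def)
    next
      case False
      then have "l v + 1 + chv T (\<lambda>_. C) v False + chv T (\<lambda>_. C) v True
        \<le> g v + C + chv T l v False + chv T l v True"
        using l that by (simp add: labelling_def l'_def)
      then show ?thesis using False chup[of v False] chup[of v True] by (simp add: l'_def)
    qed
    ultimately have "LAB l'" unfolding labelling_def by blast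
    from le_eta[OF this, of u] show ?thesis by (simp add: l'_def)
  qed
  then show ?thesis using ch[of False] ch[of True] by (simp add: val_def)
qed

text \<open>Capacity at a node: the atoms that arrive, plus those located there, fit into one
  staying place, the falls to the children and the rise to the parent. It restates
  \<open>eta_flow\<close>, since \<open>fall\<close> and \<open>rise\<close> are the negative and
  the positive part of \<open>eta - C\<close>.\<close>

lemma flow:
  assumes "u \<in> T"
  shows "ow u + g u \<le> 1 + chv T fl u False + chv T fl u True + ri u"
proof -
  have "chv T \<eta> u i + chv T fl u i = chv T (\<lambda>_. C) u i + chv T ri u i" for i
    by (cases "C \<le> \<eta> (u @ [i])") (simp_all add: chv_def fall_def rise_def)
  from this[of False] this[of True] eta_flow[OF assms] show ?thesis
    by (simp add: own_def fall_def rise_def)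
qed

lemma fl_le: "fl u \<le> C" and ri_le: "ri u \<le> C" and ri_root: "ri [] = 0"
proof -
  have "\<eta> u \<le> C + C" "\<eta> [] \<le> C" using eta_le[of u] eta_le[of "[]"] by (simp_all split: if_splits)
  then show "fl u \<le> C" "ri u \<le> C" "ri [] = 0" unfolding fall_def rise_def by linarith+
qed

text \<open>No edge is used in both directions, so an atom that has started to fall never rises
  again; this rules out endless routes.\<close>

lemma fl_ri: "fl u = 0 \<or> ri u = 0"
  by (auto simp: fall_def rise_def)

section \<open>Routes of single atoms\<close>

definition conf :: "node \<times> nat \<Rightarrow> bool" where
  "conf p \<longleftrightarrow> fst p \<in> T \<and> snd p < ow (fst p) + g (fst p)"

definition mv :: "((node \<times> nat) \<times> (node \<times> nat)) set" where
  "mv = {((u, k), (w, m)). conf (u, k) \<and> move T g C u k w m}"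

lemma chv_le: "(\<And>v. F v \<le> c) \<Longrightarrow> chv T F u i \<le> c"
  by (simp add: chv_def)

text \<open>By \<open>flow\<close> a node has at most \<open>1 + C + C + C\<close> places. A
  constant bound is essential: a route is described by one set of nodes for each place
  number.\<close>

lemma conf_less: "conf (u, k) \<Longrightarrow> k < 3 * C + 2"
proof -
  assume "conf (u, k)"
  then have "u \<in> T" "k < ow u + g u" by (auto simp: conf_def)
  with flow[of u] chv_le[of fl C u False, OF fl_le] chv_le[of fl C u True, OF fl_le] ri_le[of u]
  show ?thesis by linarith
qed

lemma mv_cases:
  assumes "((u, k), (w, m)) \<in> mv"
  obtains (falling) i where "w = u @ [i]" "w \<in> T" "m < fl w" "m < k"
      "k = 1 + m + (if i then chv T fl u False else 0)"
  | (rising) i where "u = w @ [i]" "w \<in> T" "fl w + (if i then chv T ri w False else 0) \<le> m"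
      "m < fl w + (if i then chv T ri w False else 0) + ri u" "chv T fl u False + chv T fl u True < k"
      "k = 1 + chv T fl u False + chv T fl u True + (m - (fl w + (if i then chv T ri w False else 0)))"
proof -
  let ?a = "chv T fl u False" and ?b = "chv T fl u True"
  have c: "u \<in> T" "k < ow u + g u" and "move T g C u k w m" using assms by (auto simp: mv_def conf_def)
  then consider "0 < k" "k \<le> ?a" "w = u @ [False]" "m = k - 1"
    | "0 < k" "?a < k" "k \<le> ?a + ?b" "w = u @ [True]" "m = k - 1 - ?a"
    | "?a + ?b < k" "u = w @ [False]" "m = fl w + (k - 1 - ?a - ?b)"
    | "?a + ?b < k" "u = w @ [True]" "m = fl w + chv T ri w False + (k - 1 - ?a - ?b)"
    unfolding move_def Let_def by blast
  then show ?thesis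
  proof cases
    case 1
    then have "w \<in> T" by (auto simp: chv_def split: if_splits)
    then show ?thesis using 1 by (intro falling[of False]) (auto simp: chv_def)
  next
    case 2
    then have "w \<in> T" by (auto simp: chv_def split: if_splits)
    then show ?thesis using 2 by (intro falling[of True]) (auto simp: chv_def)
  next
    case 3
    then have "w \<in> T" using c T_closed[of u w] by simp
    then show ?thesis using 3 flow[OF c(1)] c(2) by (intro rising[of False]) auto
  next
    case 4
    then have "w \<in> T" using c T_closed[of u w] by simp
    then show ?thesis using 4 flow[OF c(1)] c(2) by (intro rising[of True]) auto
  qed
qed

lemma mv_ex:
  assumes "conf (u, k)" "0 < k"
  shows "\<exists>w m. ((u, k), (w, m)) \<in> mv"
proof -
  let ?a = "chv T fl u False" and ?b = "chv T fl u True"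
  have c: "u \<in> T" "k < ow u + g u" using assms(1) by (auto simp: conf_def)
  consider "k \<le> ?a" | "?a < k" "k \<le> ?a + ?b" | "?a + ?b < k" by linarith
  then show ?thesis
  proof cases
    case 3
    then have "ri u > 0" using flow[OF c(1)] c(2) by linarith
    then have "u \<noteq> []" using ri_root by auto
    then obtain w i where "u = w @ [i]" by (metis rev_exhaust)
    with 3 assms show ?thesis by (cases i) (auto simp: mv_def move_def Let_def)
  qed (use assms in \<open>auto simp: mv_def move_def Let_def\<close>)
qed

lemma mv_conf: "(p, q) \<in> mv \<Longrightarrow> conf q"
proof -
  assume pq: "(p, q) \<in> mv"
  obtain u k w m where [simp]: "p = (u, k)" "q = (w, m)" by fastforce
  have uT: "u \<in> T" using pq by (auto simp: mv_def conf_def)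
  from pq have "((u, k), (w, m)) \<in> mv" by simp
  then show "conf q"
  proof (cases rule: mv_cases)
    case (falling i)
    then show ?thesis by (simp add: conf_def own_def)
  next
    case (rising i)
    have "chv T ri w i = ri u" using rising uT by (simp add: chv_def)
    then show ?thesis using rising by (cases i) (auto simp: conf_def own_def)
  qed
qed

lemma mv_deterministic: "single_valued mv"
  by (rule single_valuedI) (auto simp: mv_def move_def Let_def)

text \<open>Places from \<open>ow w\<close> on are never entered by a move, so the starting places
  of atoms are starts of maximal routes.\<close>

lemma mv_not_own: "((u, k), (w, m)) \<in> mv \<Longrightarrow> m < ow w"
proof -
  assume mv: "((u, k), (w, m)) \<in> mv"
  then have uT: "u \<in> T" by (auto simp: mv_def conf_def)
  from mv show ?thesis
  proof (cases rule: mv_cases)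
    case (falling i)
    then show ?thesis by (simp add: own_def)
  next
    case (rising i)
    have "chv T ri w i = ri u" using rising uT by (simp add: chv_def)
    then show ?thesis using rising by (cases i) (auto simp: own_def)
  qed
qed

text \<open>Arrivals from the parent, from child 0 and from child 1 fill three consecutive intervals
  of places, so a place reveals its origin; within one interval the numbering is a shift.\<close>

lemma mv_injective: "single_valued (mv\<inverse>)"
proof (rule single_valuedI)
  fix q p p' assume "(q, p) \<in> mv\<inverse>" "(q, p') \<in> mv\<inverse>"
  moreover obtain u k u' k' w m where [simp]: "p = (u, k)" "p' = (u', k')" "q = (w, m)" by (metis surj_pair)
  ultimately have mv: "((u, k), (w, m)) \<in> mv" and mv': "((u', k'), (w, m)) \<in> mv" by auto
  then have T: "u \<in> T" "u' \<in> T" by (auto simp: mv_def conf_def)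
  from mv show "p = p'"
  proof (cases rule: mv_cases)
    case (falling i)
    note f = falling
    from mv' show ?thesis
    proof (cases rule: mv_cases)
      case (falling i')
      then show ?thesis using f by auto
    next
      case (rising i')
      then show ?thesis using f by auto
    qed
  next
    case (rising i)
    note r = rising
    have ri: "chv T ri w i = ri u" using r T by (simp add: chv_def)
    from mv' show ?thesis
    proof (cases rule: mv_cases)
      case (falling i')
      then show ?thesis using r by auto
    next
      case (rising i')
      have "chv T ri w i' = ri u'" using rising T by (simp add: chv_def)
      then have "i = i'" using ri r rising by (cases i; cases i') auto
      then show ?thesis using r rising by auto
    qed
  qed
qed

text \<open>A falling atom loses one place per step, while a rising atom has to turn at the root at the latest.\<close>

lemma wf_mv: "wf (mv\<inverse>)"
proof (rule wf_subset)
  show "wf (inv_image (less_than <*lex*> less_than) (\<lambda>(u, k). (if k < fl u then 0 else Suc (length u), k)))"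
    by (intro wf_inv_image wf_lex_prod wf_less_than)
  show "mv\<inverse> \<subseteq> inv_image (less_than <*lex*> less_than) (\<lambda>(u, k). (if k < fl u then 0 else Suc (length u), k))"
  proof (intro subrelI)
    fix q p assume "(q, p) \<in> mv\<inverse>"
    moreover obtain u k w m where [simp]: "p = (u, k)" "q = (w, m)" by (metis surj_pair)
    ultimately have mv: "((u, k), (w, m)) \<in> mv" by auto
    then show "(q, p) \<in> inv_image (less_than <*lex*> less_than) (\<lambda>(u, k). (if k < fl u then 0 else Suc (length u), k))"
    proof (cases rule: mv_cases)
      case (falling i)
      then show ?thesis by auto
    next
      case (rising i)
      then have "ri u > 0" by linarith
      then have "fl u = 0" using fl_ri[of u] by simp
      then show ?thesis using rising by auto
    qed
  qed
qed

text \<open>Besides the existence of an end, the finiteness of the whole route is needed: it makes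
  the route accessible to quantifiers over finite sets.\<close>

lemma terminates:
  "conf p \<Longrightarrow> finite {q. (p, q) \<in> mv\<^sup>*} \<and> (\<exists>y\<in>T. (p, (y, 0)) \<in> mv\<^sup>*)"
  using wf_mv
proof (induction p rule: wf_induct_rule)
  case (less p)
  obtain u k where p: "p = (u, k)" by fastforce
  show ?case
  proof (cases "k = 0")
    case True
    have "{q. (p, q) \<in> mv\<^sup>*} = {p}"
      using True p by (auto elim: converse_rtranclE simp: mv_def move_def)
    then show ?thesis using less.prems True p by (auto simp: conf_def)
  next
    case False
    then obtain q where q: "(p, q) \<in> mv" using mv_ex less.prems p by blast
    have IH: "finite {r. (q, r) \<in> mv\<^sup>*}" "\<exists>y\<in>T. (q, (y, 0)) \<in> mv\<^sup>*"
      using less.IH[of q] q mv_conf by auto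
    have "{r. (p, r) \<in> mv\<^sup>*} \<subseteq> insert p {r. (q, r) \<in> mv\<^sup>*}"
    proof
      fix r assume "r \<in> {r. (p, r) \<in> mv\<^sup>*}"
      then consider "r = p" | z where "(p, z) \<in> mv" "(z, r) \<in> mv\<^sup>*"
        by (blast elim: converse_rtranclE)
      then show "r \<in> insert p {r. (q, r) \<in> mv\<^sup>*}"
        using single_valuedD[OF mv_deterministic q] by cases auto
    qed
    then have "finite {r. (p, r) \<in> mv\<^sup>*}" using IH(1) finite_subset by blast
    moreover have "\<exists>y\<in>T. (p, (y, 0)) \<in> mv\<^sup>*"
      using IH(2) q by (meson converse_rtrancl_into_rtrancl)
    ultimately show ?thesis ..
  qed
qed

lemma no_mv_from_0: "((y, 0), q) \<notin> mv"
  by (cases q) (simp add: mv_def move_def)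

lemma end_unique:
  assumes "(p, (y, 0)) \<in> mv\<^sup>*" "(p, (z, 0)) \<in> mv\<^sup>*"
  shows "y = z"
proof -
  have "((y, 0), (z, 0)) \<in> mv\<^sup>* \<or> ((z, 0), (y, 0)) \<in> mv\<^sup>*"
    using single_valued_confluent[OF mv_deterministic assms] .
  then show ?thesis by (auto elim: converse_rtranclE simp: no_mv_from_0)
qed

text \<open>Followed backwards from \<open>q\<close>, moves are deterministic, so one start lies on
  the route of the other; but nothing moves into a start.\<close>

lemma start_unique:
  assumes "((x, ow x + i), q) \<in> mv\<^sup>*" "((y, ow y + j), q) \<in> mv\<^sup>*"
  shows "x = y \<and> i = j"
proof -
  have no: "(p, (z, ow z + n)) \<notin> mv" for p z n
    using mv_not_own by (cases p) fastforce
  have "(q, (x, ow x + i)) \<in> (mv\<inverse>)\<^sup>*" "(q, (y, ow y + j)) \<in> (mv\<inverse>)\<^sup>*"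
    using assms by (simp_all add: rtrancl_converse)
  from single_valued_confluent[OF mv_injective this]
  have "((x, ow x + i), (y, ow y + j)) \<in> mv\<^sup>* \<or> ((y, ow y + j), (x, ow x + i)) \<in> mv\<^sup>*"
    by (auto simp: rtrancl_converse)
  then have "(x, ow x + i) = (y, ow y + j)"
    using no by (metis rtranclE)
  then show ?thesis by auto
qed

text \<open>Reachability as membership in all closed families, where component \<open>k\<close>
  holds the nodes visited at place \<open>k\<close>. Restricting to families of finite sets does no
  harm because the route itself is such a family, and it is the least closed one.\<close>

lemma reaches_iff:
  assumes "conf (u, k)"
  shows "(\<forall>Z\<in>fam T (3 * C + 2). closed_under_move T g C Z \<longrightarrow> u \<in> Z k \<longrightarrow> y \<in> Z 0) \<longleftrightarrow>
    ((u, k), (y, 0)) \<in> mv\<^sup>*"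
proof
  assume "((u, k), (y, 0)) \<in> mv\<^sup>*"
  moreover have "conf q \<and> fst q \<in> Z (snd q)"
    if "((u, k), q) \<in> mv\<^sup>*" "closed_under_move T g C Z" "u \<in> Z k" for q Z
    using that(1)
  proof (induction rule: rtrancl_induct)
    case base
    then show ?case using that assms by simp
  next
    case (step p q)
    obtain v n w m where [simp]: "p = (v, n)" "q = (w, m)" by (metis surj_pair)
    have "conf q" using step mv_conf by blast
    moreover have "w \<in> Z m"
      using step that(2) conf_less[of v n] conf_less[of w m] \<open>conf q\<close>
      by (auto simp: closed_under_move_def conf_def mv_def)
    ultimately show ?case by simp
  qed
  ultimately show "\<forall>Z\<in>fam T (3 * C + 2). closed_under_move T g C Z \<longrightarrow> u \<in> Z k \<longrightarrow> y \<in> Z 0"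
    by fastforce
next
  assume R: "\<forall>Z\<in>fam T (3 * C + 2). closed_under_move T g C Z \<longrightarrow> u \<in> Z k \<longrightarrow> y \<in> Z 0"
  define Z where "Z = (\<lambda>n. {w. ((u, k), (w, n)) \<in> mv\<^sup>*})"
  have conf: "conf (w, n)" if "w \<in> Z n" for w n
    using that assms mv_conf by (auto simp: Z_def elim: rtranclE)
  have fin: "finite (Z n)" for n
  proof -
    have "Z n \<subseteq> fst ` {q. ((u, k), q) \<in> mv\<^sup>*}" by (force simp: Z_def)
    then show ?thesis using terminates[OF assms] finite_subset by blast
  qed
  have "Z \<in> fam T (3 * C + 2)"
    using fin conf conf_less by (fastforce simp: fam_def Fpow_def conf_def)
  moreover have "closed_under_move T g C Z"
    unfolding closed_under_move_def
  proof (intro ballI allI impI)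
    fix v n w m assume "v \<in> Z n" "move T g C v n w m"
    then have "((v, n), (w, m)) \<in> mv" using conf by (simp add: mv_def)
    then show "w \<in> Z m" using \<open>v \<in> Z n\<close> by (auto simp: Z_def intro: rtrancl_into_rtrancl)
  qed
  ultimately have "y \<in> Z 0" using R by (auto simp: Z_def)
  then show "((u, k), (y, 0)) \<in> mv\<^sup>*" by (simp add: Z_def)
qed

end

subsection \<open>The code of an atom\<close>

definition tokens :: "node set \<Rightarrow> node set set \<Rightarrow> nat \<Rightarrow> node \<Rightarrow> nat" where
  "tokens T At N x = card {X \<in> At. located T At N X x}"

text \<open>The largest difference decides, in the lexicographic order of nodes. Distinct finite
  sets always have one, whatever the order of the nodes looks like.\<close>

definition set_less :: "node set \<Rightarrow> node set \<Rightarrow> node set \<Rightarrow> bool" where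
  "set_less T X Y \<longleftrightarrow> (\<exists>m\<in>T. m \<notin> X \<and> m \<in> Y \<and> (\<forall>k\<in>T. m < k \<longrightarrow> (k \<in> X \<longleftrightarrow> k \<in> Y)))"

definition rank :: "node set \<Rightarrow> node set set \<Rightarrow> nat \<Rightarrow> node \<Rightarrow> node set \<Rightarrow> nat" where
  "rank T At N x X = card {Y \<in> At. located T At N Y x \<and> set_less T Y X}"

text \<open>The right-hand side of \<open>reaches_iff\<close> is a statement about routes; this is
  its left-hand side, spelled out for the starting place of \<open>X\<close>, since in this form it
  can be translated into a formula.\<close>

definition encodes :: "node set \<Rightarrow> node set set \<Rightarrow> nat \<Rightarrow> node set \<Rightarrow> node \<Rightarrow> bool" where
  "encodes T At N X y \<longleftrightarrow>
     (\<forall>Z\<in>fam T (3 * bnd N + 2). closed_under_move T (tokens T At N) (bnd N) Z \<longrightarrow>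
        (\<exists>x\<in>T. located T At N X x \<and> x \<in> Z (own T (tokens T At N) (bnd N) x + rank T At N x X)) \<longrightarrow>
        y \<in> Z 0)"

lemma set_less_irrefl: "\<not> set_less T X X"
  by (auto simp: set_less_def)

lemma set_less_trans:
  assumes "set_less T X Y" "set_less T Y Z"
  shows "set_less T X Z"
proof -
  obtain m where m: "m \<in> T" "m \<notin> X" "m \<in> Y" "\<forall>k\<in>T. m < k \<longrightarrow> (k \<in> X \<longleftrightarrow> k \<in> Y)"
    using assms(1) unfolding set_less_def by blast
  obtain n where n: "n \<in> T" "n \<notin> Y" "n \<in> Z" "\<forall>k\<in>T. n < k \<longrightarrow> (k \<in> Y \<longleftrightarrow> k \<in> Z)"
    using assms(2) unfolding set_less_def by blast
  have "m \<noteq> n" using m n by blast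
  then consider "m < n" | "n < m" by fastforce
  then show ?thesis
  proof cases
    case 1
    then have "n \<notin> X" using m(4) n by blast
    moreover have "\<forall>k\<in>T. n < k \<longrightarrow> (k \<in> X \<longleftrightarrow> k \<in> Z)" using m(4) n(4) 1 by (meson less_trans)
    ultimately show ?thesis using n unfolding set_less_def by blast
  next
    case 2
    then have "m \<in> Z" using n(4) m by blast
    moreover have "\<forall>k\<in>T. m < k \<longrightarrow> (k \<in> X \<longleftrightarrow> k \<in> Z)" using m(4) n(4) 2 by (meson less_trans)
    ultimately show ?thesis using m unfolding set_less_def by blast
  qed
qed

lemma set_less_total:
  assumes "X \<in> Fpow T" "Y \<in> Fpow T" "X \<noteq> Y"
  shows "set_less T X Y \<or> set_less T Y X"
proof -
  let ?D = "(X - Y) \<union> (Y - X)"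
  have D: "finite ?D" "?D \<noteq> {}" "?D \<subseteq> T" using assms by (auto simp: Fpow_def)
  note m = Max_in[OF D(1,2)] Max_ge[OF D(1)]
  have "\<forall>k\<in>T. Max ?D < k \<longrightarrow> (k \<in> X \<longleftrightarrow> k \<in> Y)"
  proof (intro ballI impI)
    fix k assume "Max ?D < k"
    then have "k \<notin> ?D" using m(2)[of k] leD by blast
    then show "k \<in> X \<longleftrightarrow> k \<in> Y" by blast
  qed
  moreover have "Max ?D \<in> T" using m(1) D(3) by (rule set_mp[rotated])
  ultimately show ?thesis using m(1) unfolding set_less_def by blast
qed

section \<open>Injectivity of the code in an atom system\<close>

context atom_system
begin

abbreviation "tok \<equiv> tokens T At N"

lemma cuts_singleton: "card (cuts T {x}) \<le> 2"
proof -
  have "cuts T {x} \<subseteq> {x @ [False], x @ [True]}" by (auto simp: cuts_def)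
  then have "card (cuts T {x}) \<le> card {x @ [False], x @ [True]}" by (intro card_mono) auto
  also have "\<dots> \<le> 2" by (simp add: card_insert_if)
  finally show ?thesis .
qed

lemma located_at: "{X \<in> At. located T At N X x} = {X \<in> At. loc X = x}"
  by (auto simp: located_iff)

text \<open>The region consisting of \<open>x\<close> alone has at most three boundary edges. The
  bound holds for every finite set of atoms located there, hence there are only finitely
  many.\<close>

lemma finite_located: "finite {X \<in> At. located T At N X x}"
  and tokens_le: "tok x \<le> 1 + 3 * bnd N"
proof -
  have le: "card F \<le> 1 + 3 * bnd N" if F: "finite F" "F \<subseteq> {X \<in> At. located T At N X x}" for F
  proof (cases "x \<in> T")
    case True
    have "card F \<le> card {x} + (card (cuts T {x}) + (if x = [] then 0 else 1)) * bnd N"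
      by (rule card_region) (use F True located_at in \<open>auto dest: prefix_order.antisym\<close>)
    also have "\<dots> \<le> 1 + (2 + 1) * bnd N"
      using cuts_singleton[of x] by (intro add_mono mult_right_mono) auto
    finally show ?thesis by simp
  next
    case False
    then have "F = {}" using F by (auto simp: located_def)
    then show ?thesis by simp
  qed
  show fin: "finite {X \<in> At. located T At N X x}"
  proof (rule ccontr)
    assume "infinite {X \<in> At. located T At N X x}"
    then obtain F where "finite F" "card F = 2 + 3 * bnd N" "F \<subseteq> {X \<in> At. located T At N X x}"
      using infinite_arbitrarily_large by blast
    then show False using le[of F] by simp
  qed
  show "tok x \<le> 1 + 3 * bnd N"
    unfolding tokens_def by (rule le[OF fin]) simp
qed

sublocale flow_system T tok "bnd N"
proof
  show "[] \<in> T" by (rule root)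
  show "u \<in> T" if "v \<in> T" "prefix u v" for u v using prefix_closed that .
  fix R u
  assume R: "finite R" "R \<subseteq> T" "u \<in> R" "\<forall>v\<in>R. prefix u v"
    "\<forall>v\<in>R. \<forall>w. prefix u w \<longrightarrow> prefix w v \<longrightarrow> w \<in> R"
  let ?F = "\<Union>x\<in>R. {X \<in> At. located T At N X x}"
  have "(\<Sum>v\<in>R. tok v) = card ?F"
    unfolding tokens_def using R(1) finite_located by (intro card_UN_disjoint[symmetric]) (auto simp: located_iff)
  also have "\<dots> \<le> card R + (card (cuts T R) + (if u = [] then 0 else 1)) * bnd N"
  proof (rule card_region[OF R(1-4)])
    show "w \<in> R" if "v \<in> R" "prefix u w" "prefix w v" for v w using R(5) that by blast
    show "finite ?F" using R(1) finite_located by blast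
    show "?F \<subseteq> At" by blast
    show "\<forall>X\<in>?F. loc X \<in> R" by (auto simp: located_iff)
  qed
  finally show "(\<Sum>v\<in>R. tok v) \<le> card R + (card (cuts T R) + (if u = [] then 0 else 1)) * bnd N" .
qed

lemma rank_less:
  assumes "X \<in> At" "located T At N X x"
  shows "rank T At N x X < tok x"
  unfolding rank_def tokens_def
proof (rule psubset_card_mono[OF finite_located])
  show "{Y \<in> At. located T At N Y x \<and> set_less T Y X} \<subset> {X \<in> At. located T At N X x}"
    using assms set_less_irrefl by blast
qed

lemma rank_mono:
  assumes "X \<in> At" "located T At N X x" "set_less T X Y"
  shows "rank T At N x X < rank T At N x Y"
  unfolding rank_def
proof (rule psubset_card_mono)
  show "finite {Z \<in> At. located T At N Z x \<and> set_less T Z Y}"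
    by (rule finite_subset[OF _ finite_located[of x]]) blast
  show "{Z \<in> At. located T At N Z x \<and> set_less T Z X} \<subset> {Z \<in> At. located T At N Z x \<and> set_less T Z Y}"
    using assms set_less_trans set_less_irrefl by blast
qed

lemma rank_inj:
  assumes "X \<in> At" "Y \<in> At" "located T At N X x" "located T At N Y x" "rank T At N x X = rank T At N x Y"
  shows "X = Y"
proof (rule ccontr)
  assume "X \<noteq> Y"
  then have "set_less T X Y \<or> set_less T Y X" using set_less_total assms(1,2) At_Fpow by blast
  then show False using rank_mono[of X x Y] rank_mono[of Y x X] assms by auto
qed

definition start :: "node set \<Rightarrow> node \<times> nat" where
  "start X = (loc X, ow (loc X) + rank T At N (loc X) X)"

lemma conf_start: "X \<in> At \<Longrightarrow> conf (start X)"
proof -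
  assume X: "X \<in> At"
  have "rank T At N (loc X) X < tok (loc X)" by (rule rank_less[OF X located_loc[OF X]])
  then show ?thesis using loc_in_T[OF X] unfolding conf_def start_def by simp
qed

lemma encodes_iff: "X \<in> At \<Longrightarrow> encodes T At N X y \<longleftrightarrow> (start X, (y, 0)) \<in> mv\<^sup>*"
proof -
  assume X: "X \<in> At"
  have "(\<exists>x\<in>T. located T At N X x \<and> x \<in> Z (ow x + rank T At N x X)) \<longleftrightarrow> fst (start X) \<in> Z (snd (start X))" for Z
    using X located_iff loc_in_T by (auto simp: start_def)
  moreover have "conf (fst (start X), snd (start X))" using conf_start[OF X] by simp
  from reaches_iff[OF this, of y]
  have "(\<forall>Z\<in>fam T (3 * bnd N + 2). closed_under_move T tok (bnd N) Z \<longrightarrow> fst (start X) \<in> Z (snd (start X)) \<longrightarrow> y \<in> Z 0) \<longleftrightarrow>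
    (start X, (y, 0)) \<in> mv\<^sup>*" by simp
  ultimately show ?thesis unfolding encodes_def by simp
qed

lemma ex1_encodes: "X \<in> At \<Longrightarrow> \<exists>!y. y \<in> T \<and> encodes T At N X y"
proof -
  assume X: "X \<in> At"
  then obtain y where "y \<in> T" "(start X, (y, 0)) \<in> mv\<^sup>*" using terminates[OF conf_start[OF X]] by auto
  then show ?thesis using end_unique[of "start X"] unfolding encodes_iff[OF X] by blast
qed

lemma encodes_inj:
  assumes "X \<in> At" "Y \<in> At" "encodes T At N X y" "encodes T At N Y y"
  shows "X = Y"
proof -
  have "(start X, (y, 0)) \<in> mv\<^sup>*" "(start Y, (y, 0)) \<in> mv\<^sup>*" using assms(3,4) by (simp_all add: encodes_iff assms(1,2))
  from start_unique[OF this[unfolded start_def]]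
  have "loc X = loc Y" "rank T At N (loc X) X = rank T At N (loc Y) Y" by blast+
  then show ?thesis using rank_inj[of X Y "loc X"] assms located_loc[of X] located_loc[of Y] by simp
qed

end

subsection \<open>Definability of the code\<close>

lemma dfn_mem_if: "dfn TT (\<lambda>t e s. e x \<in> (if k < m then s k else {}))"
  by (cases "k < m") (simp_all add: dfn_mem dfn_const)

lemma dfn_set_eq: "dfn TT (\<lambda>t e s. s X = s Y)"
proof -
  have "dfn TT (\<lambda>t e s. \<forall>v\<in>dom t. v \<in> s X \<longleftrightarrow> v \<in> s Y)"
    by (rule dfn_all, rule dfn_iff, rule dfn_mem, rule dfn_mem)
  then show ?thesis
  proof (rule dfn_cong)
    fix t :: "'a tree" and e :: "nat \<Rightarrow> node" and s assume "env t e s"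
    then have "s X \<subseteq> dom t" "s Y \<subseteq> dom t" by (auto simp: env_def Fpow_def)
    then show "(\<forall>v\<in>dom t. v \<in> s X \<longleftrightarrow> v \<in> s Y) \<longleftrightarrow> s X = s Y" by blast
  qed
qed

text \<open>Splits the lexicographic order into relations that are definable from prefixes and
  successors.\<close>

lemma node_less_iff:
  "u < v \<longleftrightarrow> strict_prefix u v \<or> (\<exists>w. prefix (w @ [False]) u \<and> prefix (w @ [True]) v)" for u v :: node
proof
  assume "u < v"
  then consider a r where "v = u @ a # r"
    | w a b r r' where "a < b" "u = w @ a # r" "v = w @ b # r'"
    unfolding list_less_def lexord_def by blast
  then show "strict_prefix u v \<or> (\<exists>w. prefix (w @ [False]) u \<and> prefix (w @ [True]) v)"
  proof cases
    case 1
    then show ?thesis by (simp add: strict_prefix_def)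
  next
    case 2
    then have "u = (w @ [False]) @ r" "v = (w @ [True]) @ r'" by auto
    then show ?thesis by (metis prefixI)
  qed
next
  assume "strict_prefix u v \<or> (\<exists>w. prefix (w @ [False]) u \<and> prefix (w @ [True]) v)"
  then show "u < v"
  proof
    assume "strict_prefix u v"
    then obtain a r where "v = u @ a # r" by (auto elim: strict_prefixE')
    then show ?thesis unfolding list_less_def lexord_def by blast
  next
    assume "\<exists>w. prefix (w @ [False]) u \<and> prefix (w @ [True]) v"
    then obtain w r r' where "u = w @ False # r" "v = w @ True # r'" by (auto simp: prefix_def)
    moreover have "False < True" by simp
    ultimately show ?thesis unfolding list_less_def lexord_def by blast
  qed
qed

lemma dfn_atleast:
  assumes "dfn TT (\<lambda>t e s. Q t e (\<lambda>n. s (Suc n)) (s 0))"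
  shows "dfn TT (\<lambda>t e s. atleast m {V \<in> Fpow (dom t). Q t e s V})"
proof -
  have "dfn TT (\<lambda>t e s. \<exists>Z\<in>fam (dom t) m.
      (\<forall>i<m. \<forall>j<m. i \<noteq> j \<longrightarrow> Z i \<noteq> Z j) \<and> (\<forall>i<m. Q t e s (Z i)))"
  proof (rule dfn_exF, rule dfn_conj; intro dfn_all_less)
    fix i j assume "i < m" "j < m"
    then show "dfn TT (\<lambda>t e s. i \<noteq> j \<longrightarrow> (if i < m then s i else {}) \<noteq> (if j < m then s j else {}))"
      by (simp add: dfn_imp dfn_not dfn_const dfn_set_eq)
  next
    fix i assume "i < m"
    then show "dfn TT (\<lambda>t e s. Q t e (\<lambda>n. s (n + m)) (if i < m then s i else {}))"
      using dfn_rename[OF assms, of id "case_nat i (\<lambda>n. n + m)"] by simp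
  qed
  then show ?thesis
  proof (rule dfn_cong)
    fix t :: "'a tree" and e s
    show "(\<exists>Z\<in>fam (dom t) m. (\<forall>i<m. \<forall>j<m. i \<noteq> j \<longrightarrow> Z i \<noteq> Z j) \<and> (\<forall>i<m. Q t e s (Z i)))
      \<longleftrightarrow> atleast m {V \<in> Fpow (dom t). Q t e s V}"
    proof
      assume "\<exists>Z\<in>fam (dom t) m. (\<forall>i<m. \<forall>j<m. i \<noteq> j \<longrightarrow> Z i \<noteq> Z j) \<and> (\<forall>i<m. Q t e s (Z i))"
      then obtain Z where Z: "Z \<in> fam (dom t) m" "\<forall>i<m. \<forall>j<m. i \<noteq> j \<longrightarrow> Z i \<noteq> Z j"
        "\<forall>i<m. Q t e s (Z i)" by blast
      have "inj_on Z {..<m}" using Z(2) by (auto simp: inj_on_def)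
      then have "card (Z ` {..<m}) = m" by (simp add: card_image)
      moreover have "Z ` {..<m} \<subseteq> {V \<in> Fpow (dom t). Q t e s V}" using Z fam_in_Fpow by blast
      ultimately show "atleast m {V \<in> Fpow (dom t). Q t e s V}" unfolding atleast_def by blast
    next
      assume "atleast m {V \<in> Fpow (dom t). Q t e s V}"
      then obtain F where F: "F \<subseteq> {V \<in> Fpow (dom t). Q t e s V}" "finite F" "card F = m"
        unfolding atleast_def by blast
      obtain f where f: "bij_betw f {0..<m} F" using ex_bij_betw_nat_finite[OF F(2)] F(3) by blast
      define Z where "Z = (\<lambda>k. if k < m then f k else {})"
      have in_F: "f k \<in> F" if "k < m" for k using bij_betwE[OF f] that by simp
      have "Z \<in> fam (dom t) m" "\<forall>i<m. Q t e s (Z i)" using in_F F(1) by (auto simp: fam_def Z_def)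
      moreover have "\<forall>i<m. \<forall>j<m. i \<noteq> j \<longrightarrow> Z i \<noteq> Z j"
        using bij_betw_imp_inj_on[OF f] by (auto simp: Z_def inj_on_def)
      ultimately show "\<exists>Z\<in>fam (dom t) m. (\<forall>i<m. \<forall>j<m. i \<noteq> j \<longrightarrow> Z i \<noteq> Z j) \<and> (\<forall>i<m. Q t e s (Z i))"
        by blast
    qed
  qed
qed

lemma dfnf_card:
  assumes "dfn TT (\<lambda>t e s. Q t e (\<lambda>n. s (Suc n)) (s 0))"
    and "\<And>t e s. t \<in> TT \<Longrightarrow> env t e s \<Longrightarrow>
      finite {V \<in> Fpow (dom t). Q t e s V} \<and> card {V \<in> Fpow (dom t). Q t e s V} < b"
  shows "dfnf TT (\<lambda>t e s. card {V \<in> Fpow (dom t). Q t e s V})"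
proof -
  have "dfn TT (\<lambda>t e s. card {V \<in> Fpow (dom t). Q t e s V} = k)" for k
  proof -
    have "dfn TT (\<lambda>t e s. atleast k {V \<in> Fpow (dom t). Q t e s V} \<and> \<not> atleast (Suc k) {V \<in> Fpow (dom t). Q t e s V})"
      by (rule dfn_conj, rule dfn_atleast[OF assms(1)], rule dfn_not, rule dfn_atleast[OF assms(1)])
    then show ?thesis
    proof (rule dfn_cong)
      fix t :: "'a tree" and e s assume "t \<in> TT" "env t e s"
      then have "finite {V \<in> Fpow (dom t). Q t e s V}" using assms(2) by blast
      then show "(atleast k {V \<in> Fpow (dom t). Q t e s V} \<and> \<not> atleast (Suc k) {V \<in> Fpow (dom t). Q t e s V})
          \<longleftrightarrow> card {V \<in> Fpow (dom t). Q t e s V} = k"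
        by (auto simp: atleast_finite)
    qed
  qed
  then show ?thesis using assms(2) unfolding dfnf_def by blast
qed

lemma dfnf_chv:
  assumes "\<And>x. dfnf TT (\<lambda>t e s. F t s (e x))"
  shows "dfnf TT (\<lambda>t e s. chv (dom t) (F t s) (e x) i)"
proof -
  obtain b where b: "\<forall>t\<in>TT. \<forall>e s. env t e s \<longrightarrow> F t s (e 0) < b"
    using assms[of 0] unfolding dfnf_def by (elim conjE exE)
  have "chv (dom t) (F t s) (e x) i < Suc b" if "t \<in> TT" "env t e s" for t e s
  proof (cases "e x @ [i] \<in> dom t")
    case True
    \<comment> \<open>The bound for \<open>F\<close> is given only along environments, so it is
      transferred to the child by an environment placed there.\<close>
    then have "env t (\<lambda>_. e x @ [i]) s" using that by (simp add: env_def)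
    then show ?thesis using b that True unfolding chv_def by (auto intro: less_SucI)
  qed (simp add: chv_def)
  moreover have "dfn TT (\<lambda>t e s. chv (dom t) (F t s) (e x) i = k)" for k
  proof -
    have "dfn TT (\<lambda>t e s. (\<exists>c\<in>dom t. c = e x @ [i] \<and> F t s c = k) \<or>
       (\<not> (\<exists>c\<in>dom t. c = e x @ [i]) \<and> 0 = k))"
    proof (intro dfn_disj dfn_conj dfn_not dfn_const)
      show "dfn TT (\<lambda>t e s. \<exists>c\<in>dom t. c = e x @ [i])"
        by (rule dfn_ex, rule dfn_succ)
      have "dfn TT (\<lambda>t e s. F t s (e 0) = k)" using assms[of 0] unfolding dfnf_def by blast
      then show "dfn TT (\<lambda>t e s. \<exists>c\<in>dom t. c = e x @ [i] \<and> F t s c = k)"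
        by (intro dfn_ex dfn_conj dfn_succ)
    qed
    then show ?thesis by (rule dfn_cong) (auto simp: chv_def)
  qed
  ultimately show ?thesis unfolding dfnf_def by blast
qed

section \<open>Formulas for location, flow and code\<close>

locale definable_atoms =
  fixes TT :: "'a tree set" and AtS :: "'a tree \<Rightarrow> node set set" and N :: nat
  assumes tree: "t \<in> TT \<Longrightarrow> is_tree t"
    and AtS: "dfn TT (\<lambda>t e s. s 0 \<in> AtS t)"
    and atom_system: "t \<in> TT \<Longrightarrow> \<exists>le. atom_system (dom t) (AtS t) le N"
begin

text \<open>The closure is taken towards the root: the prefixes of a node form a finite set, whereas
  a subtree may be infinite and so out of reach of the set quantifiers.\<close>

lemma dfn_prefix: "dfn TT (\<lambda>t e s. prefix (e x) (e y))"
proof -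
  have "dfn TT (\<lambda>t e s. \<forall>Z\<in>Fpow (dom t). e y \<in> Z \<longrightarrow>
     (\<forall>w\<in>dom t. \<forall>w'\<in>dom t. (w' = w @ [False] \<or> w' = w @ [True]) \<longrightarrow> w' \<in> Z \<longrightarrow> w \<in> Z) \<longrightarrow> e x \<in> Z)"
    by (rule dfn_allS, rule dfn_imp, rule dfn_mem, rule dfn_imp, rule dfn_all, rule dfn_all,
        rule dfn_imp, rule dfn_disj, rule dfn_succ, rule dfn_succ, rule dfn_imp, rule dfn_mem,
        rule dfn_mem, rule dfn_mem)
  then show ?thesis
  proof (rule dfn_cong)
    fix t e s assume t: "t \<in> TT" and e: "env t e s"
    have closed: "u \<in> dom t" if "v \<in> dom t" "prefix u v" for u v
      using tree[OF t] that unfolding is_tree_def by blast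
    let ?P = "\<lambda>Z. \<forall>w\<in>dom t. \<forall>w'\<in>dom t. (w' = w @ [False] \<or> w' = w @ [True]) \<longrightarrow> w' \<in> Z \<longrightarrow> w \<in> Z"
    show "(\<forall>Z\<in>Fpow (dom t). e y \<in> Z \<longrightarrow> ?P Z \<longrightarrow> e x \<in> Z) \<longleftrightarrow> prefix (e x) (e y)"
    proof
      assume R: "\<forall>Z\<in>Fpow (dom t). e y \<in> Z \<longrightarrow> ?P Z \<longrightarrow> e x \<in> Z"
      have fp: "{w. prefix w (e y)} \<in> Fpow (dom t)"
        using closed[of "e y"] e finite_prefixes[of "{e y}"] by (auto simp: Fpow_def env_def)
      have P: "?P {w. prefix w (e y)}" by (auto dest: append_prefixD)
      have "e x \<in> {w. prefix w (e y)}"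
        by (rule R[THEN bspec, OF fp, THEN mp, THEN mp, OF _ P]) simp
      then show "prefix (e x) (e y)" by simp
    next
      assume pre: "prefix (e x) (e y)"
      have "w \<in> Z" if "?P Z" "v \<in> Z" "v \<in> dom t" "prefix w v" for w v Z
        using that(2-4)
      proof (induction v rule: rev_induct)
        case Nil
        then show ?case by simp
      next
        case (snoc i v)
        have "v \<in> dom t" using closed[OF snoc.prems(2)] by simp
        then have "v \<in> Z" using that(1) snoc.prems by (cases i) blast+
        then show ?case using snoc \<open>v \<in> dom t\<close> by (auto simp: prefix_snoc)
      qed
      then show "\<forall>Z\<in>Fpow (dom t). e y \<in> Z \<longrightarrow> ?P Z \<longrightarrow> e x \<in> Z"
        using pre e unfolding env_def by blast
    qed
  qed
qed

lemma dfn_AtS: "dfn TT (\<lambda>t e s. s X \<in> AtS t)"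
  using dfn_rename[OF AtS, where g = "\<lambda>_. X"] by simp

lemma AtS_Fpow: "t \<in> TT \<Longrightarrow> AtS t \<subseteq> Fpow (dom t)"
  using atom_system atom_system.At_Fpow by blast

lemma dfn_mix: "dfn TT (\<lambda>t e s. s V = mix (below (e u)) (s X) (s W))"
proof -
  have "dfn TT (\<lambda>t e s. \<forall>v\<in>dom t. (prefix (e u) v \<longrightarrow> (v \<in> s V \<longleftrightarrow> v \<in> s X)) \<and>
      (\<not> prefix (e u) v \<longrightarrow> (v \<in> s V \<longleftrightarrow> v \<in> s W)))"
    by (rule dfn_all, intro dfn_conj dfn_imp dfn_iff dfn_not dfn_prefix dfn_mem)
  then show ?thesis
  proof (rule dfn_cong)
    fix t e s assume "env t e s"
    then have sub: "s V \<subseteq> dom t" "s X \<subseteq> dom t" "s W \<subseteq> dom t" by (auto simp: env_def Fpow_def)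
    show "(\<forall>v\<in>dom t. (prefix (e u) v \<longrightarrow> (v \<in> s V \<longleftrightarrow> v \<in> s X)) \<and>
      (\<not> prefix (e u) v \<longrightarrow> (v \<in> s V \<longleftrightarrow> v \<in> s W))) \<longleftrightarrow> s V = mix (below (e u)) (s X) (s W)"
      (is "?L \<longleftrightarrow> ?R")
    proof
      assume L: ?L
      show ?R
      proof (rule set_eqI)
        fix v
        show "v \<in> s V \<longleftrightarrow> v \<in> mix (below (e u)) (s X) (s W)"
        proof (cases "v \<in> dom t")
          case True
          then show ?thesis using L by simp
        next
          case False
          then have "v \<notin> s V" "v \<notin> s X" "v \<notin> s W" using sub by blast+
          then show ?thesis by simp
        qed
      qed
    next
      assume ?R
      then show ?L by simp
    qed
  qed
qed

lemma dfn_mix_AtS: "dfn TT (\<lambda>t e s. mix (below (e u)) (s X) (s W) \<in> AtS t)"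
proof -
  have "dfn TT (\<lambda>t e s. \<exists>V\<in>Fpow (dom t). V = mix (below (e u)) (s X) (s W) \<and> V \<in> AtS t)"
    by (rule dfn_exS, rule dfn_conj, rule dfn_mix, rule dfn_AtS)
  then show ?thesis
    by (rule dfn_cong) (use AtS_Fpow in blast)
qed

lemma dfn_eqv: "dfn TT (\<lambda>t e s. eqv (dom t) (AtS t) (e u) (s X) (s Y))"
  unfolding eqv_def by (rule dfn_allS, intro dfn_iff dfn_mix_AtS)

lemma dfn_outside: "dfn TT (\<lambda>t e s. s Y - below (e u) = s X - below (e u))"
proof -
  have "dfn TT (\<lambda>t e s. \<forall>v\<in>dom t. \<not> prefix (e u) v \<longrightarrow> (v \<in> s Y \<longleftrightarrow> v \<in> s X))"
    by (rule dfn_all, intro dfn_iff dfn_imp dfn_not dfn_prefix dfn_mem)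
  then show ?thesis
  proof (rule dfn_cong)
    fix t e s assume "env t e s"
    then have "s X \<subseteq> dom t" "s Y \<subseteq> dom t" by (auto simp: env_def Fpow_def)
    then show "(\<forall>v\<in>dom t. \<not> prefix (e u) v \<longrightarrow> (v \<in> s Y \<longleftrightarrow> v \<in> s X)) \<longleftrightarrow>
        s Y - below (e u) = s X - below (e u)"
      by (auto simp: set_eq_iff subset_iff)
  qed
qed

lemma dfn_many: "dfn TT (\<lambda>t e s. many (dom t) (AtS t) N (e u) (s X))"
  unfolding many_def cls_def
  by (rule dfn_atleast, rule dfn_conj, rule dfn_outside, rule dfn_eqv)

lemma dfn_strict_prefix: "dfn TT (\<lambda>t e s. strict_prefix (e x) (e y))"
  unfolding strict_prefix_def by (intro dfn_conj dfn_not dfn_prefix dfn_eq)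

lemma dfn_root: "dfn TT (\<lambda>t e s. e x = [])"
proof -
  have "dfn TT (\<lambda>t e s. \<forall>v\<in>dom t. prefix (e x) v)"
    by (rule dfn_all, rule dfn_prefix)
  then show ?thesis
  proof (rule dfn_cong)
    fix t e s assume t: "t \<in> TT" and e: "env t e s"
    have "[] \<in> dom t" using tree[OF t] e unfolding is_tree_def env_def by (meson Nil_prefix)
    then show "(\<forall>v\<in>dom t. prefix (e x) v) \<longleftrightarrow> e x = []"
      by (metis Nil_prefix prefix_Nil)
  qed
qed

lemma dfn_located: "dfn TT (\<lambda>t e s. located (dom t) (AtS t) N (s X) (e x))"
proof -
  have "dfn TT (\<lambda>t e s. (e x = [] \<or> many (dom t) (AtS t) N (e x) (s X)) \<and>
     (\<forall>y\<in>dom t. strict_prefix (e x) y \<longrightarrow> \<not> many (dom t) (AtS t) N y (s X)))"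
    by (rule dfn_conj, rule dfn_disj, rule dfn_root, rule dfn_many, rule dfn_all,
        rule dfn_imp, rule dfn_strict_prefix, rule dfn_not, rule dfn_many)
  then show ?thesis
    by (rule dfn_cong) (auto simp: located_def env_def)
qed

lemma AtS_eq: "t \<in> TT \<Longrightarrow> {V \<in> Fpow (dom t). V \<in> AtS t \<and> P V} = {V \<in> AtS t. P V}"
  using AtS_Fpow by blast

abbreviation "tk t \<equiv> tokens (dom t) (AtS t) N"

lemma dfnf_tokens: "dfnf TT (\<lambda>t e s. tk t (e x))"
proof -
  have "dfnf TT (\<lambda>t e s. card {V \<in> Fpow (dom t). V \<in> AtS t \<and> located (dom t) (AtS t) N V (e x)})"
  proof (rule dfnf_card)
    show "dfn TT (\<lambda>t e s. s 0 \<in> AtS t \<and> located (dom t) (AtS t) N (s 0) (e x))"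
      by (intro dfn_conj dfn_AtS dfn_located)
    fix t e s assume t: "t \<in> TT"
    then obtain le where "atom_system (dom t) (AtS t) le N" using atom_system by blast
    from atom_system.finite_located[OF this, of "e x"] atom_system.tokens_le[OF this, of "e x"]
    show "finite {V \<in> Fpow (dom t). V \<in> AtS t \<and> located (dom t) (AtS t) N V (e x)} \<and>
      card {V \<in> Fpow (dom t). V \<in> AtS t \<and> located (dom t) (AtS t) N V (e x)} < 2 + 3 * bnd N"
      unfolding AtS_eq[OF t] tokens_def by simp
  qed
  then show ?thesis by (rule dfnf_cong) (simp add: AtS_eq tokens_def)
qed

lemma dfn_node_less: "dfn TT (\<lambda>t e s. e x < e y)"
proof -
  have "dfn TT (\<lambda>t e s. strict_prefix (e x) (e y) \<or> (\<exists>w\<in>dom t. \<exists>a\<in>dom t. \<exists>b\<in>dom t.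
     a = w @ [False] \<and> b = w @ [True] \<and> prefix a (e x) \<and> prefix b (e y)))"
    by (rule dfn_disj, rule dfn_strict_prefix, rule dfn_ex, rule dfn_ex, rule dfn_ex,
        intro dfn_conj dfn_succ dfn_prefix)
  then show ?thesis
  proof (rule dfn_cong)
    fix t e s assume t: "t \<in> TT" and e: "env t e s"
    have closed: "u \<in> dom t" if "v \<in> dom t" "prefix u v" for u v
      using tree[OF t] that unfolding is_tree_def by blast
    have in_dom: "w \<in> dom t \<and> w @ [i] \<in> dom t" if "prefix (w @ [i]) (e z)" for w i z
      using closed[of "e z"] e that by (auto simp: env_def intro: append_prefixD)
    have "(\<exists>w\<in>dom t. \<exists>a\<in>dom t. \<exists>b\<in>dom t.
        a = w @ [False] \<and> b = w @ [True] \<and> prefix a (e x) \<and> prefix b (e y)) \<longleftrightarrow>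
      (\<exists>w. prefix (w @ [False]) (e x) \<and> prefix (w @ [True]) (e y))" (is "?A \<longleftrightarrow> ?B")
    proof
      assume ?A
      then show ?B by blast
    next
      assume ?B
      then obtain w where w: "prefix (w @ [False]) (e x)" "prefix (w @ [True]) (e y)" by (elim exE conjE)
      with in_dom[OF w(1)] in_dom[OF w(2)] show ?A
        by (intro bexI[of _ w] bexI[of _ "w @ [False]"] bexI[of _ "w @ [True]"] conjI refl) simp_all
    qed
    then show "(strict_prefix (e x) (e y) \<or> (\<exists>w\<in>dom t. \<exists>a\<in>dom t. \<exists>b\<in>dom t.
     a = w @ [False] \<and> b = w @ [True] \<and> prefix a (e x) \<and> prefix b (e y))) \<longleftrightarrow> e x < e y"
      by (simp only: node_less_iff)
  qed
qed

lemma dfn_set_less: "dfn TT (\<lambda>t e s. set_less (dom t) (s X) (s Y))"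
  unfolding set_less_def
  by (rule dfn_ex, rule dfn_conj, rule dfn_not, rule dfn_mem, rule dfn_conj, rule dfn_mem,
      rule dfn_all, intro dfn_imp dfn_node_less dfn_iff dfn_mem)

lemma dfnf_rank: "dfnf TT (\<lambda>t e s. rank (dom t) (AtS t) N (e x) (s X))"
proof -
  have "dfnf TT (\<lambda>t e s. card {V \<in> Fpow (dom t). V \<in> AtS t \<and>
     located (dom t) (AtS t) N V (e x) \<and> set_less (dom t) V (s X)})"
  proof (rule dfnf_card)
    show "dfn TT (\<lambda>t e s. s 0 \<in> AtS t \<and> located (dom t) (AtS t) N (s 0) (e x) \<and> set_less (dom t) (s 0) (s (Suc X)))"
      by (intro dfn_conj dfn_AtS dfn_located dfn_set_less)
    fix t e s assume t: "t \<in> TT"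
    then obtain le where "atom_system (dom t) (AtS t) le N" using atom_system by blast
    note * = atom_system.finite_located[OF this, of "e x"] atom_system.tokens_le[OF this, of "e x"]
    have sub: "{V \<in> AtS t. located (dom t) (AtS t) N V (e x) \<and> set_less (dom t) V (s X)} \<subseteq>
        {V \<in> AtS t. located (dom t) (AtS t) N V (e x)}" by blast
    show "finite {V \<in> Fpow (dom t). V \<in> AtS t \<and> located (dom t) (AtS t) N V (e x) \<and> set_less (dom t) V (s X)} \<and>
      card {V \<in> Fpow (dom t). V \<in> AtS t \<and> located (dom t) (AtS t) N V (e x) \<and> set_less (dom t) V (s X)} < 2 + 3 * bnd N"
      unfolding AtS_eq[OF t] using finite_subset[OF sub] card_mono[OF _ sub] * unfolding tokens_def by simp
  qed
  then show ?thesis by (rule dfnf_cong) (simp add: AtS_eq rank_def)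
qed

text \<open>Unary coding of labels by sets; \<open>2 * bnd N\<close> is the bound from
  \<open>labelling_le\<close>. Through counting, every family denotes some labels, whether its sets
  are nested or not.\<close>

definition level :: "(nat \<Rightarrow> node set) \<Rightarrow> node \<Rightarrow> nat" where
  "level H v = card {k. k < 2 * bnd N \<and> v \<in> H k}"

lemma dfnf_level: "dfnf TT (\<lambda>t e s. level (\<lambda>k. if k < 2 * bnd N then s k else {}) (e x))"
  unfolding level_def by (rule dfnf_count) (rule dfn_mem_if)

text \<open>A maximum is at least \<open>k\<close> if and only if some labelling reaches
  \<open>k\<close>. Labellings have finite support and bounded values, so they can be quantified as
  tuples of finite sets.\<close>

lemma labelling_le_eta_iff:
  assumes "t \<in> TT"
  shows "k \<le> eta (dom t) (tk t) (bnd N) u \<longleftrightarrow>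
    (\<exists>H\<in>fam (dom t) (2 * bnd N). (\<forall>v\<in>dom t. 0 < level H v \<longrightarrow>
       level H v + 1 + chv (dom t) (\<lambda>_. bnd N) v False + chv (dom t) (\<lambda>_. bnd N) v True
        \<le> tk t v + bnd N + chv (dom t) (level H) v False + chv (dom t) (level H) v True) \<and> k \<le> level H u)"
proof -
  obtain le where "atom_system (dom t) (AtS t) le N" using atom_system assms by blast
  then interpret atom_system "dom t" "AtS t" le N .
  show ?thesis
  proof
    assume k: "k \<le> eta (dom t) (tk t) (bnd N) u"
    obtain l where l: "labelling (dom t) (tk t) (bnd N) l" "l u = eta (dom t) (tk t) (bnd N) u"
      using eta_attained[of u] by blast
    define H where "H = (\<lambda>k. {v. k < l v})"
    have "l v \<le> 2 * bnd N" for v using labelling_le[OF l(1), of v] by (simp split: if_splits)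
    then have H_l: "level H v = l v" for v
    proof -
      have "{k. k < 2 * bnd N \<and> v \<in> H k} = {..<l v}"
        using \<open>l v \<le> 2 * bnd N\<close> by (auto simp: H_def)
      then show ?thesis by (simp add: level_def)
    qed
    then have lH: "level H = l" ..
    have sub: "H k \<subseteq> {v. 0 < l v}" for k by (auto simp: H_def)
    have "finite {v. 0 < l v}" "{v. 0 < l v} \<subseteq> dom t" using l(1) by (auto simp: labelling_def Fpow_def)
    then have "H k \<in> Fpow (dom t)" for k
      using finite_subset[OF sub] sub[of k] by (auto simp: Fpow_def)
    moreover have "H k = {}" if "2 * bnd N \<le> k" for k
      using \<open>\<And>v. l v \<le> 2 * bnd N\<close> that by (auto simp: H_def) (meson leD le_trans)
    ultimately have "H \<in> fam (dom t) (2 * bnd N)" by (simp add: fam_def)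
    then show "\<exists>H\<in>fam (dom t) (2 * bnd N). (\<forall>v\<in>dom t. 0 < level H v \<longrightarrow>
       level H v + 1 + chv (dom t) (\<lambda>_. bnd N) v False + chv (dom t) (\<lambda>_. bnd N) v True
        \<le> tk t v + bnd N + chv (dom t) (level H) v False + chv (dom t) (level H) v True) \<and> k \<le> level H u"
      using l k by (intro bexI[of _ H]) (simp_all add: lH labelling_def)
  next
    assume "\<exists>H\<in>fam (dom t) (2 * bnd N). (\<forall>v\<in>dom t. 0 < level H v \<longrightarrow>
       level H v + 1 + chv (dom t) (\<lambda>_. bnd N) v False + chv (dom t) (\<lambda>_. bnd N) v True
        \<le> tk t v + bnd N + chv (dom t) (level H) v False + chv (dom t) (level H) v True) \<and> k \<le> level H u"
    then obtain H where H: "H \<in> fam (dom t) (2 * bnd N)" "\<forall>v\<in>dom t. 0 < level H v \<longrightarrow>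
       level H v + 1 + chv (dom t) (\<lambda>_. bnd N) v False + chv (dom t) (\<lambda>_. bnd N) v True
        \<le> tk t v + bnd N + chv (dom t) (level H) v False + chv (dom t) (level H) v True" "k \<le> level H u"
      by blast
    have sub: "{v. 0 < level H v} \<subseteq> (\<Union>k<2 * bnd N. H k)"
      by (auto simp: level_def card_gt_0_iff)
    have "H k \<subseteq> dom t" "finite (H k)" for k
      using fam_in_Fpow[OF H(1), of k] by (auto simp: Fpow_def)
    then have "finite (\<Union>k<2 * bnd N. H k)" "(\<Union>k<2 * bnd N. H k) \<subseteq> dom t"
      by blast+
    then have "{v. 0 < level H v} \<in> Fpow (dom t)"
      using finite_subset[OF sub] subset_trans[OF sub] by (simp add: Fpow_def)
    then have "labelling (dom t) (tk t) (bnd N) (level H)" using H(2) by (simp add: labelling_def)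
    from le_eta[OF this, of u] H(3) show "k \<le> eta (dom t) (tk t) (bnd N) u" by simp
  qed
qed

lemma dfn_le_eta: "dfn TT (\<lambda>t e s. k \<le> eta (dom t) (tk t) (bnd N) (e x))"
proof -
  have level: "dfnf TT (\<lambda>t e s. level (\<lambda>k. if k < 2 * bnd N then s k else {}) (e x))" for x
    by (rule dfnf_level)
  have "dfn TT (\<lambda>t e s. \<exists>H\<in>fam (dom t) (2 * bnd N). (\<forall>v\<in>dom t. 0 < level H v \<longrightarrow>
       level H v + 1 + chv (dom t) (\<lambda>_. bnd N) v False + chv (dom t) (\<lambda>_. bnd N) v True
        \<le> tk t v + bnd N + chv (dom t) (level H) v False + chv (dom t) (level H) v True) \<and> k \<le> level H (e x))"
    by (rule dfn_exF, rule dfn_conj, rule dfn_all, rule dfn_imp, rule dfn_num2[where R = "(<)"],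
        rule dfnf_const, rule level, rule dfn_num2[where R = "(\<le>)"], (rule dfnf_op[where opr = "(+)"])+,
        rule level, rule dfnf_const, rule dfnf_chv, rule dfnf_const, rule dfnf_chv,
        rule dfnf_const, (rule dfnf_op[where opr = "(+)"])+, rule dfnf_tokens, rule dfnf_const,
        rule dfnf_chv, rule level, rule dfnf_chv, rule level, rule dfn_num2[where R = "(\<le>)"],
        rule dfnf_const, rule level)
  then show ?thesis by (rule dfn_cong) (simp add: labelling_le_eta_iff)
qed

lemma dfnf_eta: "dfnf TT (\<lambda>t e s. eta (dom t) (tk t) (bnd N) (e x))"
proof -
  have "eta (dom t) (tk t) (bnd N) (e x) < Suc (2 * bnd N)" if t: "t \<in> TT" for t and e :: "nat \<Rightarrow> node"
  proof -
    obtain le where "atom_system (dom t) (AtS t) le N" using atom_system t by blast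
    then interpret atom_system "dom t" "AtS t" le N .
    show ?thesis using eta_le[of "e x"] by (simp split: if_splits)
  qed
  moreover have "dfn TT (\<lambda>t e s. eta (dom t) (tk t) (bnd N) (e x) = k)" for k
  proof -
    have "dfn TT (\<lambda>t e s. k \<le> eta (dom t) (tk t) (bnd N) (e x) \<and> \<not> Suc k \<le> eta (dom t) (tk t) (bnd N) (e x))"
      by (intro dfn_conj dfn_not dfn_le_eta)
    then show ?thesis by (rule dfn_cong) auto
  qed
  ultimately show ?thesis unfolding dfnf_def by blast
qed

lemma dfnf_fall: "dfnf TT (\<lambda>t e s. fall (dom t) (tk t) (bnd N) (e x))"
  unfolding fall_def by (rule dfnf_op[where opr = "(-)"], rule dfnf_const, rule dfnf_eta)

lemma dfnf_rise: "dfnf TT (\<lambda>t e s. rise (dom t) (tk t) (bnd N) (e x))"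
  unfolding rise_def by (rule dfnf_op[where opr = "(-)"], rule dfnf_eta, rule dfnf_const)

lemma dfnf_chv_fall: "dfnf TT (\<lambda>t e s. chv (dom t) (fall (dom t) (tk t) (bnd N)) (e x) i)"
  by (rule dfnf_chv) (rule dfnf_fall)

lemma dfnf_chv_rise: "dfnf TT (\<lambda>t e s. chv (dom t) (rise (dom t) (tk t) (bnd N)) (e x) i)"
  by (rule dfnf_chv) (rule dfnf_rise)

lemma dfnf_own: "dfnf TT (\<lambda>t e s. own (dom t) (tk t) (bnd N) (e x))"
  unfolding own_def
  by (rule dfnf_op[where opr = "(+)"], rule dfnf_op[where opr = "(+)"], rule dfnf_fall, rule dfnf_chv_rise, rule dfnf_chv_rise)

lemma dfn_move: "dfn TT (\<lambda>t e s. move (dom t) (tk t) (bnd N) (e u) k (e w) m)"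
proof -
  note a = dfnf_chv_fall[of u False] and b = dfnf_chv_fall[of u True]
    and f = dfnf_fall[of w] and r = dfnf_chv_rise[of w False]
  \<comment> \<open>With the flow values as constants, only successor relations and fixed truth
    values remain; the actual values are then inserted by \<open>dfn_num\<close>.\<close>
  have "dfn TT (\<lambda>t e s. 0 < k \<and>
     ((k \<le> a \<and> e w = e u @ [False] \<and> m = k - 1) \<or>
      (a < k \<and> k \<le> a + b \<and> e w = e u @ [True] \<and> m = k - 1 - a) \<or>
      (a + b < k \<and> e u = e w @ [False] \<and> m = f + (k - 1 - a - b)) \<or>
      (a + b < k \<and> e u = e w @ [True] \<and> m = f + r + (k - 1 - a - b))))" for a b f r
    by (intro dfn_conj dfn_disj dfn_const dfn_succ)
  from dfn_num[OF a dfn_num[OF b dfn_num[OF f dfn_num[OF r this]]]]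
  show ?thesis unfolding move_def Let_def .
qed

lemma dfn_encodes: "dfn TT (\<lambda>t e s. encodes (dom t) (AtS t) N (s X) (e x))"
proof -
  let ?B = "3 * bnd N + 2"
  have closed: "dfn TT (\<lambda>t e s. closed_under_move (dom t) (tk t) (bnd N) (\<lambda>k. if k < ?B then s k else {}))"
    unfolding closed_under_move_def
    by (rule dfn_all, rule dfn_all_less, rule dfn_imp, rule dfn_mem_if, rule dfn_all, rule dfn_all_less,
        rule dfn_imp, rule dfn_move, rule dfn_mem_if)
  have start: "dfn TT (\<lambda>t e s. e y \<in> (if own (dom t) (tk t) (bnd N) (e y) +
      rank (dom t) (AtS t) N (e y) (s Y) < ?B then s (own (dom t) (tk t) (bnd N) (e y) +
      rank (dom t) (AtS t) N (e y) (s Y)) else {}))" for y Y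
    by (rule dfn_num[where Q = "\<lambda>k t e s. e y \<in> (if k < ?B then s k else {})", OF dfnf_op[where opr = "(+)", OF dfnf_own dfnf_rank] dfn_mem_if])
  show ?thesis
    unfolding encodes_def
    by (rule dfn_allF, rule dfn_imp, rule closed, rule dfn_imp, rule dfn_ex, rule dfn_conj,
        rule dfn_located, rule start, rule dfn_mem_if)
qed

end

subsection \<open>Atoms of finite powerset lattices\<close>

text \<open>The image of an atom has exactly one proper subset. It is thus nonempty, and removing an
  element must give the same proper subset as removing everything.\<close>

lemma atom_singleton:
  assumes h: "bij_betw h (fst S) (Fpow E)" "\<forall>x\<in>fst S. \<forall>y\<in>fst S. (x, y) \<in> snd S \<longleftrightarrow> h x \<subseteq> h y"
    and x: "x \<in> atoms S"
  shows "\<exists>e. h x = {e}"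
proof -
  have xS: "x \<in> fst S" and uniq: "\<exists>!y. y \<in> fst S \<and> (y, x) \<in> snd S \<and> y \<noteq> x"
    using x by (auto simp: atoms_def)
  have hx: "h x \<in> Fpow E" using bij_betwE[OF h(1)] xS by blast
  have below_x: "\<exists>y. y \<in> fst S \<and> (y, x) \<in> snd S \<and> y \<noteq> x \<and> h y = P" if "P \<subset> h x" for P
  proof -
    have "P \<in> Fpow E" using that hx by (auto simp: Fpow_def intro: finite_subset)
    then have "P \<in> h ` fst S" using bij_betw_imp_surj_on[OF h(1)] by simp
    then obtain y where y: "P = h y" "y \<in> fst S" by (elim imageE)
    have "(y, x) \<in> snd S" using h(2)[rule_format, OF y(2) xS] that y(1) by simp
    then show ?thesis using that y by (intro exI[of _ y]) auto
  qed
  have eq: "P = Q" if P: "P \<subset> h x" and Q: "Q \<subset> h x" for P Q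
  proof -
    obtain y where y: "y \<in> fst S \<and> (y, x) \<in> snd S \<and> y \<noteq> x" "h y = P"
      using below_x[OF P] by auto
    obtain z where z: "z \<in> fst S \<and> (z, x) \<in> snd S \<and> z \<noteq> x" "h z = Q"
      using below_x[OF Q] by auto
    have "y = z" by (rule HOL.ex1E[OF uniq]) (use y(1) z(1) in blast)
    then show ?thesis using y(2) z(2) by simp
  qed
  obtain y where y: "y \<in> fst S" "(y, x) \<in> snd S" "y \<noteq> x" using uniq by blast
  have "h y \<noteq> h x" using y xS bij_betw_imp_inj_on[OF h(1)] by (auto dest: inj_onD)
  then have "h y \<subset> h x" using h(2)[rule_format, OF y(1) xS] y(2) by simp
  then obtain e where e: "e \<in> h x" by blast
  have "h x - {e} = {}" by (rule eq) (use e in auto)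
  then show ?thesis using e by blast
qed

text \<open>The join is the preimage of the union of the images of \<open>F\<close>. Atoms being
  singletons, an atom below this union is one of \<open>F\<close>.\<close>

lemma atoms_join:
  fixes S :: "'b rel_structure"
  assumes "finite_powerset_lattice S" "finite F" "F \<subseteq> atoms S"
  shows "\<exists>J\<in>fst S. \<forall>X\<in>atoms S. (X, J) \<in> snd S \<longleftrightarrow> X \<in> F"
proof -
  obtain E :: "'b set" where "iso_to_Fpow S E"
    using assms(1) unfolding finite_powerset_lattice_def by (elim exE)
  then obtain h where h: "bij_betw h (fst S) (Fpow E)"
    "\<forall>x\<in>fst S. \<forall>y\<in>fst S. (x, y) \<in> snd S \<longleftrightarrow> h x \<subseteq> h y"
    unfolding iso_to_Fpow_def by (elim exE conjE)
  have At: "atoms S \<subseteq> fst S" by (auto simp: atoms_def)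
  have "h x \<in> Fpow E" if "x \<in> F" for x
    by (rule bspec[OF bij_betwE[OF h(1)]]) (use that assms(3) At in blast)
  then have "\<Union>(h ` F) \<in> Fpow E" using assms(2) by (auto simp: Fpow_def)
  then have "\<Union>(h ` F) \<in> h ` fst S" using bij_betw_imp_surj_on[OF h(1)] by simp
  then obtain J where J: "\<Union>(h ` F) = h J" "J \<in> fst S" by (elim imageE)
  have "(X, J) \<in> snd S \<longleftrightarrow> X \<in> F" if X: "X \<in> atoms S" for X
  proof
    have XS: "X \<in> fst S" using X At by blast
    assume "(X, J) \<in> snd S"
    then have sub: "h X \<subseteq> \<Union>(h ` F)" using h(2)[rule_format, OF XS J(2)] J(1) by simp
    obtain e where e: "h X = {e}" using atom_singleton[OF h X] by blast
    then obtain Y where Y: "Y \<in> F" "e \<in> h Y" using sub by blast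
    have YS: "Y \<in> atoms S" using Y(1) assms(3) by blast
    obtain e' where "h Y = {e'}" using atom_singleton[OF h YS] by blast
    then have "h X = h Y" using e Y(2) by simp
    then have "X = Y" using inj_onD[OF bij_betw_imp_inj_on[OF h(1)]] XS YS At by blast
    then show "X \<in> F" using Y by simp
  next
    assume "X \<in> F"
    then have "h X \<subseteq> h J" using J(1) by auto
    moreover have "X \<in> fst S" using X At by blast
    ultimately show "(X, J) \<in> snd S" using h(2)[rule_format, OF _ J(2)] by simp
  qed
  then show ?thesis using J(2) by (intro bexI[of _ J]) simp_all
qed

lemma fst_interp: "U \<in> fst (interp \<delta> \<phi> t) \<longleftrightarrow> U \<in> Fpow (dom t) \<and> sat_X t \<delta> U"
  by (simp add: interp_def Let_def)

lemma snd_interp: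
  "U \<in> fst (interp \<delta> \<phi> t) \<Longrightarrow> V \<in> fst (interp \<delta> \<phi> t) \<Longrightarrow> (U, V) \<in> snd (interp \<delta> \<phi> t) \<longleftrightarrow> sat_XY t \<phi> U V"
  by (simp add: interp_def Let_def)

lemma atoms_interp_Fpow: "atoms (interp \<delta> \<phi> t) \<subseteq> Fpow (dom t)"
  using fst_interp by (auto simp: atoms_def)

lemma sat_X_iff:
  assumes "finite_sets_interpretation \<delta> \<phi>"
  shows "sat_X t \<delta> (s 0) \<longleftrightarrow> sat t e s \<delta>"
  unfolding sat_X_def by (rule sat_cong) (use assms in \<open>auto simp: finite_sets_interpretation_def\<close>)

lemma sat_XY_iff:
  assumes "finite_sets_interpretation \<delta> \<phi>"
  shows "sat_XY t \<phi> (s 0) (s 1) \<longleftrightarrow> sat t e s \<phi>"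
  unfolding sat_XY_def by (rule sat_cong) (use assms in \<open>auto simp: finite_sets_interpretation_def\<close>)

lemma dfn_atoms:
  assumes "finite_sets_interpretation \<delta> \<phi>"
  shows "dfn TT (\<lambda>t e s. s 0 \<in> atoms (interp \<delta> \<phi> t))"
proof -
  have "dfn TT (\<lambda>t e s. sat_X t \<delta> (s 0))"
    by (rule dfnI[of _ \<delta>]) (rule sat_X_iff[OF assms, symmetric])
  then have X: "dfn TT (\<lambda>t e s. sat_X t \<delta> (s X))" for X
    using dfn_rename[where g = "\<lambda>_. X"] by fastforce
  have "dfn TT (\<lambda>t e s. sat_XY t \<phi> (s 0) (s 1))"
    by (rule dfnI[of _ \<phi>]) (rule sat_XY_iff[OF assms, symmetric])
  then have XY: "dfn TT (\<lambda>t e s. sat_XY t \<phi> (s X) (s Y))" for X Y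
    using dfn_rename[where g = "\<lambda>n. if n = 0 then X else Y"] by fastforce
  have "dfn TT (\<lambda>t e s. sat_X t \<delta> (s 0) \<and>
      (\<exists>V\<in>Fpow (dom t). (sat_X t \<delta> V \<and> sat_XY t \<phi> V (s 0) \<and> V \<noteq> s 0) \<and>
        (\<forall>W\<in>Fpow (dom t). sat_X t \<delta> W \<and> sat_XY t \<phi> W (s 0) \<and> W \<noteq> s 0 \<longrightarrow> W = V)))"
    by (rule dfn_conj, rule X, rule dfn_exS, rule dfn_conj, rule dfn_conj, rule X, rule dfn_conj, rule XY,
        rule dfn_not, rule dfn_set_eq, rule dfn_allS, rule dfn_imp, rule dfn_conj, rule X, rule dfn_conj,
        rule XY, rule dfn_not, rule dfn_set_eq, rule dfn_set_eq)
  then show ?thesis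
  proof (rule dfn_cong)
    fix t :: "'a tree" and e :: "nat \<Rightarrow> node" and s assume "env t e s"
    then have s: "s 0 \<in> Fpow (dom t)" by (simp add: env_def)
    let ?A = "fst (interp \<delta> \<phi> t)" and ?R = "snd (interp \<delta> \<phi> t)"
    let ?Q = "\<lambda>V. sat_X t \<delta> V \<and> sat_XY t \<phi> V (s 0) \<and> V \<noteq> s 0"
    have Q: "V \<in> ?A \<and> (V, s 0) \<in> ?R \<and> V \<noteq> s 0 \<longleftrightarrow> V \<in> Fpow (dom t) \<and> ?Q V" if "s 0 \<in> ?A" for V
      using snd_interp[OF _ that, of V] fst_interp[of V] by blast
    have "s 0 \<in> atoms (interp \<delta> \<phi> t) \<longleftrightarrow> s 0 \<in> ?A \<and> (\<exists>!V. V \<in> ?A \<and> (V, s 0) \<in> ?R \<and> V \<noteq> s 0)"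
      by (simp add: atoms_def)
    also have "\<dots> \<longleftrightarrow> s 0 \<in> ?A \<and> (\<exists>!V. V \<in> Fpow (dom t) \<and> ?Q V)"
      by (rule conj_cong[OF refl]) (simp only: Q)
    also have "\<dots> \<longleftrightarrow> sat_X t \<delta> (s 0) \<and> (\<exists>!V. V \<in> Fpow (dom t) \<and> ?Q V)"
      using s by (simp add: fst_interp)
    also have "(\<exists>!V. V \<in> Fpow (dom t) \<and> ?Q V) \<longleftrightarrow>
      (\<exists>V\<in>Fpow (dom t). ?Q V \<and> (\<forall>W\<in>Fpow (dom t). ?Q W \<longrightarrow> W = V))"
      by (rule iffI) blast+
    finally show "(sat_X t \<delta> (s 0) \<and> (\<exists>V\<in>Fpow (dom t). ?Q V \<and> (\<forall>W\<in>Fpow (dom t). ?Q W \<longrightarrow> W = V)))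
      \<longleftrightarrow> s 0 \<in> atoms (interp \<delta> \<phi> t)" by (rule sym)
  qed
qed

lemma ex_definable_atoms:
  assumes fsi: "finite_sets_interpretation \<delta> \<phi>"
  shows "\<exists>N. definable_atoms {t. is_tree t \<and> finite_powerset_lattice (interp \<delta> \<phi> t) \<and> dom t \<noteq> {}}
    (\<lambda>t. atoms (interp \<delta> \<phi> t)) N"
proof -
  \<comment> \<open>The empty tree is left out because it has no root and no environments; the
    theorem treats it separately.\<close>
  let ?TT = "{t. is_tree t \<and> finite_powerset_lattice (interp \<delta> \<phi> t) \<and> dom t \<noteq> {}}"
  have dfn: "dfn ?TT (\<lambda>t e s. s 0 \<in> atoms (interp \<delta> \<phi> t))" by (rule dfn_atoms[OF fsi])
  then obtain \<psi> where \<psi>: "\<forall>t\<in>?TT. \<forall>e s. env t e s \<longrightarrow> (sat t e s \<psi> \<longleftrightarrow> s 0 \<in> atoms (interp \<delta> \<phi> t))"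
    unfolding dfn_def by (elim exE)
  obtain N1 where N1: "\<forall>t u. \<exists>c::(nat \<Rightarrow> node set) \<Rightarrow> nat. (\<forall>s. c s < N1) \<and>
     (\<forall>s1 s2 s. c s1 = c s2 \<longrightarrow>
        (sat t (\<lambda>_. u) (\<lambda>X. mix (below u) (s1 X) (s X)) \<psi> \<longleftrightarrow>
         sat t (\<lambda>_. u) (\<lambda>X. mix (below u) (s2 X) (s X)) \<psi>))"
    using finite_index[of \<psi>] by (elim exE)
  obtain N2 where N2: "\<forall>t u. \<exists>c::(nat \<Rightarrow> node set) \<Rightarrow> nat. (\<forall>s. c s < N2) \<and>
     (\<forall>s1 s2 s. c s1 = c s2 \<longrightarrow>
        (sat t (\<lambda>_. u) (\<lambda>X. mix (below u) (s1 X) (s X)) \<phi> \<longleftrightarrow>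
         sat t (\<lambda>_. u) (\<lambda>X. mix (below u) (s2 X) (s X)) \<phi>))"
    using finite_index[of \<phi>] by (elim exE)
  have sys: "atom_system (dom t) (atoms (interp \<delta> \<phi> t)) (sat_XY t \<phi>) (max N1 N2)" if t: "t \<in> ?TT" for t
  proof
    have tree: "is_tree t" and lat: "finite_powerset_lattice (interp \<delta> \<phi> t)" and ne: "dom t \<noteq> {}"
      using t by auto
    show closed: "u \<in> dom t" if "v \<in> dom t" "prefix u v" for u v
      using tree that unfolding is_tree_def by blast
    show "[] \<in> dom t" using ne closed[OF _ Nil_prefix] by blast
    show "atoms (interp \<delta> \<phi> t) \<subseteq> Fpow (dom t)" by (rule atoms_interp_Fpow)
  next
    fix F assume F: "finite F" "F \<subseteq> atoms (interp \<delta> \<phi> t)"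
    have "finite_powerset_lattice (interp \<delta> \<phi> t)" using t by simp
    from atoms_join[OF this F] obtain J where J: "J \<in> fst (interp \<delta> \<phi> t)"
      "\<forall>X\<in>atoms (interp \<delta> \<phi> t). (X, J) \<in> snd (interp \<delta> \<phi> t) \<longleftrightarrow> X \<in> F" by (elim bexE)
    have "sat_XY t \<phi> X J \<longleftrightarrow> X \<in> F" if "X \<in> atoms (interp \<delta> \<phi> t)" for X
      using J(1) J(2)[rule_format, OF that] that snd_interp[of X \<delta> \<phi> t J] by (auto simp: atoms_def)
    then show "\<exists>J\<in>Fpow (dom t). \<forall>X\<in>atoms (interp \<delta> \<phi> t). sat_XY t \<phi> X J \<longleftrightarrow> X \<in> F"
      using J(1) fst_interp[of J \<delta> \<phi> t] by (intro bexI[of _ J]) auto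
  next
    fix u assume u: "u \<in> dom t"
    obtain c :: "(nat \<Rightarrow> node set) \<Rightarrow> nat" where c: "\<forall>s. c s < N1"
      "\<forall>s1 s2 s. c s1 = c s2 \<longrightarrow>
        (sat t (\<lambda>_. u) (\<lambda>X. mix (below u) (s1 X) (s X)) \<psi> \<longleftrightarrow>
         sat t (\<lambda>_. u) (\<lambda>X. mix (below u) (s2 X) (s X)) \<psi>)"
      using N1[rule_format, of t u] by (elim exE conjE)
    let ?s = "\<lambda>X. (\<lambda>_. {})(0 := X) :: nat \<Rightarrow> node set"
    have m: "(\<lambda>V. mix (below u) (?s X V) (?s W V)) = ?s (mix (below u) X W)" for X W
      by (auto simp: fun_eq_iff)
    \<comment> \<open>Stray variables of \<psi> receive the values \<open>u\<close> and
      \<open>{}\<close>, which lie in the tree, as the characterisation of \<psi> demands.\<close>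
    have sat: "sat t (\<lambda>_. u) (?s X) \<psi> \<longleftrightarrow> X \<in> atoms (interp \<delta> \<phi> t)" if "X \<in> Fpow (dom t)" for X
    proof -
      have "env t (\<lambda>_. u) (?s X)" using that u by (auto simp: env_def Fpow_def)
      then show ?thesis using \<psi> t by simp
    qed
    have "eqv (dom t) (atoms (interp \<delta> \<phi> t)) u X Y"
      if "X \<in> Fpow (dom t)" "Y \<in> Fpow (dom t)" "c (?s X) = c (?s Y)" for X Y
      unfolding eqv_def
    proof
      fix W assume W: "W \<in> Fpow (dom t)"
      from c(2)[rule_format, OF that(3), of "?s W"]
      show "mix (below u) X W \<in> atoms (interp \<delta> \<phi> t) \<longleftrightarrow> mix (below u) Y W \<in> atoms (interp \<delta> \<phi> t)"
        unfolding m sat[OF mix_Fpow[OF that(1) W]] sat[OF mix_Fpow[OF that(2) W]] .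
    qed
    moreover have "c s < max N1 N2" for s using c(1) less_max_iff_disj by blast
    ultimately show "\<exists>c. (\<forall>X. c X < max N1 N2) \<and> (\<forall>X\<in>Fpow (dom t). \<forall>Y\<in>Fpow (dom t).
        c X = c Y \<longrightarrow> eqv (dom t) (atoms (interp \<delta> \<phi> t)) u X Y)"
      by (intro exI[of _ "\<lambda>X. c (?s X)"]) simp
  next
    fix u assume u: "u \<in> dom t"
    obtain c :: "(nat \<Rightarrow> node set) \<Rightarrow> nat" where c: "\<forall>s. c s < N2"
      "\<forall>s1 s2 s. c s1 = c s2 \<longrightarrow>
        (sat t (\<lambda>_. u) (\<lambda>X. mix (below u) (s1 X) (s X)) \<phi> \<longleftrightarrow>
         sat t (\<lambda>_. u) (\<lambda>X. mix (below u) (s2 X) (s X)) \<phi>)"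
      using N2[rule_format, of t u] by (elim exE conjE)
    let ?s = "\<lambda>X J. (\<lambda>_. {})(0 := X, 1 := J) :: nat \<Rightarrow> node set"
    have m: "(\<lambda>V. mix (below u) (?s X J V) (?s W Z V)) = ?s (mix (below u) X W) (mix (below u) J Z)" for X J W Z
      by (auto simp: fun_eq_iff)
    have sat: "sat t (\<lambda>_. u) (?s X J) \<phi> \<longleftrightarrow> sat_XY t \<phi> X J" for X J
      using sat_XY_iff[OF fsi, of t "?s X J" "\<lambda>_. u"] by simp
    have "sat_XY t \<phi> (mix (below u) X W) (mix (below u) J Z) \<longleftrightarrow>
        sat_XY t \<phi> (mix (below u) X' W) (mix (below u) J' Z)"
      if "c (?s X J) = c (?s X' J')" for X J X' J' W Z
      using c(2)[rule_format, OF that, of "?s W Z"] unfolding m sat .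
    moreover have "c s < max N1 N2" for s using c(1) less_max_iff_disj by blast
    ultimately show "\<exists>c. (\<forall>X J. c X J < max N1 N2) \<and> (\<forall>X J X' J' W Z. c X J = c X' J' \<longrightarrow>
        sat_XY t \<phi> (mix (below u) X W) (mix (below u) J Z) \<longleftrightarrow>
        sat_XY t \<phi> (mix (below u) X' W) (mix (below u) J' Z))"
      by (intro exI[of _ "\<lambda>X J. c (?s X J)"] conjI allI impI)
  qed
  have "definable_atoms ?TT (\<lambda>t. atoms (interp \<delta> \<phi> t)) (max N1 N2)"
  proof
    show "is_tree t" if "t \<in> ?TT" for t using that by simp
    show "dfn ?TT (\<lambda>t e s. s 0 \<in> atoms (interp \<delta> \<phi> t))" by (rule dfn)
    show "\<exists>le. atom_system (dom t) (atoms (interp \<delta> \<phi> t)) le (max N1 N2)" if "t \<in> ?TT" for t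
      by (rule exI[of _ "sat_XY t \<phi>"]) (rule sys[OF that])
  qed
  then show ?thesis by (rule exI[of _ "max N1 N2"])
qed

theorem theorem4p3:
  fixes \<delta> \<phi> :: "'a::finite wmso"
  assumes "finite_sets_interpretation \<delta> \<phi>"
  shows "\<exists>Code :: 'a wmso.
           free_elem Code \<subseteq> {0} \<and> free_set Code \<subseteq> {0} \<and>
           (\<forall>t. is_tree t \<longrightarrow> finite_powerset_lattice (interp \<delta> \<phi> t) \<longrightarrow>
              (\<forall>X\<in>atoms (interp \<delta> \<phi> t). \<exists>!x. x \<in> dom t \<and> sat_Xx t Code X x) \<and>
              (\<forall>X\<in>atoms (interp \<delta> \<phi> t). \<forall>Y\<in>atoms (interp \<delta> \<phi> t). \<forall>x\<in>dom t.
                 sat_Xx t Code X x \<longrightarrow> sat_Xx t Code Y x \<longrightarrow> X = Y))"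
proof -
  let ?At = "\<lambda>t. atoms (interp \<delta> \<phi> t)"
  obtain N where "definable_atoms {t. is_tree t \<and> finite_powerset_lattice (interp \<delta> \<phi> t) \<and> dom t \<noteq> {}} ?At N"
    (is "definable_atoms ?TT _ _")
    using ex_definable_atoms[OF assms] by (elim exE)
  then interpret definable_atoms ?TT ?At N .
  obtain \<psi> where \<psi>: "\<forall>t\<in>?TT. \<forall>e s. env t e s \<longrightarrow> (sat t e s \<psi> \<longleftrightarrow> encodes (dom t) (?At t) N (s 0) (e 0))"
    using dfn_encodes[of 0 0] unfolding dfn_def by (elim exE)
  \<comment> \<open>Renaming all variables to 0 removes stray ones. The meaning is kept, since
    \<psi> expresses a property of variables 0 in every environment, in particular in the constant
    ones.\<close>
  obtain Code where Code: "free_elem Code \<subseteq> (\<lambda>_. 0) ` free_elem \<psi>" "free_set Code \<subseteq> (\<lambda>_. 0) ` free_set \<psi>"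
    "\<forall>t e s. sat t e s Code \<longleftrightarrow> sat t (e \<circ> (\<lambda>_. 0)) (s \<circ> (\<lambda>_. 0)) \<psi>"
    using wmso_subst[of "\<lambda>_. 0" \<psi> "\<lambda>_. 0"] by (elim exE conjE)
  have Code_iff: "sat_Xx t Code X x \<longleftrightarrow> encodes (dom t) (?At t) N X x"
    if "t \<in> ?TT" "X \<in> ?At t" "x \<in> dom t" for t X x
  proof -
    have "env t (\<lambda>_. x) (\<lambda>_. X)" using that atoms_interp_Fpow by (auto simp: env_def)
    with \<psi> that(1) have "sat t (\<lambda>_. x) (\<lambda>_. X) \<psi> \<longleftrightarrow> encodes (dom t) (?At t) N X x" by blast
    then show ?thesis unfolding sat_Xx_def using Code(3) by (simp add: o_def)
  qed
  show ?thesis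
  proof (intro exI[of _ Code] conjI allI impI)
    show "free_elem Code \<subseteq> {0}" "free_set Code \<subseteq> {0}" using Code(1,2) by auto
    fix t assume t: "is_tree t" "finite_powerset_lattice (interp \<delta> \<phi> t)"
    have TT: "t \<in> ?TT" if "X \<in> ?At t" for X
    proof -
      \<comment> \<open>In the empty tree only the empty set can be an element, so nothing has an
        element strictly below it and there are no atoms.\<close>
      have False if "dom t = {}"
      proof -
        have "U = {}" if "U \<in> fst (interp \<delta> \<phi> t)" for U
          using that \<open>dom t = {}\<close> by (simp add: fst_interp Fpow_def)
        then show False using \<open>X \<in> ?At t\<close> unfolding atoms_def by blast
      qed
      then show ?thesis using t by blast
    qed
    show "\<forall>X\<in>?At t. \<exists>!x. x \<in> dom t \<and> sat_Xx t Code X x"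
    proof
      fix X assume X: "X \<in> ?At t"
      obtain le where "atom_system (dom t) (?At t) le N" using atom_system[OF TT[OF X]] by (elim exE)
      from atom_system.ex1_encodes[OF this X]
      show "\<exists>!x. x \<in> dom t \<and> sat_Xx t Code X x"
        using Code_iff[OF TT[OF X] X] by (simp cong: conj_cong)
    qed
    show "\<forall>X\<in>?At t. \<forall>Y\<in>?At t. \<forall>x\<in>dom t. sat_Xx t Code X x \<longrightarrow> sat_Xx t Code Y x \<longrightarrow> X = Y"
    proof (intro ballI impI)
      fix X Y x assume XY: "X \<in> ?At t" "Y \<in> ?At t" "x \<in> dom t" "sat_Xx t Code X x" "sat_Xx t Code Y x"
      obtain le where "atom_system (dom t) (?At t) le N" using atom_system[OF TT[OF XY(1)]] by (elim exE)
      from atom_system.encodes_inj[OF this XY(1,2)]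
      show "X = Y" using XY Code_iff[OF TT[OF XY(1)]] by blast
    qed
  qed
qed

end
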